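(* Let $1\le r\le k$ and $0\le t\le1$. For any function $f:\Sigma_N^2\to\mathbb{R}$ we have $$\mu_r(f)=\mathbb{E}\langle f\rangle_r,$$ where $\langle\cdot\rangle_r$ is the average with respect to the Gibbs measure $\Gamma_r$ on $\Sigma_N^2\times\mathbb{N}^k$; in particular, $$\mu_r\bigl(\Delta(R_{1,2},q_r)\bigr)=\mathbb{E}\langle\Delta(R_{1,2},q_r)\rangle_r.$$
   Context: Setting. Let $N\ge1$, $\Sigma_N=\{-1,+1\}^N$, and for $\vec\sigma^1,\vec\sigma^2\in\Sigma_N$ let $R_{1,2}=\frac1N\sum_{i\le N}\sigma^1_i\sigma^2_i$. Let $\xi$ be a smooth convex function with $\xi(0)=0$, and let $(H_N(\vec\sigma))_{\vec\sigma\in\Sigma_N}$ be a centered Gaussian process with $\mathbb{E}H_N(\vec\sigma^1)H_N(\vec\sigma^2)=N\xi(R_{1,2})$. Put $\theta(x)=x\xi'(x)-\xi(x)$ and $\Delta(a,b)=\xi(a)-a\xi'(b)+\theta(b)$. Let $k\ge1$, $0=m_0<m_1<\dots<m_k<1$ and $0=q_0<q_1<\dots<q_k<q_{k+1}=1$. Let $Z=(z_{il})$, $1\le i\le N$, $0\le l\le k$, be a matrix of independent centered Gaussian variables with $\mathbb{E}z_{il}^2=\xi'(q_{l+1})-\xi'(q_l)$, independent of $H_N$. Fix $1\le r\le k$ and let $Z^1,Z^2$ be two copies of $Z$ such that for all $i\le N$, $z^1_{il}=z^2_{il}$ for $l\le r-1$ and $z^1_{il},z^2_{il}$ are independent for $l\ge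 r$ (i.e. columns $0,\dots,r-1$ coincide and all other columns are independent). Definition of $\mu_r$. With $s=(s_1,\dots,s_N)$, $s_i=\sum_{0\le l\le k}z_{il}$, let $H_t(\vec\sigma)=\sqrt t\,H_N(\vec\sigma)+\sqrt{1-t}\,s\cdot\vec\sigma$, $X_k=\log\sum_{\vec\sigma\in\Sigma_N}\exp H_t(\vec\sigma)$, and recursively for $1\le l\le k$, $X_{l-1}=\frac1{m_l}\log\mathbb{E}_l\exp m_lX_l$, where $\mathbb{E}_l$ is expectation in $(z_{ip})$ for $1\le i\le N$, $l\le p\le k$ (all else fixed). Let $W_l=\exp m_l(X_l-X_{l-1})$ for $1\le l\le k$. Let $H_t^j,X_l^j,W_l^j$ ($j=1,2$) be defined in the same way with $Z^j$ in place of $Z$ (and the same $H_N$). For $f:\Sigma_N^2\to\mathbb{R}$, $$\mu_r(f)=\mathbb{E}\prod_{1\le l<r}W_l^1\prod_{r\le l\le k}W_l^1W_l^2\,\langle f\rangle,$$ where $\langle\cdot\rangle$ is the Gibbs average on $\Sigma_N^2$ with weights proportional to $\exp\bigl(H_t^1(\vec\sigma^1)+H_t^2(\vec\sigma^2)\bigr)$. Definition of $\Gamma_r$. Let $n_l=m_l/2$ for $l<r$ and $n_l=m_l$ for $r\le l\le k$. Let $(w^{(r)}_\alpha)_{\alpha\in\mathbb{N}^k}$ be the Derrida-Ruelle cascade weights with parameters $n_1<\dots<n_k$, that is: $(u_{j_1})_{j_1\ge1}$ is the decreasing enumeration of a Poisson point process on $(0,\infty)$ with intensity $x^{-1-n_1}dx$;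 recursively for $2\le l\le k$ and all $(j_1,\dots,j_{l-1})\in\mathbb{N}^{l-1}$, $(u_{j_1\dots j_l})_{j_l\ge1}$ are (decreasing enumerations of) independent Poisson point processes with intensity $x^{-1-n_l}dx$, independent of all previously constructed ones; for $\alpha=(j_1,\dots,j_k)$, $v_\alpha=\prod_{1\le l\le k}u_{j_1\dots j_l}$ and $w_\alpha^{(r)}=v_\alpha/\sum_\gamma v_\gamma$ (the sum is a.s. finite). Treat $(Z^1,Z^2)$ as a block matrix with $2N$ rows and with columns $\bar z_l=(z^1_l,z^2_l)$, $0\le l\le k$; let $(\bar z_{j_1})_{j_1\ge1}$ be i.i.d. copies of $\bar z_1$ and, for $2\le l\le k$ and all $(j_1,\dots,j_{l-1})$, let $(\bar z_{j_1\dots j_l})_{j_l\ge1}$ be independent sequences of i.i.d. copies of $\bar z_l$, independent of everything at earlier levels and of $\bar z_0$. For $\alpha=(j_1,\dots,j_k)$ let $(Z^1,Z^2)_\alpha=(\bar z_0,\bar z_{j_1},\dots,\bar z_{j_1\dots j_k})$, and let $s^{1,\alpha}$ and $s^{2,\alpha}$ in $\mathbb{R}^N$ be the sums over the columns $0\le l\le k$ of the first and of the second block of $N$ rows, respectively. The process $H_N$, the Gaussian columns and the cascade are mutually independent. Let $$H_t(\vec\sigma^1,\vec\sigma^2,\alpha)=\sqrt t\,H_N(\vec\sigma^1)+\sqrt{1-t}\,s^{1,\alpha}\cdot\vec\sigma^1+\sqrt t\,H_N(\vec\sigma^2)+\sqrt{1-t}\,s^{2,\alpha}\cdot\vec\sigma^2,$$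 and let $\Gamma_r$ be the random probability measure on $\Sigma_N^2\times\mathbb{N}^k$ with $\Gamma_r\{(\vec\sigma^1,\vec\sigma^2,\alpha)\}$ proportional to $w^{(r)}_\alpha\exp H_t(\vec\sigma^1,\vec\sigma^2,\alpha)$. *)

theory Defs
  imports "HOL-Probability.Probability"
begin

text \<open>
  The index \<open>N \<ge> 1\<close> is the cardinality of the finite type \<open>'n\<close>; configurations and the columns
  \<open>(z\<^sub>i\<^sub>l)\<^sub>i\<close> of the Gaussian matrices are vectors in \<^typ>\<open>real ^ 'n\<close>.
\<close>

definition spins :: "(real ^ 'n) set" where
  "spins = {\<sigma>. \<forall>i. \<sigma> $ i \<in> {-1, 1}}"

definition overlap :: "real ^ 'n \<Rightarrow> real ^ 'n \<Rightarrow> real" where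
  "overlap \<sigma> \<tau> = (\<Sum>i\<in>UNIV. \<sigma> $ i * \<tau> $ i) / real CARD('n)"

definition smooth :: "(real \<Rightarrow> real) \<Rightarrow> bool" where
  "smooth \<xi> \<longleftrightarrow> (\<forall>n x. ((deriv ^^ n) \<xi>) differentiable (at x))"

definition theta :: "(real \<Rightarrow> real) \<Rightarrow> real \<Rightarrow> real" where
  "theta \<xi> x = x * deriv \<xi> x - \<xi> x"

definition Delta :: "(real \<Rightarrow> real) \<Rightarrow> real \<Rightarrow> real \<Rightarrow> real" where
  "Delta \<xi> a b = \<xi> a - a * deriv \<xi> b + theta \<xi> b"

text \<open>
  The variance \<open>0\<close> is allowed, since \<open>\<xi>'(q\<^sub>l\<^sub>+\<^sub>1) - \<xi>'(q\<^sub>l)\<close> may vanish and the covariance of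
  \<open>H\<^sub>N\<close> may be singular.
\<close>

definition centered_normal :: "real \<Rightarrow> real measure" where
  "centered_normal v =
     (if v = 0 then return borel 0 else density lborel (\<lambda>x. ennreal (normal_density 0 (sqrt v) x)))"

definition centered_gaussian :: "'a measure \<Rightarrow> real \<Rightarrow> ('a \<Rightarrow> real) \<Rightarrow> bool" where
  "centered_gaussian M v X \<longleftrightarrow> X \<in> borel_measurable M \<and> distr M borel X = centered_normal v"

definition centered_gaussian_process :: "'a measure \<Rightarrow> 'i set \<Rightarrow> ('i \<Rightarrow> 'a \<Rightarrow> real) \<Rightarrow> bool" where
  "centered_gaussian_process M I X \<longleftrightarrow>
     (\<forall>i\<in>I. X i \<in> borel_measurable M) \<and>
     (\<forall>J a. finite J \<and> J \<subseteq> I \<longrightarrow>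
        (\<exists>v\<ge>0. centered_gaussian M v (\<lambda>\<omega>. \<Sum>i\<in>J. a i * X i \<omega>)))"

text \<open>
  \<^const>\<open>prob_space.indep_var\<close> forces all variables into one type; the following
  are its analogues for variables with values in different types.
\<close>

definition preimages :: "'a measure \<Rightarrow> 'b measure \<Rightarrow> ('a \<Rightarrow> 'b) \<Rightarrow> 'a set set" where
  "preimages M S X = {X -` A \<inter> space M | A. A \<in> sets S}"

definition indep_pair ::
  "'a measure \<Rightarrow> 'b measure \<Rightarrow> ('a \<Rightarrow> 'b) \<Rightarrow> 'c measure \<Rightarrow> ('a \<Rightarrow> 'c) \<Rightarrow> bool" where
  "indep_pair M S X T Y \<longleftrightarrow>
     X \<in> measurable M S \<and> Y \<in> measurable M T \<and>
     prob_space.indep_set M (preimages M S X) (preimages M T Y)"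

definition indep_triple ::
  "'a measure \<Rightarrow> 'b measure \<Rightarrow> ('a \<Rightarrow> 'b) \<Rightarrow> 'c measure \<Rightarrow> ('a \<Rightarrow> 'c) \<Rightarrow>
     'd measure \<Rightarrow> ('a \<Rightarrow> 'd) \<Rightarrow> bool" where
  "indep_triple M S X T Y U V \<longleftrightarrow>
     X \<in> measurable M S \<and> Y \<in> measurable M T \<and> V \<in> measurable M U \<and>
     prob_space.indep_sets M
       (case_option (preimages M S X) (case_bool (preimages M T Y) (preimages M U V))) UNIV"

text \<open>
  Below, \<open>h\<close> is a realisation of \<open>(H\<^sub>N(\<sigma>))\<^sub>\<sigma>\<close> and \<open>z\<close> one of the sequence of columns of \<open>Z\<close>.
\<close>

definition Ht :: "real \<Rightarrow> (real ^ 'n \<Rightarrow> real) \<Rightarrow> real ^ 'n \<Rightarrow> real ^ 'n \<Rightarrow> real" where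
  "Ht t h s \<sigma> = sqrt t * h \<sigma> + sqrt (1 - t) * (s \<bullet> \<sigma>)"

text \<open>
  The expectation \<open>\<bbbE>\<^sub>l\<close> in the columns \<open>l, l + 1, \<dots>\<close> of the random matrix \<open>Z\<close> on \<open>M\<close>, of a
  functional \<open>G\<close> of the columns; the columns below \<open>l\<close> stay fixed at \<open>z\<close>.
\<close>

definition expect_from ::
  "'a measure \<Rightarrow> (nat \<Rightarrow> 'a \<Rightarrow> real ^ 'n) \<Rightarrow> nat \<Rightarrow>
     ((nat \<Rightarrow> real ^ 'n) \<Rightarrow> real) \<Rightarrow> (nat \<Rightarrow> real ^ 'n) \<Rightarrow> real" where
  "expect_from M Z l G z = (\<integral>\<omega>. G (\<lambda>p. if p < l then z p else Z p \<omega>) \<partial>M)"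

text \<open>\<open>X\<^sub>l\<close> as a functional of \<open>h\<close> and \<open>z\<close>.\<close>

function (sequential) Xfun ::
  "'a measure \<Rightarrow> nat \<Rightarrow> (nat \<Rightarrow> real) \<Rightarrow> real \<Rightarrow> (nat \<Rightarrow> 'a \<Rightarrow> real ^ 'n) \<Rightarrow> (real ^ 'n \<Rightarrow> real) \<Rightarrow>
     nat \<Rightarrow> (nat \<Rightarrow> real ^ 'n) \<Rightarrow> real" where
  "Xfun M k m t Z h l =
     (if l < k
      then (\<lambda>z. 1 / m (l + 1) *
                ln (expect_from M Z (l + 1) (\<lambda>y. exp (m (l + 1) * Xfun M k m t Z h (l + 1) y)) z))
      else (\<lambda>z. ln (\<Sum>\<sigma>\<in>spins. exp (Ht t h (\<Sum>p\<le>k. z p) \<sigma>))))"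
  by pat_completeness auto
termination by (relation "Wellfounded.measure (\<lambda>(M, k, m, t, Z, h, l). k - l)") auto

declare Xfun.simps [simp del]

definition Wfun ::
  "'a measure \<Rightarrow> nat \<Rightarrow> (nat \<Rightarrow> real) \<Rightarrow> real \<Rightarrow> (nat \<Rightarrow> 'a \<Rightarrow> real ^ 'n) \<Rightarrow> (real ^ 'n \<Rightarrow> real) \<Rightarrow>
     nat \<Rightarrow> (nat \<Rightarrow> real ^ 'n) \<Rightarrow> real" where
  "Wfun M k m t Z h l z = exp (m l * (Xfun M k m t Z h l z - Xfun M k m t Z h (l - 1) z))"

definition gibbs2 ::
  "real \<Rightarrow> (real ^ 'n \<Rightarrow> real) \<Rightarrow> real ^ 'n \<Rightarrow> real ^ 'n \<Rightarrow> (real ^ 'n \<Rightarrow> real ^ 'n \<Rightarrow> real) \<Rightarrow> real" where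
  "gibbs2 t h s1 s2 f =
     (\<Sum>\<sigma>\<in>spins. \<Sum>\<tau>\<in>spins. f \<sigma> \<tau> * exp (Ht t h s1 \<sigma> + Ht t h s2 \<tau>)) /
     (\<Sum>\<sigma>\<in>spins. \<Sum>\<tau>\<in>spins. exp (Ht t h s1 \<sigma> + Ht t h s2 \<tau>))"

text \<open>\<open>Z 1 l\<close> and \<open>Z 2 l\<close> are the \<open>l\<close>-th columns of \<open>Z\<^sup>1\<close> and \<open>Z\<^sup>2\<close>.\<close>

definition mu ::
  "'a measure \<Rightarrow> nat \<Rightarrow> (nat \<Rightarrow> real) \<Rightarrow> real \<Rightarrow> (real ^ 'n \<Rightarrow> 'a \<Rightarrow> real) \<Rightarrow>
     (nat \<Rightarrow> nat \<Rightarrow> 'a \<Rightarrow> real ^ 'n) \<Rightarrow> nat \<Rightarrow> (real ^ 'n \<Rightarrow> real ^ 'n \<Rightarrow> real) \<Rightarrow> real" where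
  "mu M k m t H Z r f =
     (\<integral>\<omega>. (let h = (\<lambda>\<sigma>. H \<sigma> \<omega>);
               W = (\<lambda>j l. Wfun M k m t (Z j) h l (\<lambda>p. Z j p \<omega>))
           in (\<Prod>l\<in>{1..<r}. W 1 l) * (\<Prod>l\<in>{r..k}. W 1 l * W 2 l) *
              gibbs2 t h (\<Sum>l\<le>k. Z 1 l \<omega>) (\<Sum>l\<le>k. Z 2 l \<omega>) f) \<partial>M)"

definition intensity :: "real \<Rightarrow> real measure" where
  "intensity n = density lborel (\<lambda>x. ennreal (indicator {0<..} x * x powr (-1 - n)))"

text \<open>The number of points in \<open>A\<close>, with multiplicity; it may be infinite.\<close>

definition num_points :: "(nat \<Rightarrow> 'a \<Rightarrow> real) \<Rightarrow> real set \<Rightarrow> 'a \<Rightarrow> ennreal" where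
  "num_points U A \<omega> = emeasure (count_space UNIV) {j. U j \<omega> \<in> A}"

definition poisson_variable :: "'a measure \<Rightarrow> ennreal \<Rightarrow> ('a \<Rightarrow> ennreal) \<Rightarrow> bool" where
  "poisson_variable M \<Lambda> X \<longleftrightarrow> X \<in> borel_measurable M \<and>
     (if \<Lambda> = \<infinity> then AE \<omega> in M. X \<omega> = \<infinity>
      else \<forall>n::nat. measure M {\<omega> \<in> space M. X \<omega> = of_nat n} =
                    enn2real \<Lambda> ^ n / fact n * exp (- enn2real \<Lambda>))"

definition decreasing_poisson_process :: "'a measure \<Rightarrow> real \<Rightarrow> (nat \<Rightarrow> 'a \<Rightarrow> real) \<Rightarrow> bool" where
  "decreasing_poisson_process M n U \<longleftrightarrow>
     (\<forall>j. U j \<in> borel_measurable M) \<and>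
     (AE \<omega> in M. \<forall>j. 0 < U j \<omega> \<and> U (Suc j) \<omega> \<le> U j \<omega>) \<and>
     (\<forall>A\<in>sets borel. A \<subseteq> {0<..} \<longrightarrow>
        poisson_variable M (emeasure (intensity n) A) (num_points U A)) \<and>
     (\<forall>d (A :: nat \<Rightarrow> real set).
        (\<forall>i<d. A i \<in> sets borel \<and> A i \<subseteq> {0<..}) \<and> disjoint_family_on A {..<d} \<longrightarrow>
        prob_space.indep_vars M (\<lambda>_. borel) (\<lambda>i. num_points U (A i)) {..<d})"

text \<open>
  \<open>u\<^sub>j\<^sub>1\<^sub>\<dots>\<^sub>j\<^sub>l\<close> is \<open>u [j\<^sub>1, \<dots>, j\<^sub>l]\<close>, with indices starting at \<open>0\<close>; \<open>\<nat>\<^sup>k\<close> is the set of lists of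
  length \<open>k\<close>. The sequence of children of the node \<open>\<beta>\<close> has parameter \<open>n (length \<beta> + 1)\<close>.
\<close>

definition poisson_cascade ::
  "'a measure \<Rightarrow> nat \<Rightarrow> (nat \<Rightarrow> real) \<Rightarrow> (nat list \<Rightarrow> 'a \<Rightarrow> real) \<Rightarrow> bool" where
  "poisson_cascade M k n u \<longleftrightarrow>
     (\<forall>\<beta>. length \<beta> < k \<longrightarrow>
        decreasing_poisson_process M (n (length \<beta> + 1)) (\<lambda>j. u (\<beta> @ [j]))) \<and>
     prob_space.indep_vars M (\<lambda>_. \<Pi>\<^sub>M j\<in>UNIV. borel) (\<lambda>\<beta> \<omega> j. u (\<beta> @ [j]) \<omega>) {\<beta>. length \<beta> < k}"

definition cascade_param :: "nat \<Rightarrow> (nat \<Rightarrow> real) \<Rightarrow> nat \<Rightarrow> real" where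
  "cascade_param r m l = (if l < r then m l / 2 else m l)"

definition cascade_v :: "nat \<Rightarrow> (nat list \<Rightarrow> 'a \<Rightarrow> real) \<Rightarrow> 'a \<Rightarrow> nat list \<Rightarrow> real" where
  "cascade_v k u \<omega> \<alpha> = (\<Prod>l\<in>{1..k}. u (take l \<alpha>) \<omega>)"

definition cascade_weight :: "nat \<Rightarrow> (nat list \<Rightarrow> 'a \<Rightarrow> real) \<Rightarrow> 'a \<Rightarrow> nat list \<Rightarrow> real" where
  "cascade_weight k u \<omega> \<alpha> =
     cascade_v k u \<omega> \<alpha> / (\<Sum>\<^sub>\<infinity>\<gamma>\<in>{\<gamma>. length \<gamma> = k}. cascade_v k u \<omega> \<gamma>)"

text \<open>
  \<open>zb \<beta>\<close> is the copy of the column \<open>(z\<^sup>1\<^sub>l, z\<^sup>2\<^sub>l)\<close>, \<open>l = length \<beta>\<close>, attached to the node \<open>\<beta>\<close>; the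
  root \<open>[]\<close> carries the column \<open>0\<close>.
\<close>

definition Gamma_unnormalized ::
  "nat \<Rightarrow> real \<Rightarrow> (real ^ 'n \<Rightarrow> 'a \<Rightarrow> real) \<Rightarrow> (nat list \<Rightarrow> 'a \<Rightarrow> (real ^ 'n) \<times> (real ^ 'n)) \<Rightarrow>
     (nat list \<Rightarrow> 'a \<Rightarrow> real) \<Rightarrow> 'a \<Rightarrow> (real ^ 'n) \<times> (real ^ 'n) \<times> nat list \<Rightarrow> real" where
  "Gamma_unnormalized k t H zb u \<omega> = (\<lambda>(\<sigma>, \<tau>, \<alpha>).
     cascade_weight k u \<omega> \<alpha> *
     exp (Ht t (\<lambda>\<rho>. H \<rho> \<omega>) (\<Sum>l\<le>k. fst (zb (take l \<alpha>) \<omega>)) \<sigma> +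
          Ht t (\<lambda>\<rho>. H \<rho> \<omega>) (\<Sum>l\<le>k. snd (zb (take l \<alpha>) \<omega>)) \<tau>))"

definition Gamma_space :: "nat \<Rightarrow> ((real ^ 'n) \<times> (real ^ 'n) \<times> nat list) set" where
  "Gamma_space k = spins \<times> spins \<times> {\<alpha>. length \<alpha> = k}"

definition Gamma_measure ::
  "nat \<Rightarrow> real \<Rightarrow> (real ^ 'n \<Rightarrow> 'a \<Rightarrow> real) \<Rightarrow> (nat list \<Rightarrow> 'a \<Rightarrow> (real ^ 'n) \<times> (real ^ 'n)) \<Rightarrow>
     (nat list \<Rightarrow> 'a \<Rightarrow> real) \<Rightarrow> 'a \<Rightarrow> ((real ^ 'n) \<times> (real ^ 'n) \<times> nat list) measure" where
  "Gamma_measure k t H zb u \<omega> =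
     point_measure (Gamma_space k) (\<lambda>x. ennreal (Gamma_unnormalized k t H zb u \<omega> x /
       (\<Sum>\<^sub>\<infinity>y\<in>Gamma_space k. Gamma_unnormalized k t H zb u \<omega> y)))"

definition Gamma_average ::
  "nat \<Rightarrow> real \<Rightarrow> (real ^ 'n \<Rightarrow> 'a \<Rightarrow> real) \<Rightarrow> (nat list \<Rightarrow> 'a \<Rightarrow> (real ^ 'n) \<times> (real ^ 'n)) \<Rightarrow>
     (nat list \<Rightarrow> 'a \<Rightarrow> real) \<Rightarrow> (real ^ 'n \<Rightarrow> real ^ 'n \<Rightarrow> real) \<Rightarrow> 'a \<Rightarrow> real" where
  "Gamma_average k t H zb u f \<omega> = (\<integral>(\<sigma>, \<tau>, \<alpha>). f \<sigma> \<tau> \<partial>Gamma_measure k t H zb u \<omega>)"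

end

theory Submission
  imports Defs "HOL-Real_Asymp.Real_Asymp"
begin

text \<open>
  Write \<open>n\<^sub>l\<close> for the cascade parameters and \<open>Y\<^sub>l\<close> for the recursion
  \<open>Y\<^sub>l\<^sub>-\<^sub>1 = n\<^sub>l\<^sup>-\<^sup>1 log E\<^sub>l exp(n\<^sub>l Y\<^sub>l)\<close> started from \<open>Y\<^sub>k = log G\<close>. Given the root column,
  integrating out the marks and the Poisson points level by level from the leaves shows that
  \<open>T = \<Sum>\<^sub>\<alpha> v\<^sub>\<alpha> G(z\<^sub>\<alpha>)\<close> has the Laplace transform \<open>exp(-C (s exp Y\<^sub>0)\<^sup>n)\<close> with \<open>n = n\<^sub>1\<close>, where \<open>C\<close> does not
  depend on \<open>G\<close>. By Frullani's integral, the expectation of \<open>log T\<^sub>G\<^sub>' - log T\<^sub>G\<close> is therefore that of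
  \<open>Y'\<^sub>0 - Y\<^sub>0\<close>. Taking \<open>G' = G + \<epsilon>F\<close> with \<open>0 \<le> F \<le> G\<close> and letting \<open>\<epsilon> \<rightarrow> 0\<close> gives
  \<open>E (T\<^sub>F / T\<^sub>G) = E \<Prod>\<^sub>l exp(n\<^sub>l (Y\<^sub>l - Y\<^sub>l\<^sub>-\<^sub>1)) F / G\<close>. For two replicas \<open>G\<close> is a product of partition
  functions; independence of the columns from level \<open>r\<close> on splits the recursion into
  \<open>Y\<^sub>l = X\<^sub>l\<^sup>1 + X\<^sub>l\<^sup>2\<close>, and below level \<open>r\<close>, where both replicas agree, \<open>n\<^sub>l = m\<^sub>l / 2\<close> preserves
  \<open>Y\<^sub>l = 2 X\<^sub>l\<close>. Hence the exponential factors are exactly the weights in \<^const>\<open>mu\<close>.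
\<close>

subsection \<open>The Laplace functional of a Poisson process\<close>

text \<open>The joint law of the weights and the marks at the leaves is never described: only the
  scalar \<open>tsum\<close> is followed, through its Laplace transform. One level collapses because
  multiplying the points of a process of intensity x^(-1-n) dx by independent factors exp(Y) gives
  the same intensity multiplied by E exp(n Y), and this mean is the recursion for Y. What is left at
  the parents is a power with exponent n, to be integrated against the next intensity x^(-1-n') dx;
  convergence at 0 needs n' < n, which is why the parameters increase, and n_k < 1 plays the same
  role at the leaves. The constants so produced are never evaluated: Frullani's integral sees only
  quotients. \<open>eneg\<close> extends exp(-x) to x = \<infinity> by 0, so that sums over
  infinitely many leaves can be handled before they are known to be finite; finiteness then follows
  from the transform as s tends to 0. The bound F \<le> G keeps every difference quotient in [0,1],
  which gives dominated convergence on both sides; a general f is reduced to this case by an affine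
  map.\<close>

definition eneg :: "ennreal \<Rightarrow> ennreal" where
  "eneg x = (if x = \<infinity> then 0 else ennreal (exp (- enn2real x)))"

lemma eneg_simps [simp]: "eneg 0 = 1" "eneg top = 0"
  by (simp_all add: eneg_def)

lemma eneg_ennreal: "0 \<le> a \<Longrightarrow> eneg (ennreal a) = ennreal (exp (- a))"
  by (simp add: eneg_def)

lemma eneg_add: "eneg (a + b) = eneg a * eneg b"
  by (cases a; cases b)
     (simp_all add: eneg_ennreal ennreal_mult'[symmetric] exp_add[symmetric] flip: ennreal_plus)

lemma eneg_sum: "finite A \<Longrightarrow> eneg (\<Sum>i\<in>A. f i) = (\<Prod>i\<in>A. eneg (f i))"
  by (induction A rule: finite_induct) (auto simp: eneg_add)

lemma eneg_antimono: "a \<le> b \<Longrightarrow> eneg b \<le> eneg a"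
  by (cases a; cases b) (auto simp: eneg_ennreal ennreal_leI top_unique)

lemma eneg_le_1 [simp]: "eneg a \<le> 1"
  using eneg_antimono[of 0 a] by simp

lemma eneg_less_top [simp]: "eneg a < top"
  using eneg_le_1[of a] by (rule le_less_trans) simp

lemma eneg_neq_top [simp]: "eneg a \<noteq> top"
  using eneg_less_top[of a] by (simp add: less_top)

lemma measurable_eneg [measurable]: "eneg \<in> borel_measurable borel"
  unfolding eneg_def by measurable

text \<open>Continuity at \<infinity> is the point: limits of partial sums may be taken inside
  \<open>eneg\<close> without knowing whether the sums diverge.\<close>

lemma tendsto_eneg:
  assumes "(f \<longlongrightarrow> x) F"
  shows "((\<lambda>i. eneg (f i)) \<longlongrightarrow> eneg x) F"
proof (cases x)
  case (real a)
  have "((\<lambda>i. ennreal (exp (- enn2real (f i)))) \<longlongrightarrow> ennreal (exp (- a))) F"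
    using tendsto_enn2real[OF assms[unfolded real(2)] real(1)] by (intro tendsto_ennrealI tendsto_exp tendsto_minus)
  moreover have "eventually (\<lambda>i. f i < top) F"
    using order_tendstoD(2)[OF assms, of top] real by simp
  then have "\<forall>\<^sub>F i in F. ennreal (exp (- enn2real (f i))) = eneg (f i)"
    by (rule eventually_mono) (simp add: eneg_def)
  ultimately have "((\<lambda>i. eneg (f i)) \<longlongrightarrow> ennreal (exp (- a))) F"
    by (metis Lim_transform_eventually)
  then show ?thesis
    using real by (simp add: eneg_ennreal)
next
  case top
  have "eventually (\<lambda>i. eneg (f i) < e) F" if "0 < e" for e
  proof -
    obtain d where d: "0 < d" "ennreal d < e"
    proof (cases e)
      case (real r)
      then show ?thesis using \<open>0 < e\<close> that[of "r / 2"] by (auto simp: ennreal_less_iff)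
    qed (use that[of 1] in simp)
    \<comment> \<open>Beyond - ln d the exponential is below d; the maximum with 0 covers d > 1,
      where - ln d is negative.\<close>
    have "eventually (\<lambda>i. ennreal (max 0 (- ln d)) < f i) F"
      using order_tendstoD(1)[OF assms, of "ennreal (max 0 (- ln d))"] top by simp
    then show ?thesis
    proof (rule eventually_mono)
      fix i assume "ennreal (max 0 (- ln d)) < f i"
      then have "eneg (f i) \<le> eneg (ennreal (max 0 (- ln d)))"
        by (intro eneg_antimono) auto
      also have "\<dots> \<le> ennreal d"
        using d(1) by (subst eneg_ennreal) (auto simp: max_def intro!: ennreal_leI)
      finally show "eneg (f i) < e" using d(2) by simp
    qed
  qed
  then show ?thesis
    using top by (intro order_tendstoI) auto
qed

text \<open>Monotone convergence with limits in place of suprema, the form that composes with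
  \<open>tendsto_eneg\<close>.\<close>

lemma nn_integral_incseq_tendsto:
  assumes [measurable]: "\<And>i. f i \<in> borel_measurable M"
    and "\<And>x. incseq (\<lambda>i. f i x)" and "\<And>x. (\<lambda>i. f i x) \<longlonglongrightarrow> g x"
  shows "(\<lambda>i. \<integral>\<^sup>+x. f i x \<partial>M) \<longlonglongrightarrow> (\<integral>\<^sup>+x. g x \<partial>M)"
proof -
  have "g x = (SUP i. f i x)" for x
    using LIMSEQ_unique[OF assms(3) LIMSEQ_SUP[OF assms(2)]] .
  then have "(\<integral>\<^sup>+x. g x \<partial>M) = (SUP i. \<integral>\<^sup>+x. f i x \<partial>M)"
    using assms(2) nn_integral_monotone_convergence_SUP[of f M] by (simp add: incseq_def le_fun_def)
  moreover have "incseq (\<lambda>i. \<integral>\<^sup>+x. f i x \<partial>M)"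
    using assms(2) by (auto simp: incseq_def intro!: nn_integral_mono)
  ultimately show ?thesis
    using LIMSEQ_SUP by metis
qed

text \<open>For a finite mean this is the exponential series evaluated at exp(-c); an infinite mean,
  where X is almost surely \<infinity>, is treated apart.\<close>

lemma poisson_variable_laplace:
  assumes M: "prob_space M" and X: "poisson_variable M \<Lambda> X" and c: "c < top"
  shows "(\<integral>\<^sup>+\<omega>. eneg (c * X \<omega>) \<partial>M) = eneg (\<Lambda> * (1 - eneg c))"
proof -
  interpret prob_space M by fact
  have X_meas [measurable]: "X \<in> borel_measurable M"
    using X by (simp add: poisson_variable_def)
  obtain a where a: "c = ennreal a" "0 \<le> a"
    using c by (cases c) auto
  have c1: "1 - eneg c = ennreal (1 - exp (- a))"
    using a by (simp add: eneg_ennreal ennreal_minus flip: ennreal_1)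
  show ?thesis
  proof (cases \<Lambda>)
    case top
    then have AE: "AE \<omega> in M. X \<omega> = \<infinity>"
      using X by (simp add: poisson_variable_def)
    show ?thesis
    \<comment> \<open>With 0 * \<infinity> = 0 both sides are 1 when a = 0; otherwise both
      vanish.\<close>
    proof (cases "a = 0")
      case True
      then show ?thesis using a by (simp add: emeasure_space_1)
    next
      case False
      have "(\<integral>\<^sup>+\<omega>. eneg (c * X \<omega>) \<partial>M) = (\<integral>\<^sup>+\<omega>. 0 \<partial>M)"
        using False a by (intro nn_integral_cong_AE eventually_mono[OF AE]) (auto simp: ennreal_mult_top)
      then show ?thesis
        using False a top c1 by (simp add: ennreal_top_mult)
    qed
  next
    case (real L)
    define p where "p n = L ^ n / fact n * exp (- L)" for n
    have p: "emeasure M {\<omega> \<in> space M. X \<omega> = of_nat n} = ennreal (p n)" for n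
      using X real by (auto simp: poisson_variable_def emeasure_eq_measure p_def)
    have p_sums: "(\<lambda>n. b ^ n * p n) sums exp (L * b - L)" for b
    proof -
      have "(\<lambda>n. (L * b) ^ n /\<^sub>R fact n * exp (- L)) sums (exp (L * b) * exp (- L))"
        by (intro sums_mult2 exp_converges)
      then show ?thesis
        by (simp add: p_def power_mult_distrib divide_inverse mult_ac exp_diff exp_minus scaleR_conv_of_real)
    qed
    have p_nonneg: "0 \<le> p n" for n
      using real by (simp add: p_def)
    \<comment> \<open>The hypothesis fixes only the masses at natural numbers. They add up to 1, so
      X almost surely takes no other value, in particular not \<infinity>.\<close>
    have "emeasure M (\<Union>n. {\<omega> \<in> space M. X \<omega> = of_nat n}) = (\<Sum>n. emeasure M {\<omega> \<in> space M. X \<omega> = of_nat n})"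
      by (subst suminf_emeasure) (auto simp: disjoint_family_on_def)
    also have "\<dots> = ennreal (\<Sum>n. p n)"
      using p_sums[of 1] p_nonneg by (simp add: p suminf_ennreal2 sums_iff)
    also have "\<dots> = 1"
      using p_sums[of 1] by (simp add: sums_iff)
    finally have "AE \<omega> in M. \<omega> \<in> (\<Union>n. {\<omega> \<in> space M. X \<omega> = of_nat n})"
        by (intro AE_prob_1) (simp add: emeasure_eq_measure)
    then have AE: "AE \<omega> in M. \<exists>n. X \<omega> = of_nat n"
      by (rule AE_mp) auto
    have "(\<integral>\<^sup>+\<omega>. eneg (c * X \<omega>) \<partial>M) =
      (\<integral>\<^sup>+\<omega>. (\<Sum>n. eneg (c * of_nat n) * indicator {\<omega> \<in> space M. X \<omega> = of_nat n} \<omega>) \<partial>M)"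
    proof (intro nn_integral_cong_AE, use AE AE_space in eventually_elim)
      fix \<omega> assume "\<exists>n. X \<omega> = of_nat n" and "\<omega> \<in> space M"
      then obtain n where n: "X \<omega> = of_nat n" by auto
      have "(\<Sum>n. eneg (c * of_nat n) * indicator {\<omega> \<in> space M. X \<omega> = of_nat n} \<omega>) =
        (\<Sum>n'\<in>{n}. eneg (c * of_nat n') * indicator {\<omega> \<in> space M. X \<omega> = of_nat n'} \<omega>)"
        by (intro suminf_finite) (auto simp: n)
      then show "eneg (c * X \<omega>) = (\<Sum>n. eneg (c * of_nat n) * indicator {\<omega> \<in> space M. X \<omega> = of_nat n} \<omega>)"
        using n \<open>\<omega> \<in> space M\<close> by simp
    qed
    also have "\<dots> = (\<Sum>n. eneg (c * of_nat n) * ennreal (p n))"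
      by (subst nn_integral_suminf) (auto simp: nn_integral_cmult p)
    also have "\<dots> = (\<Sum>n. ennreal (exp (- a) ^ n * p n))"
      using a p_nonneg by (intro suminf_cong)
        (auto simp: ennreal_of_nat_eq_real_of_nat eneg_ennreal exp_of_nat_mult[symmetric] mult_ac simp flip: ennreal_mult)
    also have "\<dots> = ennreal (exp (L * exp (- a) - L))"
      using p_sums[of "exp (- a)"] p_nonneg by (simp add: suminf_ennreal2 sums_iff)
    also have "\<dots> = eneg (\<Lambda> * (1 - eneg c))"
      unfolding c1 real(2) using real(1) a(2)
      by (subst ennreal_mult[symmetric], simp, simp, subst eneg_ennreal) (simp_all add: algebra_simps mult_left_le)
    finally show ?thesis .
  qed
qed

text \<open>Used for two measures: with counting measure on the indices it turns a sum over points
  into a combination of counts, with the intensity it turns the exponent back into an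
  integral.\<close>

lemma nn_integral_simple_preimages:
  fixes s :: "real \<Rightarrow> ennreal"
  assumes s: "simple_function borel s" and g: "g \<in> measurable N borel"
    and "AE x in N. g x \<in> P" and P: "P \<in> sets borel"
  shows "(\<integral>\<^sup>+x. F (s (g x)) \<partial>N) = (\<Sum>y\<in>range s. F y * emeasure N (g -` (s -` {y} \<inter> P) \<inter> space N))"
proof -
  note g[measurable] P[measurable]
  have fin: "finite (range s)"
    using s by (auto simp: simple_function_def)
  have [measurable]: "s -` {y} \<in> sets borel" for y
    using measurable_sets_borel[OF borel_measurable_simple_function[OF s], of "{y}"] by simp
  have "(\<integral>\<^sup>+x. F (s (g x)) \<partial>N) =
    (\<integral>\<^sup>+x. (\<Sum>y\<in>range s. F y * indicator (g -` (s -` {y} \<inter> P) \<inter> space N) x) \<partial>N)"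
  proof (intro nn_integral_cong_AE, use assms(3) AE_space in eventually_elim)
    fix x assume "g x \<in> P" "x \<in> space N"
    then have "(\<Sum>y\<in>range s. F y * indicator (g -` (s -` {y} \<inter> P) \<inter> space N) x) =
      (\<Sum>y\<in>range s. if y = s (g x) then F y else 0)"
      by (intro sum.cong) auto
    then show "F (s (g x)) = (\<Sum>y\<in>range s. F y * indicator (g -` (s -` {y} \<inter> P) \<inter> space N) x)"
      using fin by simp
  qed
  also have "\<dots> = (\<Sum>y\<in>range s. F y * emeasure N (g -` (s -` {y} \<inter> P) \<inter> space N))"
    by (subst nn_integral_sum) (auto simp: nn_integral_cmult)
  finally show ?thesis .
qed

lemma sets_intensity [measurable_cong, simp]: "sets (intensity n) = sets borel"
  and space_intensity [simp]: "space (intensity n) = UNIV"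
  by (simp_all add: intensity_def)

lemma AE_intensity_pos: "AE x in intensity n. x \<in> {0<..}"
  unfolding intensity_def by (subst AE_density) (auto simp: indicator_def)

text \<open>The hypotheses speak only of counts in disjoint sets. For a simple \<phi> the sum over
  the points is a finite combination of the independent counts of its level sets; a general \<phi>
  is an increasing limit of such functions, and both sides follow by continuity of
  \<open>eneg\<close>.\<close>

lemma poisson_process_laplace:
  assumes M: "prob_space M" and U: "decreasing_poisson_process M n U"
    and \<phi> [measurable]: "\<phi> \<in> borel_measurable borel"
  shows "(\<integral>\<^sup>+\<omega>. eneg (\<integral>\<^sup>+j. \<phi> (U j \<omega>) \<partial>count_space UNIV) \<partial>M) =
    eneg (\<integral>\<^sup>+x. (1 - eneg (\<phi> x)) \<partial>intensity n)"
proof -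
  interpret prob_space M by fact
  have U_meas [measurable]: "U j \<in> borel_measurable M" for j
    using U by (simp add: decreasing_poisson_process_def)
  have pos: "AE \<omega> in M. \<forall>j. U j \<omega> \<in> {0<..}"
    using U by (auto simp: decreasing_poisson_process_def elim: eventually_mono)
  have simple: "(\<integral>\<^sup>+\<omega>. eneg (\<integral>\<^sup>+j. s (U j \<omega>) \<partial>count_space UNIV) \<partial>M) =
      eneg (\<integral>\<^sup>+x. (1 - eneg (s x)) \<partial>intensity n)"
    if s: "simple_function borel s" and fin_s: "\<And>x. s x < top" for s :: "real \<Rightarrow> ennreal"
  proof -
    have fin: "finite (range s)"
      using s by (auto simp: simple_function_def)
    define A where "A y = s -` {y} \<inter> {0<..}" for y
    have "s -` {y} \<in> sets borel" for y
      using measurable_sets_borel[OF borel_measurable_simple_function[OF s], of "{y}"] by simp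
    then have A: "A y \<in> sets borel" "A y \<subseteq> {0<..}" for y
      by (auto simp: A_def)
    have N: "poisson_variable M (emeasure (intensity n) (A y)) (num_points U (A y))" for y
      using U A by (auto simp: decreasing_poisson_process_def)
    \<comment> \<open>Independence of the counts is available for families indexed by an initial
      segment, so the values of s are numbered.\<close>
    obtain e where e: "bij_betw e {..<card (range s)} (range s)"
      using fin by (metis ex_bij_betw_nat_finite atLeast0LessThan)
    have ind: "indep_vars (\<lambda>_. borel) (\<lambda>i. num_points U (A (e i))) {..<card (range s)}"
    proof -
      have "disjoint_family_on (\<lambda>i. A (e i)) {..<card (range s)}"
        using bij_betw_imp_inj_on[OF e] by (auto simp: disjoint_family_on_def A_def inj_on_def)
      with A show ?thesis
        using U[unfolded decreasing_poisson_process_def, THEN conjunct2, THEN conjunct2, THEN conjunct2,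
          THEN spec, THEN spec, of "card (range s)" "\<lambda>i. A (e i)"] by simp
    qed
    have "(\<integral>\<^sup>+\<omega>. eneg (\<integral>\<^sup>+j. s (U j \<omega>) \<partial>count_space UNIV) \<partial>M) =
      (\<integral>\<^sup>+\<omega>. (\<Prod>y\<in>range s. eneg (y * num_points U (A y) \<omega>)) \<partial>M)"
    proof (intro nn_integral_cong_AE, use pos in eventually_elim)
      fix \<omega> assume "\<forall>j. U j \<omega> \<in> {0<..}"
      then have "(\<integral>\<^sup>+j. s (U j \<omega>) \<partial>count_space UNIV) = (\<Sum>y\<in>range s. y * num_points U (A y) \<omega>)"
        using nn_integral_simple_preimages[OF s, of "\<lambda>j. U j \<omega>" "count_space UNIV" "{0<..}" "\<lambda>x. x"]
        by (simp add: num_points_def A_def vimage_def AE_count_space)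
      then show "eneg (\<integral>\<^sup>+j. s (U j \<omega>) \<partial>count_space UNIV) = (\<Prod>y\<in>range s. eneg (y * num_points U (A y) \<omega>))"
        using fin by (simp add: eneg_sum)
    qed
    also have "\<dots> = (\<integral>\<^sup>+\<omega>. (\<Prod>i<card (range s). eneg (e i * num_points U (A (e i)) \<omega>)) \<partial>M)"
      using e by (intro nn_integral_cong prod.reindex_bij_betw[symmetric])
    also have "\<dots> = (\<Prod>i<card (range s). \<integral>\<^sup>+\<omega>. eneg (e i * num_points U (A (e i)) \<omega>) \<partial>M)"
      by (intro indep_vars_nn_integral indep_vars_compose2[OF ind]) auto
    also have "\<dots> = (\<Prod>i<card (range s). eneg (emeasure (intensity n) (A (e i)) * (1 - eneg (e i))))"
    proof (intro prod.cong refl poisson_variable_laplace M N)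
      fix i assume "i \<in> {..<card (range s)}"
      then have "e i \<in> range s" using e by (auto simp: bij_betw_def)
      then show "e i < top" using fin_s by auto
    qed
    also have "\<dots> = (\<Prod>y\<in>range s. eneg (emeasure (intensity n) (A y) * (1 - eneg y)))"
      using e by (rule prod.reindex_bij_betw)
    also have "\<dots> = eneg (\<Sum>y\<in>range s. (1 - eneg y) * emeasure (intensity n) (A y))"
      using fin by (simp add: eneg_sum mult.commute)
    also have "(\<Sum>y\<in>range s. (1 - eneg y) * emeasure (intensity n) (A y)) = (\<integral>\<^sup>+x. (1 - eneg (s x)) \<partial>intensity n)"
      using nn_integral_simple_preimages[OF s, of "\<lambda>x. x" "intensity n" "{0<..}" "\<lambda>y. 1 - eneg y"] AE_intensity_pos
      by (simp add: A_def vimage_def)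
    finally show ?thesis .
  qed
  obtain s where s: "\<And>i. simple_function borel (s i)" "incseq s" "\<And>i x. s i x < top"
      "\<And>x. (SUP i. s i x) = \<phi> x"
    using borel_measurable_implies_simple_function_sequence'[OF \<phi>] by blast
  have [measurable]: "s i \<in> borel_measurable borel" for i
    using s(1) by (rule borel_measurable_simple_function)
  have inc: "incseq (\<lambda>i. s i x)" for x
    using s(2) by (auto simp: incseq_def le_fun_def)
  have lim: "(\<lambda>i. s i x) \<longlonglongrightarrow> \<phi> x" for x
    using LIMSEQ_SUP[OF inc[of x]] s(4) by simp
  have "(\<lambda>i. \<integral>\<^sup>+\<omega>. eneg (\<integral>\<^sup>+j. s i (U j \<omega>) \<partial>count_space UNIV) \<partial>M) \<longlonglongrightarrow>
      (\<integral>\<^sup>+\<omega>. eneg (\<integral>\<^sup>+j. \<phi> (U j \<omega>) \<partial>count_space UNIV) \<partial>M)"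
  \<comment> \<open>The integrands decrease along the approximation, so the bound 1 and dominated
    convergence replace monotone convergence.\<close>
  proof (rule nn_integral_dominated_convergence[where w="\<lambda>_. 1"])
    show "AE \<omega> in M. (\<lambda>i. eneg (\<integral>\<^sup>+j. s i (U j \<omega>) \<partial>count_space UNIV)) \<longlonglongrightarrow>
        eneg (\<integral>\<^sup>+j. \<phi> (U j \<omega>) \<partial>count_space UNIV)"
      by (intro AE_I2 tendsto_eneg nn_integral_incseq_tendsto) (auto intro: inc lim)
  qed (simp_all add: nn_integral_count_space_nat emeasure_space_1)
  moreover have "(\<lambda>i. \<integral>\<^sup>+\<omega>. eneg (\<integral>\<^sup>+j. s i (U j \<omega>) \<partial>count_space UNIV) \<partial>M) \<longlonglongrightarrow>
      eneg (\<integral>\<^sup>+x. (1 - eneg (\<phi> x)) \<partial>intensity n)"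
  proof (subst simple[OF s(1,3)], intro tendsto_eneg nn_integral_incseq_tendsto)
    show "(\<lambda>i. 1 - eneg (s i x)) \<longlonglongrightarrow> 1 - eneg (\<phi> x)" for x
      by (intro tendsto_diff_ennreal tendsto_const tendsto_eneg lim) simp_all
    show "incseq (\<lambda>i. 1 - eneg (s i x))" for x
      using inc by (auto simp: incseq_def intro!: ennreal_mono_minus eneg_antimono)
  qed auto
  ultimately show ?thesis
    by (rule LIMSEQ_unique)
qed

subsection \<open>Independent families and Frullani integrals\<close>

text \<open>An enumeration exhausts I by finite sets. This reduces measurability and independence
  for sums over a whole level of the tree to finite sums.\<close>

lemma count_space_tendsto_sum:
  fixes g :: "'i::countable \<Rightarrow> ennreal"
  shows "(\<lambda>m. \<Sum>i | i \<in> I \<and> to_nat i < m. g i) \<longlonglongrightarrow> (\<integral>\<^sup>+i. g i \<partial>count_space I)"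
proof -
  define J where "J m = {i. i \<in> I \<and> to_nat i < m}" for m
  have "finite {i :: 'i. to_nat i < m}" for m
    using finite_vimageI[of "{..<m}" "to_nat :: 'i \<Rightarrow> nat"] by (simp add: vimage_def)
  then have J: "finite (J m)" "J m \<subseteq> I" for m
    by (auto simp: J_def intro: finite_subset)
  have "(\<lambda>m. \<integral>\<^sup>+i. g i * indicator (J m) i \<partial>count_space I) \<longlonglongrightarrow> (\<integral>\<^sup>+i. g i * indicator I i \<partial>count_space I)"
  proof (rule nn_integral_incseq_tendsto)
    show "incseq (\<lambda>m. g i * indicator (J m) i)" for i
      by (auto simp: incseq_def J_def split: split_indicator intro!: mult_left_mono)
    show "(\<lambda>m. g i * indicator (J m) i) \<longlonglongrightarrow> g i * indicator I i" for i
      by (rule tendsto_eventually)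
        (auto simp: J_def eventually_sequentially split: split_indicator intro!: exI[of _ "Suc (to_nat i)"])
  qed simp
  moreover have "(\<integral>\<^sup>+i. g i * indicator (J m) i \<partial>count_space I) = sum g (J m)" for m
    using J by (subst nn_integral_count_space'[of "J m"]) auto
  moreover have "(\<integral>\<^sup>+i. g i * indicator I i \<partial>count_space I) = (\<integral>\<^sup>+i. g i \<partial>count_space I)"
    by (intro nn_integral_cong) auto
  ultimately show ?thesis
    by (simp add: J_def)
qed

text \<open>Independence makes the expectation multiplicative. Writing each factor as
  \<open>eneg (g i)\<close> keeps the infinite product in the form of an exponential of a sum, where
  the limit over finite subsets is covered by continuity.\<close>

lemma nn_integral_eneg_PiM:
  fixes M :: "'i::countable \<Rightarrow> 'a measure"
  assumes M: "\<And>i. prob_space (M i)"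
    and f [measurable]: "\<And>i. i \<in> I \<Longrightarrow> f i \<in> borel_measurable (M i)"
    and g: "\<And>i. i \<in> I \<Longrightarrow> (\<integral>\<^sup>+x. eneg (f i x) \<partial>M i) = eneg (g i)"
  shows "(\<integral>\<^sup>+x. eneg (\<integral>\<^sup>+i. f i (x i) \<partial>count_space I) \<partial>PiM UNIV M) = eneg (\<integral>\<^sup>+i. g i \<partial>count_space I)"
proof -
  interpret product_prob_space M UNIV
    using M by (intro product_prob_spaceI)
  define J where "J m = {i. i \<in> I \<and> to_nat i < m}" for m
  have "finite {i :: 'i. to_nat i < m}" for m
    using finite_vimageI[of "{..<m}" "to_nat :: 'i \<Rightarrow> nat"] by (simp add: vimage_def)
  then have J: "finite (J m)" "J m \<subseteq> I" for m
    by (auto simp: J_def intro: finite_subset)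
  have J_meas [measurable]: "(\<lambda>x. \<Sum>i\<in>J m. f i (x i)) \<in> borel_measurable (PiM UNIV M)" for m
  proof (rule borel_measurable_sum)
    fix i assume "i \<in> J m"
    then have "f i \<in> borel_measurable (M i)"
      using J by (intro f) auto
    then show "(\<lambda>x. f i (x i)) \<in> borel_measurable (PiM UNIV M)"
      by (rule measurable_compose[OF measurable_component_singleton[OF UNIV_I]])
  qed
  have "(\<lambda>m. \<integral>\<^sup>+x. eneg (\<Sum>i\<in>J m. f i (x i)) \<partial>PiM UNIV M) \<longlonglongrightarrow>
      (\<integral>\<^sup>+x. eneg (\<integral>\<^sup>+i. f i (x i) \<partial>count_space I) \<partial>PiM UNIV M)"
  proof (rule nn_integral_dominated_convergence[where w="\<lambda>_. 1"])
    have lim: "(\<lambda>m. \<Sum>i\<in>J m. f i (x i)) \<longlonglongrightarrow> (\<integral>\<^sup>+i. f i (x i) \<partial>count_space I)" for x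
      using count_space_tendsto_sum[where g="\<lambda>i. f i (x i)" and I=I] by (simp add: J_def)
    then show "AE x in PiM UNIV M. (\<lambda>m. eneg (\<Sum>i\<in>J m. f i (x i))) \<longlonglongrightarrow> eneg (\<integral>\<^sup>+i. f i (x i) \<partial>count_space I)"
      by (intro AE_I2 tendsto_eneg)
    show "(\<lambda>x. eneg (\<integral>\<^sup>+i. f i (x i) \<partial>count_space I)) \<in> borel_measurable (PiM UNIV M)"
      by (rule measurable_compose[OF borel_measurable_LIMSEQ_order[OF lim] measurable_eneg]) simp
  qed (simp_all add: P.emeasure_space_1)
  moreover have "(\<integral>\<^sup>+x. eneg (\<Sum>i\<in>J m. f i (x i)) \<partial>PiM UNIV M) = eneg (\<Sum>i\<in>J m. g i)" for m
  proof -
    have [measurable]: "i \<in> J m \<Longrightarrow> f i \<in> borel_measurable (M i)" for i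
      using J by (intro f) auto
    have "(\<integral>\<^sup>+x. eneg (\<Sum>i\<in>J m. f i (x i)) \<partial>PiM UNIV M) =
      (\<integral>\<^sup>+x. (\<Prod>i\<in>J m. eneg (f i (restrict x (J m) i))) \<partial>PiM UNIV M)"
      using J by (simp add: eneg_sum)
    also have "\<dots> = (\<integral>\<^sup>+x. (\<Prod>i\<in>J m. eneg (f i (x i))) \<partial>distr (PiM UNIV M) (PiM (J m) M) (\<lambda>x. restrict x (J m)))"
      by (subst nn_integral_distr) auto
    also have "\<dots> = (\<integral>\<^sup>+x. (\<Prod>i\<in>J m. eneg (f i (x i))) \<partial>PiM (J m) M)"
      using J by (subst distr_PiM_restrict_finite) auto
    also have "\<dots> = (\<Prod>i\<in>J m. \<integral>\<^sup>+x. eneg (f i x) \<partial>M i)"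
      using J by (intro product_nn_integral_prod) auto
    also have "\<dots> = eneg (\<Sum>i\<in>J m. g i)"
      using J by (subst eneg_sum) (auto intro!: prod.cong g)
    finally show ?thesis .
  qed
  moreover have "(\<lambda>m. eneg (\<Sum>i\<in>J m. g i)) \<longlonglongrightarrow> eneg (\<integral>\<^sup>+i. g i \<partial>count_space I)"
    unfolding J_def by (intro tendsto_eneg count_space_tendsto_sum)
  ultimately show ?thesis
    using LIMSEQ_unique by simp
qed

lemma measurable_override [measurable]:
  "(\<lambda>(x, y) i. if i \<in> J then y i else x i) \<in> PiM UNIV M \<Otimes>\<^sub>M PiM UNIV M \<rightarrow>\<^sub>M PiM UNIV M"
proof -
  have "(\<lambda>z i. if i \<in> J then snd z i else fst z i) \<in> PiM UNIV M \<Otimes>\<^sub>M PiM UNIV M \<rightarrow>\<^sub>M PiM UNIV M"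
    by (rule measurable_PiM_single') (auto simp: space_pair_measure space_PiM PiE_iff)
  then show ?thesis
    by (simp add: case_prod_beta')
qed

text \<open>The coordinates in J are redrawn from an independent copy. A cylinder over K pulls back
  to a rectangle, with the coordinates K - J constraining x and K \<inter> J constraining y, so its
  measure is the same product.\<close>

lemma distr_PiM_override:
  assumes M: "\<And>i. prob_space (M i)"
  shows "distr (PiM UNIV M \<Otimes>\<^sub>M PiM UNIV M) (PiM UNIV M) (\<lambda>(x, y) i. if i \<in> J then y i else x i) = PiM UNIV M"
proof -
  interpret product_prob_space M UNIV
    using M by (intro product_prob_spaceI)
  show ?thesis
  proof (rule PiM_eq)
    fix K F assume K: "finite K" "K \<subseteq> UNIV" and F: "\<And>j. j \<in> K \<Longrightarrow> F j \<in> sets (M j)"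
    let ?e = "\<lambda>K. prod_emb UNIV M K (Pi\<^sub>E K F)"
    have F': "x \<in> F j \<Longrightarrow> j \<in> K \<Longrightarrow> x \<in> space (M j)" for x j
      using F[THEN sets.sets_into_space] by auto
    have sets: "?e (K - J) \<in> sets (PiM UNIV M)" "?e (K \<inter> J) \<in> sets (PiM UNIV M)" "?e K \<in> sets (PiM UNIV M)"
      using K F by (auto intro!: sets_PiM_I)
    have "(\<lambda>(x, y) i. if i \<in> J then y i else x i) -` ?e K \<inter> space (PiM UNIV M \<Otimes>\<^sub>M PiM UNIV M) =
      ?e (K - J) \<times> ?e (K \<inter> J)"
      using F' by (auto simp: prod_emb_def space_pair_measure space_PiM PiE_iff split: if_splits)
    then have "emeasure (distr (PiM UNIV M \<Otimes>\<^sub>M PiM UNIV M) (PiM UNIV M) (\<lambda>(x, y) i. if i \<in> J then y i else x i)) (?e K) =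
      emeasure (PiM UNIV M \<Otimes>\<^sub>M PiM UNIV M) (?e (K - J) \<times> ?e (K \<inter> J))"
      using sets by (subst emeasure_distr) auto
    also have "\<dots> = emeasure (PiM UNIV M) (?e (K - J)) * emeasure (PiM UNIV M) (?e (K \<inter> J))"
      by (intro P.emeasure_pair_measure_Times sets)
    also have "\<dots> = (\<Prod>j\<in>K - J. emeasure (M j) (F j)) * (\<Prod>j\<in>K \<inter> J. emeasure (M j) (F j))"
      using K F by (subst (1 2) emeasure_PiM_emb) auto
    also have "\<dots> = (\<Prod>j\<in>K. emeasure (M j) (F j))"
      using K by (subst prod.union_disjoint[symmetric]) (auto intro: prod.cong)
    finally show "emeasure (distr (PiM UNIV M \<Otimes>\<^sub>M PiM UNIV M) (PiM UNIV M) (\<lambda>(x, y) i. if i \<in> J then y i else x i))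
       (?e K) = (\<Prod>j\<in>K. emeasure (M j) (F j))" .
  qed simp
qed

text \<open>This is how one level of the tree is integrated out while every functional stays defined
  on the whole tree.\<close>

lemma nn_integral_PiM_override:
  assumes M: "\<And>i. prob_space (M i)" and f [measurable]: "f \<in> borel_measurable (PiM UNIV M)"
  shows "(\<integral>\<^sup>+x. f x \<partial>PiM UNIV M) =
    (\<integral>\<^sup>+x. \<integral>\<^sup>+y. f (\<lambda>i. if i \<in> J then y i else x i) \<partial>PiM UNIV M \<partial>PiM UNIV M)"
proof -
  interpret prob_space "PiM UNIV M"
    using M by (intro prob_space_PiM)
  have *: "f (case z of (x, y) \<Rightarrow> \<lambda>i. if i \<in> J then y i else x i) =
      (case z of (x, y) \<Rightarrow> f (\<lambda>i. if i \<in> J then y i else x i))" for z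
    by (simp add: case_prod_beta)
  have "(\<integral>\<^sup>+x. f x \<partial>PiM UNIV M) =
    (\<integral>\<^sup>+x. f x \<partial>distr (PiM UNIV M \<Otimes>\<^sub>M PiM UNIV M) (PiM UNIV M) (\<lambda>(x, y) i. if i \<in> J then y i else x i))"
    by (simp only: distr_PiM_override[OF M])
  also have "\<dots> = (\<integral>\<^sup>+z. f (case z of (x, y) \<Rightarrow> \<lambda>i. if i \<in> J then y i else x i) \<partial>(PiM UNIV M \<Otimes>\<^sub>M PiM UNIV M))"
    by (rule nn_integral_distr) simp_all
  also have "\<dots> = (\<integral>\<^sup>+x. \<integral>\<^sup>+y. f (\<lambda>i. if i \<in> J then y i else x i) \<partial>PiM UNIV M \<partial>PiM UNIV M)"
    by (subst nn_integral_fst[symmetric]) auto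
  finally show ?thesis .
qed

text \<open>Self-similarity of the power-law intensity, by linear substitution. It is the origin of
  the moments exp(n Y) in the recursion.\<close>

lemma nn_integral_intensity_scale:
  assumes a: "0 < a" and g [measurable]: "g \<in> borel_measurable borel"
  shows "(\<integral>\<^sup>+x. g (a * x) \<partial>intensity n) = ennreal (a powr n) * (\<integral>\<^sup>+x. g x \<partial>intensity n)"
proof -
  have "(\<integral>\<^sup>+x. g x \<partial>intensity n) = (\<integral>\<^sup>+x. ennreal (indicator {0<..} x * x powr (-1 - n)) * g x \<partial>lborel)"
    unfolding intensity_def by (subst nn_integral_density) auto
  also have "\<dots> = ennreal a * (\<integral>\<^sup>+x. ennreal (indicator {0<..} (a * x) * (a * x) powr (-1 - n)) * g (a * x) \<partial>lborel)"
    using a by (subst nn_integral_real_affine[where c=a and t=0]) auto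
  also have "\<dots> = ennreal a * (\<integral>\<^sup>+x. ennreal (a powr (-1 - n)) * (ennreal (indicator {0<..} x * x powr (-1 - n)) * g (a * x)) \<partial>lborel)"
  proof -
    have "ennreal (indicator {0<..} (a * x) * (a * x) powr (-1 - n)) =
      ennreal (a powr (-1 - n)) * ennreal (indicator {0<..} x * x powr (-1 - n))" for x
      using a by (cases "0 < x") (auto simp: powr_mult zero_less_mult_iff ennreal_mult)
    then show ?thesis
      by (simp only: mult.assoc)
  qed
  also have "\<dots> = ennreal a * (ennreal (a powr (-1 - n)) * (\<integral>\<^sup>+x. ennreal (indicator {0<..} x * x powr (-1 - n)) * g (a * x) \<partial>lborel))"
    by (subst nn_integral_cmult) auto
  also have "(\<integral>\<^sup>+x. ennreal (indicator {0<..} x * x powr (-1 - n)) * g (a * x) \<partial>lborel) = (\<integral>\<^sup>+x. g (a * x) \<partial>intensity n)"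
    unfolding intensity_def by (subst nn_integral_density) auto
  finally have "ennreal (a powr n) * (\<integral>\<^sup>+x. g x \<partial>intensity n) =
    ennreal (a powr n * (a * a powr (-1 - n))) * (\<integral>\<^sup>+x. g (a * x) \<partial>intensity n)"
    using a by (simp add: ennreal_mult' mult.assoc)
  also have "a powr n * (a * a powr (-1 - n)) = 1"
    using a by (simp add: powr_mult_base powr_add[symmetric])
  finally show ?thesis
    by simp
qed

text \<open>The open half-line is exhausted by the rays from 1/(m+1), because F has a derivative
  only away from 0 and merely a limit there.\<close>

lemma nn_integral_FTC_greaterThan_0:
  fixes f F :: "real \<Rightarrow> real"
  assumes [measurable]: "f \<in> borel_measurable borel"
    and F: "\<And>x. 0 < x \<Longrightarrow> DERIV F x :> f x" and nonneg: "\<And>x. 0 < x \<Longrightarrow> 0 \<le> f x"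
    and top: "(F \<longlongrightarrow> T) at_top" and bot: "(F \<longlongrightarrow> B) (at_right 0)"
  shows "(\<integral>\<^sup>+x. ennreal (f x) * indicator {0<..} x \<partial>lborel) = ennreal (T - B)"
proof -
  define c :: "nat \<Rightarrow> real" where "c m = 1 / (real m + 1)" for m
  have c: "0 < c m" for m
    by (simp add: c_def)
  have c0: "c \<longlonglongrightarrow> 0"
    unfolding c_def by real_asymp
  then have c_right: "filterlim c (at_right 0) sequentially"
    using less_imp_neq[OF c] c by (auto simp: filterlim_at intro!: always_eventually)
  have dec: "m \<le> m' \<Longrightarrow> c m' \<le> c m" for m m'
    by (auto simp: c_def frac_le)
  have "(\<lambda>m. \<integral>\<^sup>+x. ennreal (f x) * indicator {c m..} x \<partial>lborel) \<longlonglongrightarrow> (\<integral>\<^sup>+x. ennreal (f x) * indicator {0<..} x \<partial>lborel)"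
  proof (rule nn_integral_incseq_tendsto)
    show "incseq (\<lambda>m. ennreal (f x) * indicator {c m..} x)" for x
      using dec by (auto simp: incseq_def split: split_indicator intro: order_trans)
    show "(\<lambda>m. ennreal (f x) * indicator {c m..} x) \<longlonglongrightarrow> ennreal (f x) * indicator {0<..} x" for x
    proof (rule tendsto_eventually)
      show "\<forall>\<^sub>F m in sequentially. ennreal (f x) * indicator {c m..} x = ennreal (f x) * indicator {0<..} x"
      proof (cases "0 < x")
        case True
        with c0 have "\<forall>\<^sub>F m in sequentially. c m < x"
          by (rule order_tendstoD)
        then show ?thesis
          by (rule eventually_mono) (use True in auto)
      next
        case False
        then have "\<not> c m \<le> x" for m
          using c[of m] by linarith
        with False show ?thesis by simp
      qed
    qed
  qed auto
  moreover have "(\<integral>\<^sup>+x. ennreal (f x) * indicator {c m..} x \<partial>lborel) = ennreal (T - F (c m))" for m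
    using c[of m] by (intro nn_integral_FTC_atLeast F nonneg top) auto
  moreover have "(\<lambda>m. ennreal (T - F (c m))) \<longlonglongrightarrow> ennreal (T - B)"
    by (intro tendsto_ennrealI tendsto_diff tendsto_const filterlim_compose[OF bot c_right])
  ultimately show ?thesis
    using LIMSEQ_unique by simp
qed

text \<open>The difference of exponentials is the integral over s in [a,b] of x powr n * exp(-s x
  powr n). After exchanging the integrals the one over x is 1/(s n), and integrating 1/s gives the
  logarithm.\<close>

lemma frullani_powr:
  fixes a b n :: real
  assumes a: "0 < a" and ab: "a \<le> b" and n: "0 < n"
  shows "(\<integral>\<^sup>+x. ennreal ((exp (- (a * x powr n)) - exp (- (b * x powr n))) / x) * indicator {0<..} x \<partial>lborel) =
    ennreal (ln (b / a) / n)"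
proof -
  have s_int: "(\<integral>\<^sup>+s. ennreal (x powr (n - 1) * exp (- (s * x powr n))) * indicator {a..b} s \<partial>lborel) =
      ennreal ((exp (- (a * x powr n)) - exp (- (b * x powr n))) / x)" if "0 < x" for x
  proof -
    have "((\<lambda>s. x powr (n - 1) * exp (- (s * x powr n))) has_integral
      (- exp (- (b * x powr n)) / x) - (- exp (- (a * x powr n)) / x)) {a..b}"
      using that ab by (intro fundamental_theorem_of_calculus)
        (auto intro!: derivative_eq_intros simp: has_real_derivative_iff_has_vector_derivative[symmetric] powr_diff)
    then have "((\<lambda>s. x powr (n - 1) * exp (- (s * x powr n))) has_integral
      ((exp (- (a * x powr n)) - exp (- (b * x powr n))) / x)) {a..b}"
      by (simp add: diff_divide_distrib)
    then show ?thesis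
      by (intro nn_integral_has_integral_lebesgue') auto
  qed
  have x_int: "(\<integral>\<^sup>+x. ennreal (x powr (n - 1) * exp (- (s * x powr n))) * indicator {0<..} x \<partial>lborel) =
      ennreal (1 / s / n)" if s: "0 < s" for s
  proof -
    have "(\<integral>\<^sup>+x. ennreal (x powr (n - 1) * exp (- (s * x powr n))) * indicator {0<..} x \<partial>lborel) =
      ennreal (0 - (- 1 / (s * n)))"
    proof (rule nn_integral_FTC_greaterThan_0[where F="\<lambda>x. - exp (- (s * x powr n)) / (s * n)"])
      show "((\<lambda>x. - exp (- (s * x powr n)) / (s * n)) has_real_derivative x powr (n - 1) * exp (- (s * x powr n))) (at x)"
        if "0 < x" for x
        using that s n by (auto intro!: derivative_eq_intros simp: field_simps)
      show "((\<lambda>x. - exp (- (s * x powr n)) / (s * n)) \<longlongrightarrow> 0) at_top"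
        using s n by real_asymp
      show "((\<lambda>x. - exp (- (s * x powr n)) / (s * n)) \<longlongrightarrow> - 1 / (s * n)) (at_right 0)"
      proof -
        have "((\<lambda>x. - exp (- (s * x powr n)) / (s * n)) \<longlongrightarrow> - (inverse s * inverse n)) (at_right 0)"
          using s n by real_asymp
        then show ?thesis by (simp add: divide_inverse)
      qed
    qed auto
    then show ?thesis by simp
  qed
  have "(\<integral>\<^sup>+x. ennreal ((exp (- (a * x powr n)) - exp (- (b * x powr n))) / x) * indicator {0<..} x \<partial>lborel) =
    (\<integral>\<^sup>+x. \<integral>\<^sup>+s. ennreal (x powr (n - 1) * exp (- (s * x powr n))) * indicator {a..b} s * indicator {0<..} x \<partial>lborel \<partial>lborel)"
    by (intro nn_integral_cong) (auto simp: s_int split: split_indicator)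
  also have "\<dots> = (\<integral>\<^sup>+s. \<integral>\<^sup>+x. ennreal (x powr (n - 1) * exp (- (s * x powr n))) * indicator {a..b} s * indicator {0<..} x \<partial>lborel \<partial>lborel)"
    by (intro lborel_pair.Fubini') simp
  also have "\<dots> = (\<integral>\<^sup>+s. ennreal (1 / s / n) * indicator {a..b} s \<partial>lborel)"
    using x_int a by (intro nn_integral_cong) (auto split: split_indicator)
  also have "\<dots> = ennreal (ln b / n - ln a / n)"
  proof (rule nn_integral_has_integral_lebesgue')
    show "((\<lambda>s. 1 / s / n) has_integral ln b / n - ln a / n) {a..b}"
      using a ab n by (intro fundamental_theorem_of_calculus)
        (auto intro!: derivative_eq_intros simp: has_real_derivative_iff_has_vector_derivative[symmetric])
  qed (use a n in auto)
  also have "ln b / n - ln a / n = ln (b / a) / n"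
    using a ab by (simp add: ln_div diff_divide_distrib)
  finally show ?thesis .
qed

text \<open>For n' = 1 this is the Laplace exponent at D of a one-sided n-stable variable, D^n *
  Gamma(1-n)/n. Its value is left unevaluated because it cancels from the final quotient.\<close>

definition stable_const :: "real \<Rightarrow> real \<Rightarrow> real \<Rightarrow> real" where
  "stable_const n n' D = enn2real (\<integral>\<^sup>+x. (1 - eneg (ennreal (D * x powr n'))) \<partial>intensity n)"

text \<open>Near 0 the integrand is at most D x^(n'-1-n), integrable since n < n'; near \<infinity>
  it is at most x^(-1-n), integrable since 0 < n.\<close>

lemma stable_const:
  assumes n: "0 < n" "n < n'" and D: "0 < D"
  shows "(\<integral>\<^sup>+x. (1 - eneg (ennreal (D * x powr n'))) \<partial>intensity n) = ennreal (stable_const n n' D)"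
    and "0 < stable_const n n' D"
proof -
  let ?I = "\<integral>\<^sup>+x. (1 - eneg (ennreal (D * x powr n'))) \<partial>intensity n"
  have I: "?I = (\<integral>\<^sup>+x. ennreal ((1 - exp (- (D * x powr n'))) * x powr (-1 - n)) * indicator {0<..} x \<partial>lborel)"
  proof -
    have "1 - eneg (ennreal (D * x powr n')) = ennreal (1 - exp (- (D * x powr n')))" for x
      using D by (simp add: eneg_ennreal ennreal_minus flip: ennreal_1)
    then show ?thesis
      using D unfolding intensity_def
      by (subst nn_integral_density) (auto intro!: nn_integral_cong split: split_indicator simp: ennreal_mult' mult.commute)
  qed
  have "?I \<le> (\<integral>\<^sup>+x. ennreal (D * x powr (n' - 1 - n)) * indicator {0..1} x + ennreal (x powr (-1 - n)) * indicator {1..} x \<partial>lborel)"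
    unfolding I
  proof (intro nn_integral_mono)
    fix x :: real
    have "ennreal ((1 - exp (- (D * x powr n'))) * x powr (-1 - n)) \<le> ennreal (D * x powr (n' - 1 - n))" if "0 < x"
    proof (rule ennreal_leI)
      have "(1 - exp (- (D * x powr n'))) * x powr (-1 - n) \<le> D * x powr n' * x powr (-1 - n)"
        using exp_ge_add_one_self[of "- (D * x powr n')"] by (intro mult_right_mono) auto
      also have "\<dots> = D * x powr (n' - 1 - n)"
        using that by (simp add: powr_add[symmetric] algebra_simps)
      finally show "(1 - exp (- (D * x powr n'))) * x powr (-1 - n) \<le> D * x powr (n' - 1 - n)" .
    qed
    moreover have "ennreal ((1 - exp (- (D * x powr n'))) * x powr (-1 - n)) \<le> ennreal (x powr (-1 - n))"
      by (intro ennreal_leI mult_left_le_one_le) (use D in auto)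
    ultimately show "ennreal ((1 - exp (- (D * x powr n'))) * x powr (-1 - n)) * indicator {0<..} x \<le>
      ennreal (D * x powr (n' - 1 - n)) * indicator {0..1} x + ennreal (x powr (-1 - n)) * indicator {1..} x"
      by (auto split: split_indicator intro: order_trans)
  qed
  also have "\<dots> = (\<integral>\<^sup>+x. ennreal (D * x powr (n' - 1 - n)) * indicator {0..1} x \<partial>lborel) + (\<integral>\<^sup>+x. ennreal (x powr (-1 - n)) * indicator {1..} x \<partial>lborel)"
    by (rule nn_integral_add) auto
  also have "(\<integral>\<^sup>+x. ennreal (D * x powr (n' - 1 - n)) * indicator {0..1} x \<partial>lborel) = ennreal (D * (1 powr (n' - 1 - n + 1) / (n' - 1 - n + 1)))"
    using n D by (intro nn_integral_has_integral_lebesgue' has_integral_mult_right has_integral_powr_from_0) auto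
  also have "(\<integral>\<^sup>+x. ennreal (x powr (-1 - n)) * indicator {1..} x \<partial>lborel) = ennreal (- (1 powr (- 1 - n + 1)) / (-1 - n + 1))"
    using n by (intro nn_integral_has_integral_lebesgue' has_integral_powr_to_inf) auto
  finally have "?I < top"
    by (rule le_less_trans) simp
  then show eq: "?I = ennreal (stable_const n n' D)"
    by (simp add: stable_const_def ennreal_enn2real_if less_top)
  \<comment> \<open>A lower bound for the integrand on [1,2]: there x powr n' is at least 1, and x
    powr (-1 - n) is smallest at 2.\<close>
  have "0 < (1 - exp (- D)) * 2 powr (-1 - n)"
    using D by simp
  then have "0 < ennreal ((1 - exp (- D)) * 2 powr (-1 - n)) * emeasure lborel {1..2::real}"
    by simp
  also have "\<dots> = (\<integral>\<^sup>+x. ennreal ((1 - exp (- D)) * 2 powr (-1 - n)) * indicator {1..2::real} x \<partial>lborel)"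
    by (subst nn_integral_cmult_indicator) auto
  also have "\<dots> \<le> ?I"
    unfolding I
  proof (intro nn_integral_mono)
    fix x :: real
    have "(1 - exp (- D)) * 2 powr (-1 - n) \<le> (1 - exp (- (D * x powr n'))) * x powr (-1 - n)" if "1 \<le> x" "x \<le> 2"
    proof (intro mult_mono powr_mono2')
      show "1 - exp (- D) \<le> 1 - exp (- (D * x powr n'))"
        using that n D ge_one_powr_ge_zero[of x n'] by simp
    qed (use that n D in auto)
    then show "ennreal ((1 - exp (- D)) * 2 powr (-1 - n)) * indicator {1..2} x \<le>
       ennreal ((1 - exp (- (D * x powr n'))) * x powr (-1 - n)) * indicator {0<..} x"
      by (auto split: split_indicator intro: ennreal_leI)
  qed
  finally show "0 < stable_const n n' D"
    unfolding eq by simp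
qed

subsection \<open>The recursion along the columns\<close>

text \<open>The recursion descends from k, so it is indexed by the distance to the terminal level to
  be primitive recursive; \<open>ylog\<close> translates back to levels.\<close>

primrec yrec :: "nat \<Rightarrow> (nat \<Rightarrow> real) \<Rightarrow> (nat \<Rightarrow> 'c measure) \<Rightarrow> ((nat \<Rightarrow> 'c) \<Rightarrow> real) \<Rightarrow> nat \<Rightarrow> (nat \<Rightarrow> 'c) \<Rightarrow> real" where
  "yrec k n \<rho> G 0 z = ln (G z)"
| "yrec k n \<rho> G (Suc d) z =
    ln (\<integral>x. exp (n (k - d) * yrec k n \<rho> G d (z(k - d := x))) \<partial>\<rho> (k - d)) / n (k - d)"

definition ylog :: "nat \<Rightarrow> (nat \<Rightarrow> real) \<Rightarrow> (nat \<Rightarrow> 'c measure) \<Rightarrow> ((nat \<Rightarrow> 'c) \<Rightarrow> real) \<Rightarrow> nat \<Rightarrow> (nat \<Rightarrow> 'c) \<Rightarrow> real" where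
  "ylog k n \<rho> G l = yrec k n \<rho> G (k - l)"

lemma ylog_last: "ylog k n \<rho> G k z = ln (G z)"
  by (simp add: ylog_def)

lemma ylog_step:
  assumes "l < k"
  shows "ylog k n \<rho> G l z =
    ln (\<integral>x. exp (n (Suc l) * ylog k n \<rho> G (Suc l) (z(Suc l := x))) \<partial>\<rho> (Suc l)) / n (Suc l)"
proof -
  have "k - l = Suc (k - Suc l)" "k - (k - Suc l) = Suc l"
    using assms by auto
  then show ?thesis
    by (simp add: ylog_def)
qed

lemma ylog_induct [consumes 1, case_names last step]:
  assumes "l \<le> (k :: nat)" and "P k" and "\<And>l. l < k \<Longrightarrow> P (Suc l) \<Longrightarrow> P l"
  shows "P l"
  using assms(1)
proof (induction rule: inc_induct)
  case base
  show ?case by (rule assms(2))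
next
  case (step m)
  show ?case by (rule assms(3)[OF step(2,3)])
qed

definition depends_upto :: "nat \<Rightarrow> ((nat \<Rightarrow> 'c) \<Rightarrow> 'd) \<Rightarrow> bool" where
  "depends_upto l G \<longleftrightarrow> (\<forall>z z'. (\<forall>p\<le>l. z p = z' p) \<longrightarrow> G z = G z')"

lemma depends_uptoD: "depends_upto l G \<Longrightarrow> (\<And>p. p \<le> l \<Longrightarrow> z p = z' p) \<Longrightarrow> G z = G z'"
  by (auto simp: depends_upto_def)

lemma depends_upto_ylog:
  assumes G: "depends_upto k G" and "l \<le> k"
  shows "depends_upto l (ylog k n \<rho> G l)"
  using assms(2)
proof (induction l rule: ylog_induct)
  case last
  then show ?case
    using G unfolding depends_upto_def ylog_last by metis
next
  case (step l)
  show ?case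
    unfolding depends_upto_def
  proof (intro allI impI)
    fix z z' :: "nat \<Rightarrow> 'a" assume "\<forall>p\<le>l. z p = z' p"
    then have "ylog k n \<rho> G (Suc l) (z(Suc l := x)) = ylog k n \<rho> G (Suc l) (z'(Suc l := x))" for x
      by (intro depends_uptoD[OF step.IH]) auto
    with step show "ylog k n \<rho> G l z = ylog k n \<rho> G l z'"
      by (simp add: ylog_step)
  qed
qed

text \<open>A function on I is read as a total function that is \<open>undefined\<close> off I.
  Functionals of full sequences can thereby be integrated against product measures over finitely
  many columns or over part of the tree.\<close>

lemma measurable_PiM_UNIV_id:
  assumes "\<And>i. i \<in> I \<Longrightarrow> sets (M i) = sets (N i)" and N: "\<And>i. space (N i) = UNIV"
  shows "(\<lambda>z. z) \<in> PiM I M \<rightarrow>\<^sub>M PiM UNIV N"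
proof (rule measurable_PiM_single')
  fix i
  show "(\<lambda>z. z i) \<in> PiM I M \<rightarrow>\<^sub>M N i"
  proof (cases "i \<in> I")
    case True
    then show ?thesis
      using measurable_component_singleton[OF True, of M] assms(1) by (simp cong: measurable_cong_sets)
  next
    case False
    then have "(\<lambda>z. z i) \<in> PiM I M \<rightarrow>\<^sub>M N i \<longleftrightarrow> (\<lambda>z. undefined) \<in> PiM I M \<rightarrow>\<^sub>M N i"
      by (intro measurable_cong) (auto simp: space_PiM PiE_def extensional_def)
    then show ?thesis
      using N by simp
  qed
qed (use N in auto)

lemma measurable_fun_upd_UNIV [measurable (raw)]:
  assumes f [measurable]: "f \<in> N \<rightarrow>\<^sub>M PiM UNIV M" and g [measurable]: "g \<in> N \<rightarrow>\<^sub>M M i"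
  shows "(\<lambda>x. (f x)(i := g x)) \<in> N \<rightarrow>\<^sub>M PiM UNIV M"
  by (rule measurable_fun_upd[where J=UNIV]) (auto intro: f g)

abbreviation (input) seqs :: "('i \<Rightarrow> 'c::topological_space) measure" where
  "seqs \<equiv> PiM UNIV (\<lambda>_. borel)"

text \<open>Joint measurability in the parameter h and the columns is required because the disorder
  is integrated last, by Fubini.\<close>

lemma measurable_ylog_param:
  fixes G :: "'h \<Rightarrow> (nat \<Rightarrow> 'c::topological_space) \<Rightarrow> real"
  assumes \<rho>: "\<And>l. l \<le> k \<Longrightarrow> prob_space (\<rho> l)" "\<And>l. l \<le> k \<Longrightarrow> sets (\<rho> l) = sets borel"
    and G: "(\<lambda>(h, z). G h z) \<in> borel_measurable (N \<Otimes>\<^sub>M seqs)" and "l \<le> k"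
  shows "(\<lambda>(h, z). ylog k n \<rho> (G h) l z) \<in> borel_measurable (N \<Otimes>\<^sub>M seqs)"
  using assms(4)
proof (induction l rule: ylog_induct)
  case last
  then show ?case
    using G by (simp add: ylog_last case_prod_beta')
next
  case (step l)
  interpret prob_space "\<rho> (Suc l)"
    using step by (intro \<rho>) auto
  have [measurable_cong]: "sets (\<rho> (Suc l)) = sets borel"
    using step by (intro \<rho>) auto
  have upd: "(\<lambda>(a, x). (fst a, (snd a)(Suc l := x))) \<in> (N \<Otimes>\<^sub>M seqs) \<Otimes>\<^sub>M \<rho> (Suc l) \<rightarrow>\<^sub>M N \<Otimes>\<^sub>M seqs"
    by measurable
  have "(\<lambda>(a, x). exp (n (Suc l) * ylog k n \<rho> (G (fst a)) (Suc l) ((snd a)(Suc l := x)))) \<in> borel_measurable ((N \<Otimes>\<^sub>M seqs) \<Otimes>\<^sub>M \<rho> (Suc l))"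
    using measurable_compose[OF measurable_compose[OF upd step.IH], of "\<lambda>y. exp (n (Suc l) * y)"]
    by (simp add: case_prod_beta')
  then have [measurable]: "(\<lambda>a. \<integral>x. exp (n (Suc l) * ylog k n \<rho> (G (fst a)) (Suc l) ((snd a)(Suc l := x))) \<partial>\<rho> (Suc l)) \<in> borel_measurable (N \<Otimes>\<^sub>M seqs)"
    by (rule borel_measurable_lebesgue_integral)
  show ?case
    using step by (simp add: ylog_step case_prod_beta')
qed

lemma measurable_ylog:
  fixes G :: "(nat \<Rightarrow> 'c::topological_space) \<Rightarrow> real"
  assumes \<rho>: "\<And>l. l \<le> k \<Longrightarrow> prob_space (\<rho> l)" "\<And>l. l \<le> k \<Longrightarrow> sets (\<rho> l) = sets borel"
    and G: "G \<in> borel_measurable seqs" and l: "l \<le> k"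
  shows "ylog k n \<rho> G l \<in> borel_measurable seqs"
proof -
  have "(\<lambda>(h, z). ylog k n \<rho> G l z) \<in> borel_measurable (count_space UNIV \<Otimes>\<^sub>M seqs)"
    by (rule measurable_ylog_param[OF \<rho> _ l]) (use G in simp_all)
  from measurable_compose[OF measurable_Pair1' this] show ?thesis
    by simp
qed

lemma (in prob_space) integral_exp_pos:
  fixes f :: "'a \<Rightarrow> real"
  assumes "integrable M (\<lambda>x. exp (f x))"
  shows "0 < (\<integral>x. exp (f x) \<partial>M)"
proof -
  have "(\<integral>x. exp (f x) \<partial>M) \<noteq> 0"
  proof
    assume "(\<integral>x. exp (f x) \<partial>M) = 0"
    then have "AE x in M. exp (f x) = 0"
      using assms by (subst (asm) integral_nonneg_eq_0_iff_AE) auto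
    then have "AE x in M. False"
      by (rule eventually_mono) auto
    then show False
      by (simp add: AE_False)
  qed
  moreover have "0 \<le> (\<integral>x. exp (f x) \<partial>M)"
    by (intro integral_nonneg_AE) auto
  ultimately show ?thesis by linarith
qed

text \<open>Columns are abstract because the recursion is instantiated twice: with the parameters
  \<open>m\<close> on single columns and with the parameters of the cascade on pairs of
  columns.\<close>

locale hierarchy =
  fixes k :: nat and n :: "nat \<Rightarrow> real" and \<rho> :: "nat \<Rightarrow> 'c::topological_space measure"
  assumes n_pos: "\<And>l. 1 \<le> l \<Longrightarrow> l \<le> k \<Longrightarrow> 0 < n l"
    and n_less_1: "\<And>l. 1 \<le> l \<Longrightarrow> l \<le> k \<Longrightarrow> n l < 1"
    and \<rho>_prob: "\<And>l. prob_space (\<rho> l)"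
    and sets_\<rho> [measurable_cong, simp]: "\<And>l. sets (\<rho> l) = sets borel"
begin

abbreviation "Y \<equiv> ylog k n \<rho>"

lemma space_\<rho> [simp]: "space (\<rho> l) = UNIV"
  using sets_eq_imp_space_eq[OF sets_\<rho>] by simp

text \<open>Under these conditions no integral or logarithm in the recursion takes a default value.
  Integrability is asked for every z, so the recursion holds pointwise and not just almost
  everywhere.\<close>

definition admissible :: "((nat \<Rightarrow> 'c) \<Rightarrow> real) \<Rightarrow> bool" where
  "admissible G \<longleftrightarrow> G \<in> borel_measurable seqs \<and> (\<forall>z. 0 < G z) \<and> depends_upto k G \<and>
    (\<forall>l<k. \<forall>z. integrable (\<rho> (Suc l)) (\<lambda>x. exp (n (Suc l) * Y G (Suc l) (z(Suc l := x)))))"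

lemma measurable_Y: "G \<in> borel_measurable seqs \<Longrightarrow> l \<le> k \<Longrightarrow> Y G l \<in> borel_measurable seqs"
  by (intro measurable_ylog \<rho>_prob sets_\<rho>)

lemma admissible_measurable_Y: "admissible G \<Longrightarrow> l \<le> k \<Longrightarrow> Y G l \<in> borel_measurable seqs"
  by (intro measurable_Y) (auto simp: admissible_def)

lemma measurable_upd [measurable]: "(\<lambda>x. z(i := x)) \<in> borel \<rightarrow>\<^sub>M (seqs :: (nat \<Rightarrow> 'c) measure)"
  by (rule measurable_fun_upd_UNIV) (auto simp: space_PiM)

lemma exp_Y_step:
  assumes "admissible G" "l < k"
  shows "exp (n (Suc l) * Y G l z) = (\<integral>x. exp (n (Suc l) * Y G (Suc l) (z(Suc l := x))) \<partial>\<rho> (Suc l))"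
proof -
  interpret prob_space "\<rho> (Suc l)" by (rule \<rho>_prob)
  have "0 < (\<integral>x. exp (n (Suc l) * Y G (Suc l) (z(Suc l := x))) \<partial>\<rho> (Suc l))"
    using assms by (intro integral_exp_pos) (auto simp: admissible_def)
  then show ?thesis
    using assms n_pos[of "Suc l"] by (simp add: ylog_step)
qed

lemma nn_integral_exp_Y_step:
  assumes "admissible G" "l < k"
  shows "(\<integral>\<^sup>+x. ennreal (exp (n (Suc l) * Y G (Suc l) (z(Suc l := x)))) \<partial>\<rho> (Suc l)) = ennreal (exp (n (Suc l) * Y G l z))"
  using assms by (subst exp_Y_step) (auto intro!: nn_integral_eq_integral simp: admissible_def)

text \<open>The recursion is monotone in the terminal function, and multiplying that function by
  exp(a) adds a at every level. The upper bound at one level gives the integrability that the level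
  below it needs.\<close>

lemma Y_comparison:
  assumes G: "admissible G" and G' [measurable]: "G' \<in> borel_measurable seqs" and dep: "depends_upto k G'"
    and le: "\<And>z. G z \<le> G' z" "\<And>z. G' z \<le> exp a * G z"
  shows "admissible G'" and "l \<le> k \<Longrightarrow> Y G l z \<le> Y G' l z" and "l \<le> k \<Longrightarrow> Y G' l z \<le> Y G l z + a"
proof -
  have pos: "0 < G z" "0 < G' z" for z
    using G le(1)[of z] by (auto simp: admissible_def intro: less_le_trans)
  have int: "integrable (\<rho> (Suc l)) (\<lambda>x. exp (n (Suc l) * Y G' (Suc l) (z(Suc l := x))))"
    if "l < k" "\<And>z. Y G' (Suc l) z \<le> Y G (Suc l) z + a" for l z
  proof (rule Bochner_Integration.integrable_bound)
    show "integrable (\<rho> (Suc l)) (\<lambda>x. exp (n (Suc l) * a) * exp (n (Suc l) * Y G (Suc l) (z(Suc l := x))))"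
      using G that(1) by (intro integrable_mult_right) (auto simp: admissible_def)
    have [measurable]: "Y G' (Suc l) \<in> borel_measurable seqs"
      using that by (intro measurable_Y G') auto
    show "(\<lambda>x. exp (n (Suc l) * Y G' (Suc l) (z(Suc l := x)))) \<in> borel_measurable (\<rho> (Suc l))"
      by measurable
    have "n (Suc l) * Y G' (Suc l) (z(Suc l := x)) \<le> n (Suc l) * a + n (Suc l) * Y G (Suc l) (z(Suc l := x))" for x
      using mult_left_mono[OF that(2)[of "z(Suc l := x)"], of "n (Suc l)"] n_pos[of "Suc l"] that(1)
      by (simp add: algebra_simps)
    then show "AE x in \<rho> (Suc l). norm (exp (n (Suc l) * Y G' (Suc l) (z(Suc l := x)))) \<le>
        norm (exp (n (Suc l) * a) * exp (n (Suc l) * Y G (Suc l) (z(Suc l := x))))"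
      by (simp add: exp_add[symmetric])
  qed
  have *: "(\<forall>z. Y G l z \<le> Y G' l z) \<and> (\<forall>z. Y G' l z \<le> Y G l z + a)" if "l \<le> k" for l
    using that
  proof (induction l rule: ylog_induct)
    case last
    have "ln (G' z) \<le> ln (G z) + a" for z
    proof -
      have "ln (G' z) \<le> ln (exp a * G z)"
        using le(2)[of z] pos[of z] by simp
      then show ?thesis
        using pos(1)[of z] by (simp add: ln_mult)
    qed
    then show ?case
      using le(1) pos by (auto simp: ylog_last)
  next
    case (step l)
    let ?n = "n (Suc l)"
    have n: "0 < ?n" using n_pos step by simp
    interpret prob_space "\<rho> (Suc l)" by (rule \<rho>_prob)
    have i1: "integrable (\<rho> (Suc l)) (\<lambda>x. exp (?n * Y G (Suc l) (z(Suc l := x))))" for z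
      using G step by (auto simp: admissible_def)
    have i2: "integrable (\<rho> (Suc l)) (\<lambda>x. exp (?n * Y G' (Suc l) (z(Suc l := x))))" for z
      using step by (intro int) auto
    have p1: "0 < (\<integral>x. exp (?n * Y G (Suc l) (z(Suc l := x))) \<partial>\<rho> (Suc l))" for z
      by (rule integral_exp_pos[OF i1])
    have p2: "0 < (\<integral>x. exp (?n * Y G' (Suc l) (z(Suc l := x))) \<partial>\<rho> (Suc l))" for z
      by (rule integral_exp_pos[OF i2])
    have 1: "(\<integral>x. exp (?n * Y G (Suc l) (z(Suc l := x))) \<partial>\<rho> (Suc l)) \<le> (\<integral>x. exp (?n * Y G' (Suc l) (z(Suc l := x))) \<partial>\<rho> (Suc l))" for z
      using step n by (intro integral_mono i1 i2) auto
    have 2: "(\<integral>x. exp (?n * Y G' (Suc l) (z(Suc l := x))) \<partial>\<rho> (Suc l)) \<le> exp (?n * a) * (\<integral>x. exp (?n * Y G (Suc l) (z(Suc l := x))) \<partial>\<rho> (Suc l))" for z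
    proof -
      have "?n * Y G' (Suc l) (z(Suc l := x)) \<le> ?n * a + ?n * Y G (Suc l) (z(Suc l := x))" for x
        using mult_left_mono[of "Y G' (Suc l) (z(Suc l := x))" "Y G (Suc l) (z(Suc l := x)) + a" ?n] n step
        by (simp add: algebra_simps)
      then have "(\<integral>x. exp (?n * Y G' (Suc l) (z(Suc l := x))) \<partial>\<rho> (Suc l)) \<le> (\<integral>x. exp (?n * a) * exp (?n * Y G (Suc l) (z(Suc l := x))) \<partial>\<rho> (Suc l))"
        by (intro integral_mono i2 integrable_mult_right i1) (simp add: exp_add[symmetric])
      then show ?thesis by simp
    qed
    show ?case
    proof (intro conjI allI)
      fix z
      show "Y G l z \<le> Y G' l z"
        using step(1) n 1[of z] p1[of z] p2[of z] by (simp add: ylog_step divide_right_mono)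
      have "ln (\<integral>x. exp (?n * Y G' (Suc l) (z(Suc l := x))) \<partial>\<rho> (Suc l)) \<le> ln (exp (?n * a) * (\<integral>x. exp (?n * Y G (Suc l) (z(Suc l := x))) \<partial>\<rho> (Suc l)))"
        using 2[of z] p1[of z] p2[of z] by (subst ln_le_cancel_iff) auto
      also have "\<dots> = ?n * a + ln (\<integral>x. exp (?n * Y G (Suc l) (z(Suc l := x))) \<partial>\<rho> (Suc l))"
        using p1[of z] by (simp add: ln_mult)
      finally show "Y G' l z \<le> Y G l z + a"
        using step(1) n by (simp add: ylog_step field_simps)
    qed
  qed
  show "l \<le> k \<Longrightarrow> Y G l z \<le> Y G' l z" "l \<le> k \<Longrightarrow> Y G' l z \<le> Y G l z + a"
    using * by auto
  show "admissible G'"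
    unfolding admissible_def using pos dep int * by auto
qed

text \<open>A bound by a constant plus a nonnegative function of each column survives the recursion.
  Since n < 1, the moment of exp(n \<kappa>) is at most that of exp(\<kappa>), so one exponential
  moment per column suffices at all levels.\<close>

lemma admissible_exp_bound:
  assumes G [measurable]: "G \<in> borel_measurable seqs" and pos: "\<And>z. 0 < G z" and dep: "depends_upto k G"
    and \<kappa> [measurable]: "\<kappa> \<in> borel_measurable borel" and \<kappa>_nonneg: "\<And>x. 0 \<le> \<kappa> x"
    and \<kappa>_int: "\<And>l. l \<le> k \<Longrightarrow> integrable (\<rho> l) (\<lambda>x. exp (\<kappa> x))"
    and le: "\<And>z. G z \<le> exp (b + (\<Sum>p\<le>k. \<kappa> (z p)))"
  shows "admissible G"
proof -
  have int: "integrable (\<rho> (Suc l)) (\<lambda>x. exp (n (Suc l) * Y G (Suc l) (z(Suc l := x)))) \<and>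
      (\<integral>x. exp (n (Suc l) * Y G (Suc l) (z(Suc l := x))) \<partial>\<rho> (Suc l)) \<le>
        exp (n (Suc l) * (c + (\<Sum>p\<le>l. \<kappa> (z p)))) * (\<integral>x. exp (\<kappa> x) \<partial>\<rho> (Suc l))"
    if "l < k" and bound: "\<And>z. Y G (Suc l) z \<le> c + (\<Sum>p\<le>Suc l. \<kappa> (z p))" for l c z
  proof -
    have n: "0 < n (Suc l)" "n (Suc l) < 1"
      using that n_pos n_less_1 by auto
    have [measurable]: "Y G (Suc l) \<in> borel_measurable seqs"
      using that by (intro measurable_Y G) auto
    have i: "integrable (\<rho> (Suc l)) (\<lambda>x. exp (n (Suc l) * (c + (\<Sum>p\<le>l. \<kappa> (z p)))) * exp (\<kappa> x))"
      using that by (intro integrable_mult_right \<kappa>_int) auto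
    have le': "exp (n (Suc l) * Y G (Suc l) (z(Suc l := x))) \<le> exp (n (Suc l) * (c + (\<Sum>p\<le>l. \<kappa> (z p)))) * exp (\<kappa> x)" for x
    proof -
      have "Y G (Suc l) (z(Suc l := x)) \<le> c + (\<Sum>p\<le>l. \<kappa> (z p)) + \<kappa> x"
        using bound[of "z(Suc l := x)"] by (simp add: add.assoc)
      then have "n (Suc l) * Y G (Suc l) (z(Suc l := x)) \<le> n (Suc l) * (c + (\<Sum>p\<le>l. \<kappa> (z p)) + \<kappa> x)"
        using n by simp
      also have "\<dots> \<le> n (Suc l) * (c + (\<Sum>p\<le>l. \<kappa> (z p))) + \<kappa> x"
        using n \<kappa>_nonneg[of x] by (simp add: algebra_simps mult_left_le)
      finally show ?thesis
        by (simp add: exp_add[symmetric])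
    qed
    have i': "integrable (\<rho> (Suc l)) (\<lambda>x. exp (n (Suc l) * Y G (Suc l) (z(Suc l := x))))"
      by (rule Bochner_Integration.integrable_bound[OF i]) (use le' in auto)
    then show ?thesis
      using integral_mono[OF i' i] le' by simp
  qed
  have bound: "\<exists>c. \<forall>z. Y G l z \<le> c + (\<Sum>p\<le>l. \<kappa> (z p))" if "l \<le> k" for l
    using that
  proof (induction l rule: ylog_induct)
    case last
    have "ln (G z) \<le> b + (\<Sum>p\<le>k. \<kappa> (z p))" for z
      using le[of z] pos[of z] by (metis ln_exp ln_le_cancel_iff exp_gt_zero)
    then show ?case
      by (auto simp: ylog_last)
  next
    case (step l)
    then obtain c where c: "\<And>z. Y G (Suc l) z \<le> c + (\<Sum>p\<le>Suc l. \<kappa> (z p))"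
      by auto
    let ?n = "n (Suc l)"
    have n: "0 < ?n" using n_pos step by simp
    interpret prob_space "\<rho> (Suc l)" by (rule \<rho>_prob)
    have E: "0 < (\<integral>x. exp (\<kappa> x) \<partial>\<rho> (Suc l))"
      using step by (intro integral_exp_pos \<kappa>_int) auto
    have "Y G l z \<le> (c + ln (\<integral>x. exp (\<kappa> x) \<partial>\<rho> (Suc l)) / ?n) + (\<Sum>p\<le>l. \<kappa> (z p))" for z
    proof -
      have "0 < (\<integral>x. exp (?n * Y G (Suc l) (z(Suc l := x))) \<partial>\<rho> (Suc l))"
        using int[OF step(1) c, of z] by (intro integral_exp_pos) auto
      then have "ln (\<integral>x. exp (?n * Y G (Suc l) (z(Suc l := x))) \<partial>\<rho> (Suc l)) \<le>
          ln (exp (?n * (c + (\<Sum>p\<le>l. \<kappa> (z p)))) * (\<integral>x. exp (\<kappa> x) \<partial>\<rho> (Suc l)))"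
        using int[OF step(1) c, of z] E by (subst ln_le_cancel_iff) auto
      also have "\<dots> = ?n * (c + (\<Sum>p\<le>l. \<kappa> (z p))) + ln (\<integral>x. exp (\<kappa> x) \<partial>\<rho> (Suc l))"
        using E by (simp add: ln_mult)
      finally show ?thesis
        using step(1) n by (simp add: ylog_step field_simps)
    qed
    then show ?case by blast
  qed
  show ?thesis
    unfolding admissible_def
  proof (intro conjI allI impI)
    fix l z assume "l < k"
    moreover from this obtain c where "\<And>z. Y G (Suc l) z \<le> c + (\<Sum>p\<le>Suc l. \<kappa> (z p))"
      using bound[of "Suc l"] by auto
    ultimately show "integrable (\<rho> (Suc l)) (\<lambda>x. exp (n (Suc l) * Y G (Suc l) (z(Suc l := x))))"
      using int by blast
  qed (use G pos dep in auto)
qed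

end

subsection \<open>The Laplace transform of the cascade sum\<close>

text \<open>Inverse of \<open>eneg\<close> on (0,1]. After averaging over a mark, a node contributes
  a factor in this interval; as an exponent it can be fed into the Laplace functional of the next
  level.\<close>

definition nlog :: "ennreal \<Rightarrow> ennreal" where
  "nlog e = ennreal (- ln (enn2real e))"

lemma eneg_nlog:
  assumes "0 < e" "e \<le> 1"
  shows "eneg (nlog e) = e"
proof -
  obtain a where a: "e = ennreal a" "0 \<le> a"
    using assms by (cases e) (auto simp: top_unique)
  with assms have "0 < a" "a \<le> 1"
    by auto
  with a show ?thesis
    by (simp add: nlog_def eneg_ennreal)
qed

lemma measurable_nlog [measurable]: "nlog \<in> borel_measurable borel"
  unfolding nlog_def by measurable

lemma eneg_pos: "a < top \<Longrightarrow> 0 < eneg a"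
  by (auto simp: eneg_def)

text \<open>Strict positivity of the mean is what makes \<open>eneg_nlog\<close> applicable to
  it.\<close>

lemma (in prob_space) nn_integral_eneg_bounds:
  assumes [measurable]: "f \<in> borel_measurable M" and fin: "\<And>x. f x < top"
  shows "0 < (\<integral>\<^sup>+x. eneg (f x) \<partial>M)" "(\<integral>\<^sup>+x. eneg (f x) \<partial>M) \<le> 1"
proof -
  have "(\<integral>\<^sup>+x. eneg (f x) \<partial>M) \<noteq> 0"
  proof
    assume "(\<integral>\<^sup>+x. eneg (f x) \<partial>M) = 0"
    then have "AE x in M. eneg (f x) = 0"
      by (subst (asm) nn_integral_0_iff_AE) auto
    then have "AE x in M. False"
      by (rule eventually_mono) (use eneg_pos[OF fin] in \<open>auto simp: less_le\<close>)
    then show False by (simp add: AE_False)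
  qed
  then show "0 < (\<integral>\<^sup>+x. eneg (f x) \<partial>M)"
    by (simp add: zero_less_iff_neq_zero)
  have "(\<integral>\<^sup>+x. eneg (f x) \<partial>M) \<le> (\<integral>\<^sup>+x. 1 \<partial>M)"
    by (intro nn_integral_mono) simp
  then show "(\<integral>\<^sup>+x. eneg (f x) \<partial>M) \<le> 1"
    by (simp add: emeasure_space_1)
qed

lemma borel_measurable_nn_integral_count_space [measurable (raw)]:
  fixes I :: "'i::countable set"
  assumes "\<And>i. f i \<in> borel_measurable M"
  shows "(\<lambda>x. \<integral>\<^sup>+i. f i x \<partial>count_space I) \<in> borel_measurable M"
  by (rule borel_measurable_LIMSEQ_order[OF count_space_tendsto_sum]) (intro borel_measurable_sum assms)

lemma sigma_finite_intensity: "sigma_finite_measure (intensity n)"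
  unfolding intensity_def by (subst sigma_finite_measure.sigma_finite_iff_density_finite[OF sigma_finite_lborel]) auto

lemma nn_integral_count_space_Times:
  "(\<integral>\<^sup>+x. f x \<partial>count_space (A \<times> B)) = (\<integral>\<^sup>+a. \<integral>\<^sup>+b. f (a, b) \<partial>count_space B \<partial>count_space A)"
proof -
  have "(\<integral>\<^sup>+x. f x \<partial>count_space (A \<times> B)) = (\<integral>\<^sup>+x. f x * indicator A (fst x) * indicator B (snd x) \<partial>count_space UNIV)"
    by (subst nn_integral_count_space_indicator) (auto intro!: nn_integral_cong split: split_indicator)
  also have "\<dots> = (\<integral>\<^sup>+a. \<integral>\<^sup>+b. f (a, b) * indicator A a * indicator B b \<partial>count_space UNIV \<partial>count_space UNIV)"
    by (subst nn_integral_fst_count_space[symmetric]) simp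
  also have "\<dots> = (\<integral>\<^sup>+a. (\<integral>\<^sup>+b. f (a, b) * indicator B b \<partial>count_space UNIV) * indicator A a \<partial>count_space UNIV)"
    by (intro nn_integral_cong) (auto split: split_indicator)
  also have "\<dots> = (\<integral>\<^sup>+a. \<integral>\<^sup>+b. f (a, b) \<partial>count_space B \<partial>count_space A)"
    by (simp add: nn_integral_count_space_indicator[where X=B and f="\<lambda>b. f (_, b)"] nn_integral_count_space_indicator[where X=A])
  finally show ?thesis .
qed

lemma nn_integral_count_space_snoc:
  "(\<integral>\<^sup>+\<gamma>. f \<gamma> \<partial>count_space {\<gamma>. length \<gamma> = Suc l}) =
    (\<integral>\<^sup>+\<beta>. \<integral>\<^sup>+j. f (\<beta> @ [j]) \<partial>count_space UNIV \<partial>count_space {\<beta>. length \<beta> = l})"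
proof -
  let ?L = "{\<beta>. length \<beta> = l}"
  have "bij_betw (\<lambda>(\<beta>, j). \<beta> @ [j]) (?L \<times> UNIV) {\<gamma>. length \<gamma> = Suc l}"
  proof (rule bij_betw_byWitness[where f'="\<lambda>\<gamma>. (butlast \<gamma>, last \<gamma>)"])
    show "\<forall>\<gamma>\<in>{\<gamma>. length \<gamma> = Suc l}. (case (butlast \<gamma>, last \<gamma>) of (\<beta>, j) \<Rightarrow> \<beta> @ [j]) = \<gamma>"
      by (auto intro!: append_butlast_last_id)
  qed auto
  from nn_integral_bij_count_space[OF this, of f]
  have "(\<integral>\<^sup>+\<gamma>. f \<gamma> \<partial>count_space {\<gamma>. length \<gamma> = Suc l}) =
    (\<integral>\<^sup>+x. f (fst x @ [snd x]) \<partial>count_space (?L \<times> UNIV))"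
    by (simp add: case_prod_beta')
  also have "\<dots> = (\<integral>\<^sup>+\<beta>. \<integral>\<^sup>+j. f (\<beta> @ [j]) \<partial>count_space UNIV \<partial>count_space ?L)"
    by (simp add: nn_integral_count_space_Times)
  finally show ?thesis .
qed

text \<open>The labels met from the root to \<beta>, as a sequence. Past the end of \<beta> the last
  label repeats, a default that functionals depending only on the first
  \<open>length \<beta>\<close> levels do not see.\<close>

definition path :: "(nat list \<Rightarrow> 'c) \<Rightarrow> nat list \<Rightarrow> nat \<Rightarrow> 'c" where
  "path z \<beta> p = z (take p \<beta>)"

lemma measurable_path [measurable]: "(\<lambda>z. path z \<beta>) \<in> seqs \<rightarrow>\<^sub>M seqs"
proof -
  have "(\<lambda>z p. z (take p \<beta>)) \<in> seqs \<rightarrow>\<^sub>M seqs"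
    by (rule measurable_PiM_single') (auto simp: space_PiM)
  then show ?thesis
    unfolding path_def[abs_def] .
qed

text \<open>Points are stored by parent: \<open>w \<beta> j\<close> is the point of the j-th child
  of \<beta>. In this way the whole point process below \<beta> is a single coordinate of a product
  measure.\<close>

definition vprod :: "(nat list \<Rightarrow> nat \<Rightarrow> real) \<Rightarrow> nat list \<Rightarrow> real" where
  "vprod w \<beta> = (\<Prod>p<length \<beta>. w (take p \<beta>) (\<beta> ! p))"

lemma vprod_snoc: "vprod w (\<beta> @ [j]) = vprod w \<beta> * w \<beta> j"
  by (simp add: vprod_def nth_append)

lemma vprod_cong: "(\<And>\<gamma>. length \<gamma> < length \<beta> \<Longrightarrow> w \<gamma> = w' \<gamma>) \<Longrightarrow> vprod w \<beta> = vprod w' \<beta>"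
  by (auto simp: vprod_def intro!: prod.cong)

abbreviation (input) wseqs :: "(nat list \<Rightarrow> nat \<Rightarrow> real) measure" where
  "wseqs \<equiv> PiM UNIV (\<lambda>_. seqs)"

lemma measurable_points:
  assumes "f \<in> N \<rightarrow>\<^sub>M wseqs"
  shows "(\<lambda>x. f x \<beta> j) \<in> borel_measurable N"
proof -
  have "(\<lambda>w. w \<beta>) \<in> wseqs \<rightarrow>\<^sub>M seqs" "(\<lambda>x. x j) \<in> borel_measurable (seqs :: (nat \<Rightarrow> real) measure)"
    by (rule measurable_component_singleton[OF UNIV_I])+
  from measurable_compose[OF assms measurable_compose[OF this]] show ?thesis .
qed

lemma measurable_vprod [measurable]: "(\<lambda>w. vprod w \<beta>) \<in> borel_measurable wseqs"
  unfolding vprod_def by (intro borel_measurable_prod measurable_points) simp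

text \<open>\<open>Q \<beta>\<close> is the law of the entire sequence of points below \<beta>. Of
  its Poisson structure two facts are retained: positivity and the Laplace functional.\<close>

locale tree_hierarchy = hierarchy k n \<rho>
  for k n and \<rho> :: "nat \<Rightarrow> 'c::topological_space measure" +
  fixes Q :: "nat list \<Rightarrow> (nat \<Rightarrow> real) measure"
  assumes n_less: "\<And>l. 1 \<le> l \<Longrightarrow> l < k \<Longrightarrow> n l < n (Suc l)"
    and Q_prob: "\<And>\<beta>. prob_space (Q \<beta>)"
    and sets_Q [measurable_cong, simp]: "\<And>\<beta>. sets (Q \<beta>) = sets seqs"
    and Q_pos: "\<And>\<beta>. length \<beta> < k \<Longrightarrow> AE x in Q \<beta>. \<forall>j. 0 < x j"
    and Q_laplace: "\<And>\<beta> \<phi>. length \<beta> < k \<Longrightarrow> \<phi> \<in> borel_measurable borel \<Longrightarrow>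
      (\<integral>\<^sup>+x. eneg (\<integral>\<^sup>+j. \<phi> (x j) \<partial>count_space UNIV) \<partial>Q \<beta>) =
      eneg (\<integral>\<^sup>+x. (1 - eneg (\<phi> x)) \<partial>intensity (n (Suc (length \<beta>))))"
begin

text \<open>Indexing by all lists keeps resampling identities free of restrictions; the passage from
  the actual nodes of depth at most k is made by \<open>nn_integral_PiM_restrict\<close>.\<close>

definition "PZ = PiM UNIV (\<lambda>\<beta>::nat list. \<rho> (length \<beta>))"
definition "PW = PiM UNIV Q"

lemma sets_PZ [measurable_cong, simp]: "sets PZ = sets seqs"
  unfolding PZ_def by (intro sets_PiM_cong) auto

lemma sets_PW [measurable_cong, simp]: "sets PW = sets wseqs"
  unfolding PW_def by (intro sets_PiM_cong) auto

sublocale PZ: prob_space PZ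
  unfolding PZ_def by (intro prob_space_PiM \<rho>_prob)

sublocale PW: prob_space PW
  unfolding PW_def by (intro prob_space_PiM Q_prob)

sublocale PWZ: pair_prob_space PW PZ ..

text \<open>The exponents are continued by the value 1 at level \<open>k + 1\<close>, so that the leaves behave like
  all other levels.\<close>

definition expo :: "nat \<Rightarrow> real" where
  "expo l = (if l \<le> k then n l else 1)"

lemma expo_pos: "1 \<le> l \<Longrightarrow> 0 < expo l"
  using n_pos by (simp add: expo_def)

lemma expo_less: "1 \<le> l \<Longrightarrow> l \<le> k \<Longrightarrow> expo l < expo (Suc l)"
  using n_less[of l] n_less_1[of l] by (auto simp: expo_def)

text \<open>The constant C of the Laplace transform, accumulated upwards from the leaves:
  \<open>level_const (k - l)\<close> belongs to level l, and the full constant is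
  \<open>level_const k\<close>.\<close>

primrec level_const :: "nat \<Rightarrow> real" where
  "level_const 0 = 1"
| "level_const (Suc d) = stable_const (expo (k - d)) (expo (Suc (k - d))) (level_const d)"

lemma level_const_pos: "d \<le> k \<Longrightarrow> 0 < level_const d"
  by (induction d) (auto intro!: stable_const(2) expo_pos expo_less)

text \<open>The conditional Laplace exponent at s of the part of the tree sum below a node of level
  l, given the labels y on its path and the accumulated weight v. At l = k it is s * v * G y, the
  contribution of a single leaf.\<close>

definition level_term :: "((nat \<Rightarrow> 'c) \<Rightarrow> real) \<Rightarrow> real \<Rightarrow> nat \<Rightarrow> (nat \<Rightarrow> 'c) \<Rightarrow> real \<Rightarrow> real" where
  "level_term G s l y v = level_const (k - l) * (s * v * exp (Y G l y)) powr expo (Suc l)"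

lemma measurable_level_term:
  assumes "admissible G" "l \<le> k"
  shows "(\<lambda>(y, v). level_term G s l y v) \<in> borel_measurable (seqs \<Otimes>\<^sub>M borel)"
proof -
  have [measurable]: "Y G l \<in> borel_measurable seqs"
    using assms by (rule admissible_measurable_Y)
  show ?thesis
    unfolding level_term_def by measurable
qed

lemma measurable_level_term' [measurable (raw)]:
  assumes "admissible G" "l \<le> k" and [measurable]: "f \<in> N \<rightarrow>\<^sub>M seqs" "g \<in> borel_measurable N"
  shows "(\<lambda>x. level_term G s l (f x) (g x)) \<in> borel_measurable N"
  using measurable_compose[OF _ measurable_level_term[OF assms(1,2)], of "\<lambda>x. (f x, g x)" N] by simp

lemma level_term_cong:
  assumes "admissible G" "l \<le> k" "\<And>p. p \<le> l \<Longrightarrow> y p = y' p"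
  shows "level_term G s l y v = level_term G s l y' v"
proof -
  have "depends_upto l (Y G l)"
    using assms by (intro depends_upto_ylog) (auto simp: admissible_def)
  then show ?thesis
    using depends_uptoD[of l "Y G l" y y'] assms(3) by (simp add: level_term_def)
qed

definition level_mean :: "((nat \<Rightarrow> 'c) \<Rightarrow> real) \<Rightarrow> real \<Rightarrow> nat \<Rightarrow> (nat \<Rightarrow> 'c) \<Rightarrow> real \<Rightarrow> ennreal" where
  "level_mean G s l y v = (\<integral>\<^sup>+x. eneg (ennreal (level_term G s (Suc l) (y(Suc l := x)) v)) \<partial>\<rho> (Suc l))"

lemma measurable_level_mean [measurable (raw)]:
  assumes "admissible G" "l < k" and [measurable]: "f \<in> N \<rightarrow>\<^sub>M seqs" "g \<in> borel_measurable N"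
  shows "(\<lambda>x. level_mean G s l (f x) (g x)) \<in> borel_measurable N"
proof -
  interpret prob_space "\<rho> (Suc l)" by (rule \<rho>_prob)
  have [measurable]: "(\<lambda>q. level_term G s (Suc l) ((f (fst q))(Suc l := snd q)) (g (fst q))) \<in> borel_measurable (N \<Otimes>\<^sub>M \<rho> (Suc l))"
    using assms(1,2) by (intro measurable_level_term') (auto simp: Suc_le_eq intro!: measurable_fun_upd_UNIV)
  show ?thesis
    unfolding level_mean_def by (intro borel_measurable_nn_integral) (simp add: case_prod_beta')
qed

lemma level_mean_bounds:
  assumes "admissible G" "l < k"
  shows "0 < level_mean G s l y v" "level_mean G s l y v \<le> 1"
proof -
  interpret prob_space "\<rho> (Suc l)" by (rule \<rho>_prob)
  have [measurable]: "(\<lambda>x. level_term G s (Suc l) (y(Suc l := x)) v) \<in> borel_measurable (\<rho> (Suc l))"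
    using assms by (intro measurable_level_term') (auto simp: Suc_le_eq)
  show "0 < level_mean G s l y v" "level_mean G s l y v \<le> 1"
    unfolding level_mean_def by (intro nn_integral_eneg_bounds; simp)+
qed

lemma level_mean_cong:
  assumes "admissible G" "l < k" "\<And>p. p \<le> l \<Longrightarrow> y p = y' p"
  shows "level_mean G s l y v = level_mean G s l y' v"
  unfolding level_mean_def using assms
  by (intro nn_integral_cong arg_cong[where f=eneg] arg_cong[where f=ennreal] level_term_cong) auto

abbreviation "level l \<equiv> count_space {\<beta> :: nat list. length \<beta> = l}"

text \<open>First half of a level: with the points and the shallower marks fixed, the marks at level
  l + 1 are independent, so each can be averaged on its own. The resulting sum over children is then
  grouped by parent.\<close>

lemma integrate_marks:
  assumes G: "admissible G" and l: "l < k"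
  shows "(\<integral>\<^sup>+z. eneg (\<integral>\<^sup>+\<gamma>. ennreal (level_term G s (Suc l) (path z \<gamma>) (vprod w \<gamma>)) \<partial>level (Suc l)) \<partial>PZ) =
    (\<integral>\<^sup>+z. eneg (\<integral>\<^sup>+\<beta>. \<integral>\<^sup>+j. nlog (level_mean G s l (path z \<beta>) (vprod w \<beta> * w \<beta> j)) \<partial>count_space UNIV \<partial>level l) \<partial>PZ)"
    (is "(\<integral>\<^sup>+z. ?f z \<partial>PZ) = _")
proof -
  let ?J = "{\<gamma> :: nat list. length \<gamma> = Suc l}"
  have [measurable]: "(\<lambda>z. level_term G s (Suc l) (path z \<gamma>) (vprod w \<gamma>)) \<in> borel_measurable PZ" for \<gamma>
    using G l by (intro measurable_level_term') auto
  \<comment> \<open>The outer variable keeps all marks, the inner one supplies fresh marks at level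
    l + 1 only.\<close>
  have "(\<integral>\<^sup>+z. ?f z \<partial>PZ) = (\<integral>\<^sup>+z. \<integral>\<^sup>+z'. ?f (\<lambda>\<gamma>. if \<gamma> \<in> ?J then z' \<gamma> else z \<gamma>) \<partial>PZ \<partial>PZ)"
    unfolding PZ_def by (rule nn_integral_PiM_override[OF \<rho>_prob]) (simp add: PZ_def[symmetric])
  also have "\<dots> = (\<integral>\<^sup>+z. eneg (\<integral>\<^sup>+\<gamma>. nlog (level_mean G s l (path z \<gamma>) (vprod w \<gamma>)) \<partial>level (Suc l)) \<partial>PZ)"
  proof (intro nn_integral_cong)
    fix z
    have "?f (\<lambda>\<gamma>. if \<gamma> \<in> ?J then z' \<gamma> else z \<gamma>) =
      eneg (\<integral>\<^sup>+\<gamma>. ennreal (level_term G s (Suc l) ((path z \<gamma>)(Suc l := z' \<gamma>)) (vprod w \<gamma>)) \<partial>level (Suc l))" for z'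
      using G l
      by (intro arg_cong[where f=eneg] nn_integral_cong arg_cong[where f=ennreal] level_term_cong)
        (auto simp: path_def)
    then have "(\<integral>\<^sup>+z'. ?f (\<lambda>\<gamma>. if \<gamma> \<in> ?J then z' \<gamma> else z \<gamma>) \<partial>PZ) =
      (\<integral>\<^sup>+z'. eneg (\<integral>\<^sup>+\<gamma>. ennreal (level_term G s (Suc l) ((path z \<gamma>)(Suc l := z' \<gamma>)) (vprod w \<gamma>)) \<partial>level (Suc l)) \<partial>PZ)"
      by simp
    also have "\<dots> = eneg (\<integral>\<^sup>+\<gamma>. nlog (level_mean G s l (path z \<gamma>) (vprod w \<gamma>)) \<partial>level (Suc l))"
      unfolding PZ_def
    proof (rule nn_integral_eneg_PiM[OF \<rho>_prob])
      fix \<gamma> assume "\<gamma> \<in> ?J"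
      then have len: "length \<gamma> = Suc l" by simp
      show "(\<lambda>x. ennreal (level_term G s (Suc l) ((path z \<gamma>)(Suc l := x)) (vprod w \<gamma>))) \<in> borel_measurable (\<rho> (length \<gamma>))"
        using G l by (intro measurable_compose[OF _ measurable_ennreal] measurable_level_term') auto
      show "(\<integral>\<^sup>+x. eneg (ennreal (level_term G s (Suc l) ((path z \<gamma>)(Suc l := x)) (vprod w \<gamma>))) \<partial>\<rho> (length \<gamma>)) =
        eneg (nlog (level_mean G s l (path z \<gamma>) (vprod w \<gamma>)))"
        using level_mean_bounds[OF G l] unfolding len by (subst eneg_nlog) (auto simp: level_mean_def)
    qed
    finally show "(\<integral>\<^sup>+z'. ?f (\<lambda>\<gamma>. if \<gamma> \<in> ?J then z' \<gamma> else z \<gamma>) \<partial>PZ) =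
      eneg (\<integral>\<^sup>+\<gamma>. nlog (level_mean G s l (path z \<gamma>) (vprod w \<gamma>)) \<partial>level (Suc l))" .
  qed
  also have "\<dots> = (\<integral>\<^sup>+z. eneg (\<integral>\<^sup>+\<beta>. \<integral>\<^sup>+j. nlog (level_mean G s l (path z \<beta>) (vprod w \<beta> * w \<beta> j)) \<partial>count_space UNIV \<partial>level l) \<partial>PZ)"
  proof -
    \<comment> \<open>Once averaged over the child's own mark, the term depends on the parent's path
      alone.\<close>
    have "level_mean G s l (path z (\<beta> @ [j])) v = level_mean G s l (path z \<beta>) v" if "length \<beta> = l" for z \<beta> j v
      using G l that by (intro level_mean_cong) (auto simp: path_def)
    then show ?thesis
      unfolding nn_integral_count_space_snoc
      by (intro nn_integral_cong arg_cong[where f=eneg]) (simp add: vprod_snoc)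
  qed
  finally show ?thesis .
qed

text \<open>Second half of a level, at one parent. The Laplace functional produces the integral of 1
  minus the averaged factor; for a fixed mark, scaling extracts (s v exp Y)^n times the constant of
  the level, and averaging exp(n Y) over the mark is the recursion.\<close>

lemma integrate_points:
  assumes G: "admissible G" and l: "l < k" and s: "0 < s" and \<beta>: "length \<beta> = l" and v: "0 < v"
  shows "(\<integral>\<^sup>+x. eneg (\<integral>\<^sup>+j. nlog (level_mean G s l y (v * x j)) \<partial>count_space UNIV) \<partial>Q \<beta>) =
    eneg (ennreal (level_term G s l y v))"
proof -
  let ?n = "n (Suc l)" and ?D = "level_const (k - Suc l)" and ?Y = "\<lambda>x. Y G (Suc l) (y(Suc l := x))"
  interpret \<rho>: prob_space "\<rho> (Suc l)" by (rule \<rho>_prob)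
  interpret I: sigma_finite_measure "intensity ?n" by (rule sigma_finite_intensity)
  interpret P: pair_sigma_finite "intensity ?n" "\<rho> (Suc l)" ..
  have kl: "k - l = Suc (k - Suc l)" "k - (k - Suc l) = Suc l"
    using l by auto
  have expo_l: "expo (Suc l) = ?n"
    using l by (simp add: expo_def)
  have [measurable]: "Y G (Suc l) \<in> borel_measurable seqs"
    using l by (intro admissible_measurable_Y G) auto
  have "(\<integral>\<^sup>+x. eneg (\<integral>\<^sup>+j. nlog (level_mean G s l y (v * x j)) \<partial>count_space UNIV) \<partial>Q \<beta>) =
    eneg (\<integral>\<^sup>+x. (1 - eneg (nlog (level_mean G s l y (v * x)))) \<partial>intensity ?n)"
    using Q_laplace[of \<beta> "\<lambda>x. nlog (level_mean G s l y (v * x))"] \<beta> l G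
    by (simp add: measurable_level_mean space_PiM)
  also have "(\<integral>\<^sup>+x. (1 - eneg (nlog (level_mean G s l y (v * x)))) \<partial>intensity ?n) =
      (\<integral>\<^sup>+x. (1 - level_mean G s l y (v * x)) \<partial>intensity ?n)"
    using level_mean_bounds[OF G l] by (simp add: eneg_nlog)
  also have "\<dots> = (\<integral>\<^sup>+x. \<integral>\<^sup>+c. (1 - eneg (ennreal (?D * (s * (v * x) * exp (?Y c)) powr expo (Suc (Suc l))))) \<partial>\<rho> (Suc l) \<partial>intensity ?n)"
  proof (intro nn_integral_cong)
    fix x
    \<comment> \<open>Finiteness of the mean allows the subtraction to be moved under the integral
      over the mark, where 1 is written as the mass of \<open>\<rho> (Suc l)\<close>.\<close>
    have "level_mean G s l y (v * x) < top"
      using level_mean_bounds(2)[OF G l, of s y "v * x"] by (rule le_less_trans) simp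
    then show "1 - level_mean G s l y (v * x) =
        (\<integral>\<^sup>+c. (1 - eneg (ennreal (?D * (s * (v * x) * exp (?Y c)) powr expo (Suc (Suc l))))) \<partial>\<rho> (Suc l))"
      unfolding level_mean_def level_term_def
      by (subst nn_integral_diff) (use \<rho>.emeasure_space_1 in auto)
  qed
  also have "\<dots> = (\<integral>\<^sup>+c. \<integral>\<^sup>+x. (1 - eneg (ennreal (?D * (s * (v * x) * exp (?Y c)) powr expo (Suc (Suc l))))) \<partial>intensity ?n \<partial>\<rho> (Suc l))"
    by (intro P.Fubini'[symmetric]) measurable
  also have "\<dots> = (\<integral>\<^sup>+c. ennreal (level_const (k - l) * (s * v) powr ?n * exp (?n * ?Y c)) \<partial>\<rho> (Suc l))"
  proof (intro nn_integral_cong)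
    fix c
    let ?a = "s * v * exp (?Y c)"
    have a: "0 < ?a" using s v by simp
    have "(\<integral>\<^sup>+x. (1 - eneg (ennreal (?D * (s * (v * x) * exp (?Y c)) powr expo (Suc (Suc l))))) \<partial>intensity ?n) =
      (\<integral>\<^sup>+x. (1 - eneg (ennreal (?D * (?a * x) powr expo (Suc (Suc l))))) \<partial>intensity ?n)"
      by (simp add: mult_ac)
    also have "\<dots> = ennreal (?a powr ?n) * (\<integral>\<^sup>+x. (1 - eneg (ennreal (?D * x powr expo (Suc (Suc l))))) \<partial>intensity ?n)"
      using a by (rule nn_integral_intensity_scale) measurable
    also have "(\<integral>\<^sup>+x. (1 - eneg (ennreal (?D * x powr expo (Suc (Suc l))))) \<partial>intensity ?n) = ennreal (level_const (k - l))"
      unfolding kl level_const.simps expo_l[symmetric]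
      using l by (intro stable_const expo_pos expo_less level_const_pos) auto
    also have "?a powr ?n = (s * v) powr ?n * exp (?n * ?Y c)"
      using s v by (simp add: powr_mult powr_def exp_add[symmetric] ln_mult algebra_simps)
    also have "ennreal ((s * v) powr ?n * exp (?n * ?Y c)) * ennreal (level_const (k - l)) =
        ennreal (level_const (k - l) * (s * v) powr ?n * exp (?n * ?Y c))"
      using level_const_pos[of "k - l"] by (simp add: ennreal_mult''[symmetric] mult_ac)
    finally show "(\<integral>\<^sup>+x. (1 - eneg (ennreal (?D * (s * (v * x) * exp (?Y c)) powr expo (Suc (Suc l))))) \<partial>intensity ?n) =
        ennreal (level_const (k - l) * (s * v) powr ?n * exp (?n * ?Y c))" .
  qed
  also have "\<dots> = ennreal (level_const (k - l) * (s * v) powr ?n) * ennreal (exp (?n * Y G l y))"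
    using level_const_pos[of "k - l"] nn_integral_exp_Y_step[OF G l, of y]
    by (simp add: ennreal_mult' nn_integral_cmult)
  also have "\<dots> = ennreal (level_term G s l y v)"
    using level_const_pos[of "k - l"] s v
    by (simp add: level_term_def expo_l powr_mult powr_def ennreal_mult'[symmetric] exp_add[symmetric] ln_mult algebra_simps)
  finally show ?thesis .
qed

lemma AE_PW_pos: "AE w in PW. \<forall>\<beta> j. length \<beta> < k \<longrightarrow> 0 < w \<beta> j"
proof -
  have "AE w in PW. length \<beta> < k \<longrightarrow> (\<forall>j. 0 < w \<beta> j)" for \<beta>
  proof (cases "length \<beta> < k")
    case True
    then show ?thesis
      unfolding PW_def using AE_PiM_component[OF Q_prob, of \<beta> UNIV] Q_pos[OF True] by auto
  qed simp
  then have "AE w in PW. \<forall>\<beta>. length \<beta> < k \<longrightarrow> (\<forall>j. 0 < w \<beta> j)"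
    by (simp add: AE_all_countable)
  then show ?thesis
    by (rule eventually_mono) auto
qed

lemma vprod_pos: "(\<forall>\<beta> j. length \<beta> < k \<longrightarrow> 0 < w \<beta> j) \<Longrightarrow> length \<beta> \<le> k \<Longrightarrow> 0 < vprod w \<beta>"
  unfolding vprod_def by (intro prod_pos) auto

definition level_laplace :: "((nat \<Rightarrow> 'c) \<Rightarrow> real) \<Rightarrow> real \<Rightarrow> nat \<Rightarrow> ennreal" where
  "level_laplace G s l =
    (\<integral>\<^sup>+w. \<integral>\<^sup>+z. eneg (\<integral>\<^sup>+\<beta>. ennreal (level_term G s l (path z \<beta>) (vprod w \<beta>)) \<partial>level l) \<partial>PZ \<partial>PW)"

text \<open>The marks of level l + 1 are integrated with the points fixed; Fubini then brings the
  points inside, so that the processes below the nodes of level l can be integrated with the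
  remaining marks fixed.\<close>

lemma level_laplace_Suc:
  assumes G: "admissible G" and l: "l < k" and s: "0 < s"
  shows "level_laplace G s (Suc l) = level_laplace G s l"
proof -
  let ?g = "\<lambda>z w. eneg (\<integral>\<^sup>+\<beta>. \<integral>\<^sup>+j. nlog (level_mean G s l (path z \<beta>) (vprod w \<beta> * w \<beta> j)) \<partial>count_space UNIV \<partial>level l)"
  let ?h = "\<lambda>z w. eneg (\<integral>\<^sup>+\<beta>. ennreal (level_term G s l (path z \<beta>) (vprod w \<beta>)) \<partial>level l)"
  let ?J = "{\<beta> :: nat list. length \<beta> = l}"
  have [measurable]: "(\<lambda>q. level_mean G s l (path (snd q) \<beta>) (vprod (fst q) \<beta> * fst q \<beta> j)) \<in> borel_measurable (PW \<Otimes>\<^sub>M PZ)" for \<beta> j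
  proof -
    have [measurable]: "(\<lambda>q. fst q \<beta> j) \<in> borel_measurable (PW \<Otimes>\<^sub>M PZ)"
      by (rule measurable_points) simp
    show ?thesis
      using G l by (intro measurable_level_mean) auto
  qed
  have [measurable]: "(\<lambda>w. level_mean G s l (path z \<beta>) (vprod w \<beta> * w \<beta> j)) \<in> borel_measurable PW" for z \<beta> j
  proof -
    have [measurable]: "(\<lambda>w. w \<beta> j) \<in> borel_measurable PW"
      by (rule measurable_points) simp
    show ?thesis
      using G l by (intro measurable_level_mean) (auto simp: space_PiM)
  qed
  have [measurable]: "(\<lambda>q. level_term G s l (path (snd q) \<beta>) (vprod (fst q) \<beta>)) \<in> borel_measurable (PW \<Otimes>\<^sub>M PZ)" for \<beta>
    using G l by (intro measurable_level_term') auto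
  have "level_laplace G s (Suc l) = (\<integral>\<^sup>+w. \<integral>\<^sup>+z. ?g z w \<partial>PZ \<partial>PW)"
    unfolding level_laplace_def using G l by (simp add: integrate_marks)
  also have "\<dots> = (\<integral>\<^sup>+z. \<integral>\<^sup>+w. ?g z w \<partial>PW \<partial>PZ)"
    by (intro PWZ.Fubini'[symmetric]) (simp add: case_prod_beta')
  also have "\<dots> = (\<integral>\<^sup>+z. \<integral>\<^sup>+w. ?h z w \<partial>PW \<partial>PZ)"
  proof (rule nn_integral_cong)
    fix z
    have "(\<integral>\<^sup>+w. ?g z w \<partial>PW) = (\<integral>\<^sup>+w. \<integral>\<^sup>+w'. ?g z (\<lambda>\<beta>. if \<beta> \<in> ?J then w' \<beta> else w \<beta>) \<partial>PW \<partial>PW)"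
      unfolding PW_def by (rule nn_integral_PiM_override[OF Q_prob]) (simp add: PW_def[symmetric])
    also have "\<dots> = (\<integral>\<^sup>+w. ?h z w \<partial>PW)"
    proof -
      have "(\<integral>\<^sup>+w'. ?g z (\<lambda>\<beta>. if \<beta> \<in> ?J then w' \<beta> else w \<beta>) \<partial>PW) = ?h z w"
        if w: "\<forall>\<beta> j. length \<beta> < k \<longrightarrow> 0 < w \<beta> j" for w
      proof -
      \<comment> \<open>The weight accumulated at a node of level l involves only the processes
        below its strict ancestors, so redrawing the processes at level l leaves it
        unchanged.\<close>
      have "vprod (\<lambda>\<beta>. if \<beta> \<in> ?J then w' \<beta> else w \<beta>) \<beta> = vprod w \<beta>" if "length \<beta> = l" for w' \<beta>
        using that by (intro vprod_cong) auto
      then have "?g z (\<lambda>\<beta>. if \<beta> \<in> ?J then w' \<beta> else w \<beta>) =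
        eneg (\<integral>\<^sup>+\<beta>. \<integral>\<^sup>+j. nlog (level_mean G s l (path z \<beta>) (vprod w \<beta> * w' \<beta> j)) \<partial>count_space UNIV \<partial>level l)" for w'
        by (intro arg_cong[where f=eneg] nn_integral_cong) simp
      then have "(\<integral>\<^sup>+w'. ?g z (\<lambda>\<beta>. if \<beta> \<in> ?J then w' \<beta> else w \<beta>) \<partial>PW) =
        (\<integral>\<^sup>+w'. eneg (\<integral>\<^sup>+\<beta>. \<integral>\<^sup>+j. nlog (level_mean G s l (path z \<beta>) (vprod w \<beta> * w' \<beta> j)) \<partial>count_space UNIV \<partial>level l) \<partial>PW)"
        by simp
      also have "\<dots> = ?h z w"
        unfolding PW_def
      proof (rule nn_integral_eneg_PiM[OF Q_prob])
        fix \<beta> assume "\<beta> \<in> ?J"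
        then have \<beta>: "length \<beta> = l" by simp
        have [measurable]: "(\<lambda>x. x j) \<in> borel_measurable (Q \<beta>)" for j
          using measurable_component_singleton[of j UNIV "\<lambda>_. borel"] by (simp cong: measurable_cong_sets)
        have "(\<lambda>x. level_mean G s l (path z \<beta>) (vprod w \<beta> * x j)) \<in> borel_measurable (Q \<beta>)" for j
          using G l by (intro measurable_level_mean) (auto intro!: borel_measurable_times simp: space_PiM)
        then show "(\<lambda>x. \<integral>\<^sup>+j. nlog (level_mean G s l (path z \<beta>) (vprod w \<beta> * x j)) \<partial>count_space UNIV) \<in> borel_measurable (Q \<beta>)"
          by measurable
        show "(\<integral>\<^sup>+x. eneg (\<integral>\<^sup>+j. nlog (level_mean G s l (path z \<beta>) (vprod w \<beta> * x j)) \<partial>count_space UNIV) \<partial>Q \<beta>) =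
          eneg (ennreal (level_term G s l (path z \<beta>) (vprod w \<beta>)))"
          using G l s \<beta> vprod_pos[OF w] by (intro integrate_points) auto
      qed
      finally show ?thesis .
      qed
      then show ?thesis
        by (intro nn_integral_cong_AE eventually_mono[OF AE_PW_pos])
    qed
    finally show "(\<integral>\<^sup>+w. ?g z w \<partial>PW) = (\<integral>\<^sup>+w. ?h z w \<partial>PW)" .
  qed
  also have "\<dots> = (\<integral>\<^sup>+w. \<integral>\<^sup>+z. ?h z w \<partial>PZ \<partial>PW)"
    by (intro PWZ.Fubini') (simp add: case_prod_beta')
  finally show ?thesis
    by (simp add: level_laplace_def)
qed

definition tsum :: "((nat \<Rightarrow> 'c) \<Rightarrow> real) \<Rightarrow> (nat list \<Rightarrow> nat \<Rightarrow> real) \<Rightarrow> (nat list \<Rightarrow> 'c) \<Rightarrow> ennreal" where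
  "tsum F w z = (\<integral>\<^sup>+\<alpha>. ennreal (vprod w \<alpha> * F (path z \<alpha>)) \<partial>level k)"

text \<open>The level-l transform does not depend on l. At the leaves it is the transform of the
  tree sum; at level 0 the only node is the root, with empty weight product 1 and a constant
  path.\<close>

lemma tree_laplace:
  assumes G: "admissible G" and s: "0 < s"
  shows "(\<integral>\<^sup>+w. \<integral>\<^sup>+z. eneg (ennreal s * tsum G w z) \<partial>PZ \<partial>PW) =
    (\<integral>\<^sup>+x. eneg (ennreal (level_const k * (s * exp (Y G 0 (\<lambda>_. x))) powr expo 1)) \<partial>\<rho> 0)"
proof -
  have G_pos: "0 < G z" for z
    using G by (auto simp: admissible_def)
  have "level_laplace G s l = level_laplace G s 0" if "l \<le> k" for l
    using that by (induction l) (auto simp: level_laplace_Suc[OF G _ s])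
  moreover have "level_laplace G s k = (\<integral>\<^sup>+w. \<integral>\<^sup>+z. eneg (ennreal s * tsum G w z) \<partial>PZ \<partial>PW)"
    unfolding level_laplace_def
  proof (rule nn_integral_cong_AE, use AE_PW_pos in \<open>elim eventually_mono\<close>, rule nn_integral_cong)
    fix w :: "nat list \<Rightarrow> nat \<Rightarrow> real" and z assume w: "\<forall>\<beta> j. length \<beta> < k \<longrightarrow> 0 < w \<beta> j"
    have "ennreal (level_term G s k (path z \<beta>) (vprod w \<beta>)) = ennreal s * ennreal (vprod w \<beta> * G (path z \<beta>))"
      if "length \<beta> = k" for \<beta>
      using s vprod_pos[OF w, of \<beta>] that G_pos[of "path z \<beta>"]
      by (simp add: level_term_def ylog_last expo_def ennreal_mult'[symmetric] mult_ac abs_mult)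
    then have "(\<integral>\<^sup>+\<beta>. ennreal (level_term G s k (path z \<beta>) (vprod w \<beta>)) \<partial>level k) =
      (\<integral>\<^sup>+\<beta>. ennreal s * ennreal (vprod w \<beta> * G (path z \<beta>)) \<partial>level k)"
      by (intro nn_integral_cong) simp
    also have "\<dots> = ennreal s * tsum G w z"
      unfolding tsum_def by (rule nn_integral_cmult) simp
    finally show "eneg (\<integral>\<^sup>+\<beta>. ennreal (level_term G s k (path z \<beta>) (vprod w \<beta>)) \<partial>level k) = eneg (ennreal s * tsum G w z)"
      by simp
  qed
  moreover have "level_laplace G s 0 = (\<integral>\<^sup>+x. eneg (ennreal (level_const k * (s * exp (Y G 0 (\<lambda>_. x))) powr expo 1)) \<partial>\<rho> 0)"
  proof -
    have [measurable]: "(\<lambda>x. Y G 0 (\<lambda>_. x)) \<in> borel_measurable borel"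
    proof -
      have "(\<lambda>x _. x) \<in> borel \<rightarrow>\<^sub>M (seqs :: (nat \<Rightarrow> 'c) measure)"
        by (rule measurable_PiM_single') auto
      from measurable_compose[OF this admissible_measurable_Y[OF G, of 0]] show ?thesis by simp
    qed
    have "{\<beta> :: nat list. length \<beta> = 0} = {[]}" by auto
    then have "level_laplace G s 0 =
      (\<integral>\<^sup>+z. eneg (ennreal (level_const k * (s * exp (Y G 0 (\<lambda>_. z []))) powr expo 1)) \<partial>PZ)"
      by (simp add: level_laplace_def nn_integral_count_space_finite vprod_def level_term_def path_def[abs_def] PW.emeasure_space_1)
    also have "\<dots> = (\<integral>\<^sup>+x. eneg (ennreal (level_const k * (s * exp (Y G 0 (\<lambda>_. x))) powr expo 1)) \<partial>distr PZ (\<rho> 0) (\<lambda>z. z []))"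
      by (subst nn_integral_distr) auto
    also have "distr PZ (\<rho> 0) (\<lambda>z. z []) = \<rho> 0"
      using distr_PiM_component[of UNIV "\<lambda>\<beta>. \<rho> (length \<beta>)" "[]"] \<rho>_prob by (simp add: PZ_def)
    finally show ?thesis .
  qed
  ultimately show ?thesis by simp
qed

end

subsection \<open>Perturbation of the terminal function\<close>

text \<open>The increments \<epsilon> i * d i may vanish, so Caratheodory's slope function is used
  instead of a quotient by the increment. It serves for both ln(1 + y) and exp(n y) - 1.\<close>

lemma difference_quotient_tendsto:
  fixes f :: "real \<Rightarrow> real"
  assumes f: "DERIV f 0 :> c" "f 0 = 0" and \<epsilon>: "\<epsilon> \<longlonglongrightarrow> 0" "\<And>i. \<epsilon> i \<noteq> 0" and d: "d \<longlonglongrightarrow> D"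
  shows "(\<lambda>i. f (\<epsilon> i * d i) / \<epsilon> i) \<longlonglongrightarrow> c * D"
proof -
  obtain g where g: "\<And>y. f y - f 0 = g y * (y - 0)" "isCont g 0" "g 0 = c"
    using f(1) unfolding CARAT_DERIV by auto
  have "(\<lambda>i. \<epsilon> i * d i) \<longlonglongrightarrow> 0"
    using tendsto_mult[OF \<epsilon>(1) d] by simp
  from isCont_tendsto_compose[OF g(2) this] have "(\<lambda>i. g (\<epsilon> i * d i) * d i) \<longlonglongrightarrow> c * D"
    unfolding g(3) by (intro tendsto_mult d)
  moreover have "f (\<epsilon> i * d i) / \<epsilon> i = g (\<epsilon> i * d i) * d i" for i
    using g(1)[of "\<epsilon> i * d i"] f(2) \<epsilon>(2)[of i] by simp
  ultimately show ?thesis by simp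
qed

lemma measurable_const_seq:
  fixes f :: "(nat \<Rightarrow> 'c::topological_space) \<Rightarrow> real"
  assumes "f \<in> borel_measurable seqs"
  shows "(\<lambda>x. f (\<lambda>_. x)) \<in> borel_measurable borel"
proof -
  have "(\<lambda>x _. x) \<in> borel \<rightarrow>\<^sub>M (seqs :: (nat \<Rightarrow> 'c) measure)"
    by (rule measurable_PiM_single') auto
  from measurable_compose[OF this assms] show ?thesis by simp
qed

lemma exp_minus_one_le: "exp y - 1 \<le> y * exp (y :: real)"
proof -
  have "(1 - y) * exp y \<le> exp (- y) * exp y"
    using exp_ge_add_one_self[of "- y"] by (intro mult_right_mono) auto
  then show ?thesis
    by (simp add: exp_minus algebra_simps)
qed

lemma frullani_eneg:
  assumes "0 < a" "a \<le> b" "0 < n"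
  shows "(\<integral>\<^sup>+s. (eneg (ennreal (a * s powr n)) - eneg (ennreal (b * s powr n))) * (ennreal (1 / s) * indicator {0<..} s) \<partial>lborel) =
    ennreal (ln (b / a) / n)"
  unfolding frullani_powr[OF assms, symmetric]
proof (rule nn_integral_cong)
  fix s :: real
  show "(eneg (ennreal (a * s powr n)) - eneg (ennreal (b * s powr n))) * (ennreal (1 / s) * indicator {0<..} s) =
    ennreal ((exp (- (a * s powr n)) - exp (- (b * s powr n))) / s) * indicator {0<..} s"
  proof (cases "0 < s")
    case True
    have "a * s powr n \<le> b * s powr n"
      using assms by (intro mult_right_mono) auto
    with True assms show ?thesis
      by (simp add: eneg_ennreal ennreal_minus ennreal_mult''[symmetric] divide_inverse)
  qed simp
qed

section \<open>Derivative of the recursion with respect to the terminal function\<close>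

context hierarchy
begin

text \<open>The derivative of \<open>Y G l\<close> in the direction F: differentiating (1/n) ln E
  exp(n Y) gives the mean of the derivative one level deeper, weighted by exp(n (Y - Y')), where Y'
  is the value at the shallower level.\<close>

primrec tilt_rec :: "((nat \<Rightarrow> 'c) \<Rightarrow> real) \<Rightarrow> ((nat \<Rightarrow> 'c) \<Rightarrow> real) \<Rightarrow> nat \<Rightarrow> (nat \<Rightarrow> 'c) \<Rightarrow> real" where
  "tilt_rec G F 0 z = F z / G z"
| "tilt_rec G F (Suc d) z = (\<integral>x. exp (n (k - d) * (Y G (k - d) (z(k - d := x)) - Y G (k - Suc d) z)) *
    tilt_rec G F d (z(k - d := x)) \<partial>\<rho> (k - d))"

definition tilted :: "((nat \<Rightarrow> 'c) \<Rightarrow> real) \<Rightarrow> ((nat \<Rightarrow> 'c) \<Rightarrow> real) \<Rightarrow> nat \<Rightarrow> (nat \<Rightarrow> 'c) \<Rightarrow> real" where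
  "tilted G F l = tilt_rec G F (k - l)"

lemma tilted_last: "tilted G F k z = F z / G z"
  by (simp add: tilted_def)

lemma tilted_step:
  assumes "l < k"
  shows "tilted G F l z = (\<integral>x. exp (n (Suc l) * (Y G (Suc l) (z(Suc l := x)) - Y G l z)) *
    tilted G F (Suc l) (z(Suc l := x)) \<partial>\<rho> (Suc l))"
proof -
  have "k - l = Suc (k - Suc l)" "k - (k - Suc l) = Suc l" "k - Suc (k - Suc l) = l"
    using assms by auto
  then show ?thesis
    by (simp add: tilted_def)
qed

lemma measurable_upd_pair [measurable]: "(\<lambda>(z, x). z(i := x)) \<in> seqs \<Otimes>\<^sub>M \<rho> l \<rightarrow>\<^sub>M (seqs :: (nat \<Rightarrow> 'c) measure)"
proof -
  have "(\<lambda>q. (fst q)(i := snd q)) \<in> seqs \<Otimes>\<^sub>M \<rho> l \<rightarrow>\<^sub>M (seqs :: (nat \<Rightarrow> 'c) measure)"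
    by (rule measurable_fun_upd_UNIV) auto
  then show ?thesis by (simp add: case_prod_beta')
qed

lemma measurable_tilted:
  assumes G: "admissible G" and F [measurable]: "F \<in> borel_measurable seqs" and "l \<le> k"
  shows "tilted G F l \<in> borel_measurable seqs"
  using assms(3)
proof (induction l rule: ylog_induct)
  case last
  have [measurable]: "G \<in> borel_measurable seqs"
    using G by (auto simp: admissible_def)
  show ?case
    by (simp add: tilted_last[abs_def])
next
  case (step l)
  interpret prob_space "\<rho> (Suc l)" by (rule \<rho>_prob)
  note step.IH [measurable]
  have [measurable]: "Y G (Suc l) \<in> borel_measurable seqs" "Y G l \<in> borel_measurable seqs"
    using step by (auto intro!: admissible_measurable_Y G)
  have eq: "tilted G F l = (\<lambda>z. \<integral>x. exp (n (Suc l) * (Y G (Suc l) (z(Suc l := x)) - Y G l z)) *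
      tilted G F (Suc l) (z(Suc l := x)) \<partial>\<rho> (Suc l))"
    using step by (simp add: fun_eq_iff tilted_step)
  show ?case
    unfolding eq by (rule borel_measurable_lebesgue_integral) measurable
qed

text \<open>By the recursion the exponential weight is a probability density for column l + 1, the
  earlier columns being fixed. Hence tilting preserves the bounds 0 and 1.\<close>

lemma weight_integrable:
  assumes G: "admissible G" and l: "l < k"
  shows "integrable (\<rho> (Suc l)) (\<lambda>x. exp (n (Suc l) * (Y G (Suc l) (z(Suc l := x)) - Y G l z)))"
    and "(\<integral>x. exp (n (Suc l) * (Y G (Suc l) (z(Suc l := x)) - Y G l z)) \<partial>\<rho> (Suc l)) = 1"
proof -
  have eq: "exp (n (Suc l) * (Y G (Suc l) (z(Suc l := x)) - Y G l z)) =
    exp (n (Suc l) * Y G (Suc l) (z(Suc l := x))) * exp (- n (Suc l) * Y G l z)" for x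
    by (simp add: exp_add[symmetric] algebra_simps)
  show "integrable (\<rho> (Suc l)) (\<lambda>x. exp (n (Suc l) * (Y G (Suc l) (z(Suc l := x)) - Y G l z)))"
    unfolding eq using G l by (intro integrable_mult_left) (auto simp: admissible_def)
  show "(\<integral>x. exp (n (Suc l) * (Y G (Suc l) (z(Suc l := x)) - Y G l z)) \<partial>\<rho> (Suc l)) = 1"
    unfolding eq by (subst integral_mult_left_zero) (simp add: exp_Y_step[OF G l, symmetric] exp_add[symmetric])
qed

end

locale perturbed_hierarchy = hierarchy k n \<rho>
  for k n and \<rho> :: "nat \<Rightarrow> 'c::topological_space measure" +
  fixes G F :: "(nat \<Rightarrow> 'c) \<Rightarrow> real"
  assumes G: "admissible G" and F_measurable [measurable]: "F \<in> borel_measurable seqs"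
    and F_dep: "depends_upto k F" and F_nonneg: "\<And>z. 0 \<le> F z" and F_le: "\<And>z. F z \<le> G z"
begin

lemma G_pos: "0 < G z" and G_measurable [measurable]: "G \<in> borel_measurable seqs"
  using G by (auto simp: admissible_def)

lemma tilted_integrable:
  assumes "l < k" "\<And>z. 0 \<le> tilted G F (Suc l) z" "\<And>z. tilted G F (Suc l) z \<le> 1"
  shows "integrable (\<rho> (Suc l)) (\<lambda>x. exp (n (Suc l) * (Y G (Suc l) (z(Suc l := x)) - Y G l z)) * tilted G F (Suc l) (z(Suc l := x)))"
proof (rule Bochner_Integration.integrable_bound[OF weight_integrable(1)[OF G assms(1), of z]])
  have [measurable]: "tilted G F (Suc l) \<in> borel_measurable seqs" "Y G (Suc l) \<in> borel_measurable seqs"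
    using assms by (auto intro!: measurable_tilted admissible_measurable_Y G)
  show "(\<lambda>x. exp (n (Suc l) * (Y G (Suc l) (z(Suc l := x)) - Y G l z)) * tilted G F (Suc l) (z(Suc l := x))) \<in> borel_measurable (\<rho> (Suc l))"
    by measurable
qed (use assms in \<open>auto simp: abs_mult intro!: mult_left_le\<close>)

lemma tilted_bounds: "l \<le> k \<Longrightarrow> (\<forall>z. 0 \<le> tilted G F l z) \<and> (\<forall>z. tilted G F l z \<le> 1)"
proof (induction l rule: ylog_induct)
  case last
  then show ?case
    using F_nonneg F_le G_pos by (auto simp: tilted_last less_imp_le)
next
  case (step l)
  have "(\<integral>x. exp (n (Suc l) * (Y G (Suc l) (z(Suc l := x)) - Y G l z)) * tilted G F (Suc l) (z(Suc l := x)) \<partial>\<rho> (Suc l)) \<le>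
    (\<integral>x. exp (n (Suc l) * (Y G (Suc l) (z(Suc l := x)) - Y G l z)) \<partial>\<rho> (Suc l))" for z
    using step by (intro integral_mono tilted_integrable weight_integrable(1) G) (auto intro!: mult_left_le)
  then show ?case
    using step by (auto simp: tilted_step weight_integrable(2)[OF G] intro!: integral_nonneg_AE)
qed

lemma tilted_nonneg: "l \<le> k \<Longrightarrow> 0 \<le> tilted G F l z"
  using tilted_bounds by blast

lemma tilted_le_1: "l \<le> k \<Longrightarrow> tilted G F l z \<le> 1"
  using tilted_bounds by blast

definition eps :: "nat \<Rightarrow> real" where "eps i = inverse (real (Suc i))"

lemma eps: "0 < eps i" "eps i \<le> 1" "eps \<longlonglongrightarrow> 0"
  using LIMSEQ_inverse_real_of_nat by (auto simp: eps_def[abs_def] field_simps)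

definition Geps :: "nat \<Rightarrow> (nat \<Rightarrow> 'c) \<Rightarrow> real" where
  "Geps i z = G z + eps i * F z"

text \<open>F \<le> G gives G + \<epsilon> F \<le> (1 + \<epsilon>) G; the factor is written as an
  exponential to fit \<open>Y_comparison\<close> with a = ln(1 + \<epsilon>) \<le>
  \<epsilon>.\<close>

lemma Geps_bounds: "G z \<le> Geps i z" "Geps i z \<le> exp (ln (1 + eps i)) * G z"
  using F_nonneg[of z] F_le[of z] eps(1)[of i]
  by (auto simp: Geps_def algebra_simps intro: add_nonneg_nonneg)

lemma Geps_dep: "depends_upto k (Geps i)"
  using G F_dep unfolding admissible_def depends_upto_def Geps_def[abs_def] by metis

lemma Geps_measurable [measurable]: "Geps i \<in> borel_measurable seqs"
  unfolding Geps_def[abs_def] by measurable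

lemmas Geps_comparison = Y_comparison[OF G Geps_measurable Geps_dep Geps_bounds]

lemma Geps_admissible: "admissible (Geps i)"
  by (rule Geps_comparison(1))

definition quot :: "nat \<Rightarrow> nat \<Rightarrow> (nat \<Rightarrow> 'c) \<Rightarrow> real" where
  "quot i l z = (Y (Geps i) l z - Y G l z) / eps i"

lemma quot_bounds:
  assumes "l \<le> k"
  shows "0 \<le> quot i l z" "quot i l z \<le> 1"
proof -
  show "0 \<le> quot i l z"
    using Geps_comparison(2)[OF assms, of z i] eps(1)[of i] by (simp add: quot_def)
  have "Y (Geps i) l z - Y G l z \<le> eps i"
    using Geps_comparison(3)[OF assms, of i z] ln_add_one_self_le_self[of "eps i"] eps(1)[of i] by simp
  then show "quot i l z \<le> 1"
    using eps(1)[of i] by (simp add: quot_def)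
qed

text \<open>Downward induction, each step being differentiation under the integral: the quotients
  one level deeper lie in [0,1] and the weights form a probability density, so convergence is
  dominated.\<close>

lemma quot_tendsto: "l \<le> k \<Longrightarrow> \<forall>z. (\<lambda>i. quot i l z) \<longlonglongrightarrow> tilted G F l z"
proof (induction l rule: ylog_induct)
  case last
  have "(\<lambda>i. ln (1 + eps i * (F z / G z)) / eps i) \<longlonglongrightarrow> 1 * (F z / G z)" for z
    using eps(1) by (intro difference_quotient_tendsto[OF _ _ eps(3)]) (auto intro!: derivative_eq_intros simp: less_imp_neq[symmetric])
  moreover have "quot i k z = ln (1 + eps i * (F z / G z)) / eps i" for i z
  proof -
    have "0 < Geps i z"
      using G_pos[of z] Geps_bounds(1)[of z i] by simp
    then have "ln (Geps i z) - ln (G z) = ln (Geps i z / G z)"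
      using G_pos[of z] by (simp add: ln_div)
    also have "Geps i z / G z = 1 + eps i * (F z / G z)"
      using G_pos[of z] by (simp add: Geps_def field_simps)
    finally show ?thesis
      by (simp add: quot_def ylog_last)
  qed
  ultimately show ?case
    by (simp add: tilted_last)
next
  case (step l)
  let ?n = "n (Suc l)"
  have n: "0 < ?n" "?n < 1"
    using n_pos n_less_1 step by auto
  show ?case
  proof
    fix z
    define W where "W x = exp (?n * (Y G (Suc l) (z(Suc l := x)) - Y G l z))" for x
    define q where "q i x = quot i (Suc l) (z(Suc l := x))" for i x
    \<comment> \<open>The first-order part of the perturbed moment, normalised by the unperturbed
      one: that quotient is exactly 1 + \<open>eps i * A i\<close>.\<close>
    define A where "A i = (\<integral>x. W x * ((exp (?n * (eps i * q i x)) - 1) / eps i) \<partial>\<rho> (Suc l))" for i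
    have W: "integrable (\<rho> (Suc l)) W" "(\<integral>x. W x \<partial>\<rho> (Suc l)) = 1"
      unfolding W_def using step weight_integrable[OF G] by auto
    have q: "0 \<le> q i x" "q i x \<le> 1" for i x
      using step by (auto simp: q_def quot_bounds)
    have [measurable]: "Y G (Suc l) \<in> borel_measurable seqs" "Y (Geps i) (Suc l) \<in> borel_measurable seqs"
        "tilted G F (Suc l) \<in> borel_measurable seqs" for i
      using step by (auto intro!: measurable_Y measurable_tilted G)
    have W_meas [measurable]: "W \<in> borel_measurable (\<rho> (Suc l))"
      unfolding W_def by measurable
    have q_meas [measurable]: "q i \<in> borel_measurable (\<rho> (Suc l))" for i
      unfolding q_def quot_def by measurable
    \<comment> \<open>From exp y - 1 \<le> y exp y with 0 \<le> y \<le> \<open>eps i\<close> \<le>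
      1: the quotient is at most exp 1.\<close>
    have bound: "\<bar>(exp (?n * (eps i * q i x)) - 1) / eps i\<bar> \<le> exp 1" for i x
    proof -
      have y: "0 \<le> ?n * (eps i * q i x)" "?n * (eps i * q i x) \<le> eps i"
        using n q[of i x] eps(1)[of i] mult_mono[of ?n 1 "eps i * q i x" "eps i"] by (auto simp: mult_left_le)
      have y1: "?n * (eps i * q i x) \<le> 1"
        using y(2) eps(2)[of i] by linarith
      have "exp (?n * (eps i * q i x)) - 1 \<le> ?n * (eps i * q i x) * exp (?n * (eps i * q i x))"
        by (rule exp_minus_one_le)
      also have "\<dots> \<le> eps i * exp 1"
        using y y1 eps(1)[of i] by (intro mult_mono) (simp_all del: mult_le_cancel_left1 mult_le_cancel_left2)
      finally show ?thesis
        using eps(1)[of i] y by (simp add: field_simps)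
    qed
    have W_nonneg: "0 \<le> W x" for x
      by (simp add: W_def)
    have W_bound: "norm (W x * ((exp (?n * (eps i * q i x)) - 1) / eps i)) \<le> W x * exp 1" for i x
    proof -
      have "norm (W x * ((exp (?n * (eps i * q i x)) - 1) / eps i)) = W x * \<bar>(exp (?n * (eps i * q i x)) - 1) / eps i\<bar>"
        using W_nonneg by (simp add: abs_mult)
      also have "\<dots> \<le> W x * exp 1"
        by (intro mult_left_mono bound W_nonneg)
      finally show ?thesis .
    qed
    have A_int: "integrable (\<rho> (Suc l)) (\<lambda>x. W x * ((exp (?n * (eps i * q i x)) - 1) / eps i))" for i
    proof (rule Bochner_Integration.integrable_bound[OF integrable_mult_left[OF W(1), of "exp 1"]])
      show "AE x in \<rho> (Suc l). norm (W x * ((exp (?n * (eps i * q i x)) - 1) / eps i)) \<le> norm (W x * exp 1)"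
        using order_trans[OF W_bound abs_ge_self] by (intro AE_I2) (simp only: real_norm_def)
    qed measurable
    have "A \<longlonglongrightarrow> (\<integral>x. W x * (?n * tilted G F (Suc l) (z(Suc l := x))) \<partial>\<rho> (Suc l))"
      unfolding A_def
    proof (rule integral_dominated_convergence[where w="\<lambda>x. W x * exp 1"])
      show "AE x in \<rho> (Suc l). (\<lambda>i. W x * ((exp (?n * (eps i * q i x)) - 1) / eps i)) \<longlonglongrightarrow>
          W x * (?n * tilted G F (Suc l) (z(Suc l := x)))"
      proof (intro AE_I2 tendsto_mult tendsto_const)
        fix x
        have "(\<lambda>i. q i x) \<longlonglongrightarrow> tilted G F (Suc l) (z(Suc l := x))"
          using step.IH by (simp add: q_def)
        then show "(\<lambda>i. (exp (?n * (eps i * q i x)) - 1) / eps i) \<longlonglongrightarrow> ?n * tilted G F (Suc l) (z(Suc l := x))"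
          using eps(1) by (intro difference_quotient_tendsto[OF _ _ eps(3), where f="\<lambda>y. exp (?n * y) - 1"])
            (auto intro!: derivative_eq_intros simp: less_imp_neq[symmetric])
      qed
      show "AE x in \<rho> (Suc l). norm (W x * ((exp (?n * (eps i * q i x)) - 1) / eps i)) \<le> W x * exp 1" for i
        by (intro AE_I2 W_bound)
      show "(\<lambda>x. W x * (?n * tilted G F (Suc l) (z(Suc l := x)))) \<in> borel_measurable (\<rho> (Suc l))"
        by measurable
    qed (use W in auto)
    also have "(\<integral>x. W x * (?n * tilted G F (Suc l) (z(Suc l := x))) \<partial>\<rho> (Suc l)) = ?n * tilted G F l z"
      using step by (simp add: tilted_step W_def mult.left_commute[of _ ?n])
    finally have "A \<longlonglongrightarrow> ?n * tilted G F l z" .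
    then have "(\<lambda>i. ln (1 + eps i * A i) / eps i) \<longlonglongrightarrow> 1 * (?n * tilted G F l z)"
      using eps(1) by (intro difference_quotient_tendsto[OF _ _ eps(3)])
        (auto intro!: derivative_eq_intros simp: less_imp_neq[symmetric])
    then have "(\<lambda>i. ln (1 + eps i * A i) / eps i / ?n) \<longlonglongrightarrow> 1 * (?n * tilted G F l z) / ?n"
      using n by (intro tendsto_divide tendsto_const) auto
    moreover have "quot i l z = ln (1 + eps i * A i) / eps i / ?n" for i
    proof -
      \<comment> \<open>Subtracting the unperturbed value at level l makes the constant part of the
        integrand the density W, whose integral is 1.\<close>
      have exp_Y: "exp (?n * (Y (Geps i) (Suc l) (z(Suc l := x)) - Y G l z)) =
          W x + eps i * (W x * ((exp (?n * (eps i * q i x)) - 1) / eps i))" for x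
      proof -
        have Y_eps: "Y (Geps i) (Suc l) (z(Suc l := x)) = Y G (Suc l) (z(Suc l := x)) + eps i * q i x"
          using eps(1)[of i] by (simp add: q_def quot_def)
        have "exp (?n * (Y (Geps i) (Suc l) (z(Suc l := x)) - Y G l z)) = W x * exp (?n * (eps i * q i x))"
          unfolding Y_eps by (simp add: W_def exp_add[symmetric] algebra_simps)
        then show ?thesis
          using eps(1)[of i] by (simp add: field_simps)
      qed
      have "exp (?n * (Y (Geps i) l z - Y G l z)) = exp (?n * Y (Geps i) l z) * exp (- ?n * Y G l z)"
        by (simp add: exp_add[symmetric] algebra_simps)
      also have "\<dots> = (\<integral>x. exp (?n * Y (Geps i) (Suc l) (z(Suc l := x))) * exp (- ?n * Y G l z) \<partial>\<rho> (Suc l))"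
        using step by (simp add: exp_Y_step[OF Geps_admissible])
      also have "\<dots> = (\<integral>x. exp (?n * (Y (Geps i) (Suc l) (z(Suc l := x)) - Y G l z)) \<partial>\<rho> (Suc l))"
        by (intro Bochner_Integration.integral_cong) (simp_all add: exp_add[symmetric] algebra_simps)
      also have "\<dots> = 1 + eps i * A i"
        unfolding exp_Y A_def
        by (simp only: Bochner_Integration.integral_add[OF W(1) integrable_mult_right[OF A_int]] W(2) integral_mult_right_zero)
      finally have "?n * (Y (Geps i) l z - Y G l z) = ln (1 + eps i * A i)"
        by (metis ln_exp)
      then show ?thesis
        using n eps(1)[of i] by (simp add: quot_def field_simps)
    qed
    ultimately show "(\<lambda>i. quot i l z) \<longlonglongrightarrow> tilted G F l z"
      using n by simp
  qed
qed

definition weight :: "nat \<Rightarrow> (nat \<Rightarrow> 'c) \<Rightarrow> real" where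
  "weight l z = exp (n l * (Y G l z - Y G (l - 1) z))"

lemma measurable_id_seqs [measurable]: "(\<lambda>z. z) \<in> PiM I \<rho> \<rightarrow>\<^sub>M (seqs :: (nat \<Rightarrow> 'c) measure)"
  by (rule measurable_PiM_UNIV_id) auto

text \<open>Unrolls the nested conditional means into one integral over all columns: the weights up
  to level l do not involve column l + 1, so integrating this column alone replaces
  \<open>tilted\<close> at level l + 1 by \<open>tilted\<close> at level l.\<close>

lemma nn_integral_weights:
  assumes "l \<le> k"
  shows "(\<integral>\<^sup>+z. ennreal ((\<Prod>p\<in>{1..l}. weight p z) * tilted G F l z) \<partial>PiM {..l} \<rho>) =
    (\<integral>\<^sup>+x. ennreal (tilted G F 0 (\<lambda>_. x)) \<partial>\<rho> 0)"
  using assms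
proof (induction l)
  case 0
  interpret product_sigma_finite \<rho>
    by (intro product_sigma_finite.intro prob_space_imp_sigma_finite \<rho>_prob)
  \<comment> \<open>At level 0 only the root column is seen, which permits evaluation at a constant
    sequence.\<close>
  have dep: "depends_upto l (tilted G F l)" if "l \<le> k" for l
    using that
  proof (induction l rule: ylog_induct)
    case last
    then show ?case
      using G F_dep unfolding admissible_def depends_upto_def tilted_last by metis
  next
    case (step l)
    show ?case
      unfolding depends_upto_def
    proof (intro allI impI)
      fix z z' :: "nat \<Rightarrow> 'c" assume eq: "\<forall>p\<le>l. z p = z' p"
      have "depends_upto (Suc l) (Y G (Suc l))" "depends_upto l (Y G l)"
        using step G by (auto intro!: depends_upto_ylog simp: admissible_def)
      then have "Y G (Suc l) (z(Suc l := x)) = Y G (Suc l) (z'(Suc l := x))" "Y G l z = Y G l z'"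
          "tilted G F (Suc l) (z(Suc l := x)) = tilted G F (Suc l) (z'(Suc l := x))" for x
        using eq step.IH by (auto elim!: depends_uptoD)
      then show "tilted G F l z = tilted G F l z'"
        using step by (simp add: tilted_step)
    qed
  qed
  have "(\<integral>\<^sup>+z. ennreal (tilted G F 0 z) \<partial>PiM {..0} \<rho>) = (\<integral>\<^sup>+z. ennreal (tilted G F 0 (\<lambda>_. z 0)) \<partial>PiM {0} \<rho>)"
  proof -
    have "{..0::nat} = {0}" by auto
    then show ?thesis
      by (auto intro!: nn_integral_cong arg_cong[where f=ennreal] depends_uptoD[OF dep[of 0]])
  qed
  also have "\<dots> = (\<integral>\<^sup>+x. ennreal (tilted G F 0 (\<lambda>_. x)) \<partial>\<rho> 0)"
  proof (rule product_nn_integral_singleton[where f="\<lambda>x. ennreal (tilted G F 0 (\<lambda>_. x))"])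
    have "(\<lambda>x. tilted G F 0 (\<lambda>_. x)) \<in> borel_measurable borel"
      by (rule measurable_const_seq[OF measurable_tilted[OF G F_measurable]]) simp
    from measurable_compose[OF this measurable_ennreal]
    show "(\<lambda>x. ennreal (tilted G F 0 (\<lambda>_. x))) \<in> borel_measurable (\<rho> 0)"
      by (simp only: measurable_cong_sets[OF sets_\<rho> refl])
  qed
  finally show ?case by simp
next
  case (Suc l)
  interpret product_sigma_finite \<rho>
    by (intro product_sigma_finite.intro prob_space_imp_sigma_finite \<rho>_prob)
  have Y_meas: "Y G p \<in> borel_measurable seqs" if "p \<le> k" for p
    using that by (intro admissible_measurable_Y G)
  have weight_meas: "weight p \<in> borel_measurable seqs" if "p \<le> k" for p
  proof -
    have [measurable]: "Y G p \<in> borel_measurable seqs" "Y G (p - 1) \<in> borel_measurable seqs"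
      using that by (auto intro: Y_meas)
    show ?thesis
      unfolding weight_def[abs_def] by measurable
  qed
  have Y_upd: "Y G p (z(Suc l := x)) = Y G p z" if "p \<le> l" for p z x
    using depends_upto_ylog[of k G p n \<rho>] G that Suc.prems
    by (intro depends_uptoD[of p "Y G p"]) (auto simp: admissible_def)
  have weight_upd: "weight p (z(Suc l := x)) = weight p z" if "p \<le> l" for p z x
    using that Y_upd[of p] Y_upd[of "p - 1"] by (simp add: weight_def)
  have "(\<lambda>z. ennreal ((\<Prod>p\<in>{1..Suc l}. weight p z) * tilted G F (Suc l) z)) \<in> borel_measurable seqs"
    using Suc.prems by (intro measurable_compose[OF _ measurable_ennreal] borel_measurable_times
      borel_measurable_prod weight_meas measurable_tilted G F_measurable) auto
  then have meas: "(\<lambda>z. ennreal ((\<Prod>p\<in>{1..Suc l}. weight p z) * tilted G F (Suc l) z)) \<in> borel_measurable (PiM (insert (Suc l) {..l}) \<rho>)"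
    by (rule measurable_compose[OF measurable_id_seqs])
  have "(\<integral>\<^sup>+z. ennreal ((\<Prod>p\<in>{1..Suc l}. weight p z) * tilted G F (Suc l) z) \<partial>PiM {..Suc l} \<rho>) =
    (\<integral>\<^sup>+z. \<integral>\<^sup>+x. ennreal ((\<Prod>p\<in>{1..Suc l}. weight p (z(Suc l := x))) * tilted G F (Suc l) (z(Suc l := x))) \<partial>\<rho> (Suc l) \<partial>PiM {..l} \<rho>)"
    unfolding atMost_Suc by (rule product_nn_integral_insert[OF _ _ meas]) simp_all
  also have "\<dots> = (\<integral>\<^sup>+z. ennreal ((\<Prod>p\<in>{1..l}. weight p z) * tilted G F l z) \<partial>PiM {..l} \<rho>)"
  proof (rule nn_integral_cong)
    fix z
    have w: "0 \<le> (\<Prod>p\<in>{1..l}. weight p z)"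
      by (intro prod_nonneg) (simp add: weight_def)
    have "(\<integral>\<^sup>+x. ennreal ((\<Prod>p\<in>{1..Suc l}. weight p (z(Suc l := x))) * tilted G F (Suc l) (z(Suc l := x))) \<partial>\<rho> (Suc l)) =
      (\<integral>\<^sup>+x. ennreal (\<Prod>p\<in>{1..l}. weight p z) * ennreal (exp (n (Suc l) * (Y G (Suc l) (z(Suc l := x)) - Y G l z)) * tilted G F (Suc l) (z(Suc l := x))) \<partial>\<rho> (Suc l))"
      using w by (intro nn_integral_cong) (simp add: weight_upd Y_upd weight_def[of "Suc l"] ennreal_mult'[symmetric] mult.assoc)
    also have "\<dots> = ennreal (\<Prod>p\<in>{1..l}. weight p z) * (\<integral>\<^sup>+x. ennreal (exp (n (Suc l) * (Y G (Suc l) (z(Suc l := x)) - Y G l z)) * tilted G F (Suc l) (z(Suc l := x))) \<partial>\<rho> (Suc l))"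
    proof (rule nn_integral_cmult)
      show "(\<lambda>x. ennreal (exp (n (Suc l) * (Y G (Suc l) (z(Suc l := x)) - Y G l z)) * tilted G F (Suc l) (z(Suc l := x)))) \<in> borel_measurable (\<rho> (Suc l))"
        using Suc.prems by (intro measurable_compose[OF borel_measurable_integrable[OF tilted_integrable] measurable_ennreal])
          (auto simp: tilted_nonneg tilted_le_1)
    qed
    also have "\<dots> = ennreal (\<Prod>p\<in>{1..l}. weight p z) * ennreal (tilted G F l z)"
      using Suc.prems by (subst nn_integral_eq_integral)
        (auto simp: tilted_step[of l] intro!: tilted_integrable tilted_nonneg tilted_le_1 AE_I2 mult_nonneg_nonneg)
    finally show "(\<integral>\<^sup>+x. ennreal ((\<Prod>p\<in>{1..Suc l}. weight p (z(Suc l := x))) * tilted G F (Suc l) (z(Suc l := x))) \<partial>\<rho> (Suc l)) =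
      ennreal ((\<Prod>p\<in>{1..l}. weight p z) * tilted G F l z)"
      using w by (simp add: ennreal_mult')
  qed
  finally show ?case
    using Suc by simp
qed

end

section \<open>Frullani's formula for the logarithm of the random tree sum\<close>

context tree_hierarchy
begin

lemma measurable_tsum [measurable]:
  assumes [measurable]: "F \<in> borel_measurable seqs"
  shows "(\<lambda>q. tsum F (fst q) (snd q)) \<in> borel_measurable (PW \<Otimes>\<^sub>M PZ)"
  unfolding tsum_def by measurable

lemma measurable_Y_const:
  assumes "admissible G"
  shows "(\<lambda>x. Y G 0 (\<lambda>_. x)) \<in> borel_measurable borel"
  by (rule measurable_const_seq[OF admissible_measurable_Y[OF assms]]) simp

lemma tree_laplace_pair:
  assumes G: "admissible G" and s: "0 < s"
  shows "(\<integral>\<^sup>+q. eneg (ennreal s * tsum G (fst q) (snd q)) \<partial>(PW \<Otimes>\<^sub>M PZ)) =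
    (\<integral>\<^sup>+x. eneg (ennreal (level_const k * exp (Y G 0 (\<lambda>_. x)) powr expo 1 * s powr expo 1)) \<partial>\<rho> 0)"
proof -
  have [measurable]: "G \<in> borel_measurable seqs"
    using G by (auto simp: admissible_def)
  have "(\<integral>\<^sup>+q. eneg (ennreal s * tsum G (fst q) (snd q)) \<partial>(PW \<Otimes>\<^sub>M PZ)) =
    (\<integral>\<^sup>+w. \<integral>\<^sup>+z. eneg (ennreal s * tsum G w z) \<partial>PZ \<partial>PW)"
    by (subst PZ.nn_integral_fst[symmetric]) simp_all
  also have "\<dots> = (\<integral>\<^sup>+x. eneg (ennreal (level_const k * (s * exp (Y G 0 (\<lambda>_. x))) powr expo 1)) \<partial>\<rho> 0)"
    by (rule tree_laplace[OF G s])
  finally show ?thesis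
    using s by (simp add: powr_mult mult_ac)
qed

lemma AE_points_pos: "AE q in PW \<Otimes>\<^sub>M PZ. \<forall>\<beta> j. length \<beta> < k \<longrightarrow> 0 < fst q \<beta> j"
proof (rule PWZ.AE_pair_measure)
  have [measurable]: "(\<lambda>q. fst q \<beta> j) \<in> borel_measurable (PW \<Otimes>\<^sub>M PZ)" for \<beta> j
    by (rule measurable_points) simp
  show "{q \<in> space (PW \<Otimes>\<^sub>M PZ). \<forall>\<beta> j. length \<beta> < k \<longrightarrow> 0 < fst q \<beta> j} \<in> sets (PW \<Otimes>\<^sub>M PZ)"
    by measurable
  show "AE w in PW. AE z in PZ. \<forall>\<beta> j. length \<beta> < k \<longrightarrow> 0 < fst (w, z) \<beta> j"
    using AE_PW_pos by (rule eventually_mono) simp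
qed

lemma tsum_pos:
  assumes "\<And>z. 0 < G z" "\<forall>\<beta> j. length \<beta> < k \<longrightarrow> 0 < w \<beta> j"
  shows "0 < tsum G w z"
proof -
  have "tsum G w z \<noteq> 0"
  proof
    assume "tsum G w z = 0"
    then have "\<forall>\<alpha>. length \<alpha> = k \<longrightarrow> ennreal (vprod w \<alpha> * G (path z \<alpha>)) = 0"
      unfolding tsum_def by (subst (asm) nn_integral_0_iff_AE) (auto simp: AE_count_space)
    \<comment> \<open>A single leaf with positive contribution is enough for a positive sum.\<close>
    then have "vprod w (replicate k 0) * G (path z (replicate k 0)) \<le> 0"
      by (simp add: ennreal_eq_0_iff)
    moreover have "0 < vprod w (replicate k 0) * G (path z (replicate k 0))"
      using assms by (intro mult_pos_pos vprod_pos) auto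
    ultimately show False by simp
  qed
  then show ?thesis
    by (simp add: zero_less_iff_neq_zero)
qed

text \<open>\<open>eneg (s T)\<close> is bounded by the indicator of T < \<infinity> for s > 0. As s
  tends to 0 its mean tends to 1, because the explicit exponent contains a positive power of
  s.\<close>

lemma AE_tsum_finite:
  assumes G: "admissible G"
  shows "AE q in PW \<Otimes>\<^sub>M PZ. tsum G (fst q) (snd q) < top"
proof -
  have [measurable]: "G \<in> borel_measurable seqs"
    using G by (auto simp: admissible_def)
  note measurable_Y_const[OF G, measurable]
  interpret \<rho>0: prob_space "\<rho> 0" by (rule \<rho>_prob)
  define s :: "nat \<Rightarrow> real" where "s i = inverse (real (Suc i))" for i
  have s: "0 < s i" "s \<longlonglongrightarrow> 0" for i
    using LIMSEQ_inverse_real_of_nat by (simp_all add: s_def[abs_def])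
  let ?A = "{q \<in> space (PW \<Otimes>\<^sub>M PZ). tsum G (fst q) (snd q) < top}"
  let ?R = "\<lambda>i. \<integral>\<^sup>+x. eneg (ennreal (level_const k * exp (Y G 0 (\<lambda>_. x)) powr expo 1 * s i powr expo 1)) \<partial>\<rho> 0"
  have "?R \<longlonglongrightarrow> (\<integral>\<^sup>+x. eneg (ennreal (level_const k * exp (Y G 0 (\<lambda>_. x)) powr expo 1 * 0)) \<partial>\<rho> 0)"
  proof (rule nn_integral_dominated_convergence[where w="\<lambda>_. 1"])
    have "(\<lambda>i. s i powr expo 1) \<longlonglongrightarrow> 0"
      by (rule tendsto_zero_powrI[OF s(2) tendsto_const _ expo_pos]) (auto intro!: always_eventually less_imp_le s(1))
    then show "AE x in \<rho> 0. (\<lambda>i. eneg (ennreal (level_const k * exp (Y G 0 (\<lambda>_. x)) powr expo 1 * s i powr expo 1))) \<longlonglongrightarrow>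
        eneg (ennreal (level_const k * exp (Y G 0 (\<lambda>_. x)) powr expo 1 * 0))"
      by (intro AE_I2 tendsto_eneg tendsto_ennrealI tendsto_mult tendsto_const)
  qed (use \<rho>0.emeasure_space_1 in simp_all)
  also have "(\<integral>\<^sup>+x. eneg (ennreal (level_const k * exp (Y G 0 (\<lambda>_. x)) powr expo 1 * 0)) \<partial>\<rho> 0) = 1"
    using \<rho>0.emeasure_space_1 by simp
  finally have "?R \<longlonglongrightarrow> 1" .
  moreover have "?R i \<le> emeasure (PW \<Otimes>\<^sub>M PZ) ?A" for i
  proof -
    have "?R i = (\<integral>\<^sup>+q. eneg (ennreal (s i) * tsum G (fst q) (snd q)) \<partial>(PW \<Otimes>\<^sub>M PZ))"
      using tree_laplace_pair[OF G s(1)] by simp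
    also have "\<dots> \<le> (\<integral>\<^sup>+q. indicator ?A q \<partial>(PW \<Otimes>\<^sub>M PZ))"
      using s(1)[of i] by (intro nn_integral_mono) (auto split: split_indicator simp: less_top[symmetric] ennreal_mult_top)
    also have "\<dots> = emeasure (PW \<Otimes>\<^sub>M PZ) ?A"
      by (rule nn_integral_indicator) measurable
    finally show ?thesis .
  qed
  ultimately have "1 \<le> emeasure (PW \<Otimes>\<^sub>M PZ) ?A"
    by (intro LIMSEQ_le_const2) auto
  then have "PWZ.prob ?A = 1"
    using PWZ.prob_le_1[of ?A] by (simp add: PWZ.emeasure_eq_measure)
  then have "AE q in PW \<Otimes>\<^sub>M PZ. q \<in> ?A"
    by (rule PWZ.AE_prob_1)
  then show ?thesis
    by (rule eventually_mono) simp
qed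

lemma tsum_mono:
  assumes "\<And>z. F z \<le> F' z" "\<forall>\<beta> j. length \<beta> < k \<longrightarrow> 0 < w \<beta> j"
  shows "tsum F w z \<le> tsum F' w z"
  unfolding tsum_def
proof (intro nn_integral_mono ennreal_leI mult_left_mono assms)
  fix \<alpha> assume "\<alpha> \<in> space (level k)"
  then show "0 \<le> vprod w \<alpha>"
    using vprod_pos[OF assms(2), of \<alpha>] by simp
qed

text \<open>The logarithm of the quotient is an integral over s of a difference of Laplace
  transforms. The ordering of G and G' makes this difference nonnegative, so the integrals can be
  exchanged with no integrability assumed for the logarithms.\<close>

lemma frullani_tree:
  assumes G: "admissible G" "admissible G'" and le: "\<And>z. G z \<le> G' z" and Y_le: "\<And>z. Y G 0 z \<le> Y G' 0 z"
  shows "(\<integral>\<^sup>+q. ennreal (ln (enn2real (tsum G' (fst q) (snd q)) / enn2real (tsum G (fst q) (snd q)))) \<partial>(PW \<Otimes>\<^sub>M PZ)) =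
    (\<integral>\<^sup>+x. ennreal (Y G' 0 (\<lambda>_. x) - Y G 0 (\<lambda>_. x)) \<partial>\<rho> 0)"
proof -
  have [measurable]: "G \<in> borel_measurable seqs" "G' \<in> borel_measurable seqs" and G_pos: "\<And>z. 0 < G z"
    using G by (auto simp: admissible_def)
  note measurable_Y_const[OF G(1), measurable] measurable_Y_const[OF G(2), measurable]
  interpret \<rho>0: prob_space "\<rho> 0" by (rule \<rho>_prob)
  interpret P: pair_sigma_finite "PW \<Otimes>\<^sub>M PZ" "lborel :: real measure" ..
  interpret R: pair_sigma_finite "\<rho> 0" "lborel :: real measure" ..
  let ?S = "\<lambda>G q. tsum G (fst q) (snd q)"
  let ?c = "\<lambda>s::real. ennreal (1 / s) * indicator {0<..} s"
  let ?e = "\<lambda>G x. level_const k * exp (Y G 0 (\<lambda>_. x)) powr expo 1"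
  have e1: "0 < expo 1" by (rule expo_pos) simp
  have e_pos: "0 < ?e H x" for H x
    using level_const_pos[of k] by simp
  have e_le: "?e G x \<le> ?e G' x" for x
    using level_const_pos[of k] Y_le[of "\<lambda>_. x"] e1 by (intro mult_left_mono powr_mono2) auto
  have "(\<integral>\<^sup>+q. ennreal (ln (enn2real (?S G' q) / enn2real (?S G q))) \<partial>(PW \<Otimes>\<^sub>M PZ)) =
    (\<integral>\<^sup>+q. \<integral>\<^sup>+s. (eneg (ennreal s * ?S G q) - eneg (ennreal s * ?S G' q)) * ?c s \<partial>lborel \<partial>(PW \<Otimes>\<^sub>M PZ))"
  proof (intro nn_integral_cong_AE, use AE_points_pos AE_tsum_finite[OF G(1)] AE_tsum_finite[OF G(2)] in eventually_elim)
    fix q assume w: "\<forall>\<beta> j. length \<beta> < k \<longrightarrow> 0 < fst q \<beta> j" and fin: "?S G q < top" "?S G' q < top"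
    define a b where "a = enn2real (?S G q)" and "b = enn2real (?S G' q)"
    have a: "?S G q = ennreal a" and b: "?S G' q = ennreal b"
      using fin by (auto simp: a_def b_def)
    have "0 < a" "a \<le> b"
      using tsum_pos[OF G_pos w, where z="snd q"] tsum_mono[OF le w, where z="snd q"] fin
      unfolding a_def b_def by (auto simp: enn2real_positive_iff intro: enn2real_mono)
    \<comment> \<open>Exponent 1 for the realised sums; after the exchange the same formula is read
      backwards with exponent \<open>expo 1\<close>.\<close>
    from frullani_eneg[OF this, of 1]
    have "ennreal (ln (b / a)) = (\<integral>\<^sup>+s. (eneg (ennreal (a * s powr 1)) - eneg (ennreal (b * s powr 1))) * ?c s \<partial>lborel)"
      by simp
    also have "\<dots> = (\<integral>\<^sup>+s. (eneg (ennreal s * ?S G q) - eneg (ennreal s * ?S G' q)) * ?c s \<partial>lborel)"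
      unfolding a b using \<open>0 < a\<close> \<open>a \<le> b\<close>
      by (intro nn_integral_cong) (auto split: split_indicator simp: ennreal_mult'[symmetric] mult.commute)
    finally show "ennreal (ln (enn2real (?S G' q) / enn2real (?S G q))) =
        (\<integral>\<^sup>+s. (eneg (ennreal s * ?S G q) - eneg (ennreal s * ?S G' q)) * ?c s \<partial>lborel)"
      unfolding a_def b_def .
  qed
  also have "\<dots> = (\<integral>\<^sup>+s. \<integral>\<^sup>+q. (eneg (ennreal s * ?S G q) - eneg (ennreal s * ?S G' q)) * ?c s \<partial>(PW \<Otimes>\<^sub>M PZ) \<partial>lborel)"
  proof (rule P.Fubini'[symmetric])
    have "(\<lambda>x. (eneg (ennreal (snd x) * ?S G (fst x)) - eneg (ennreal (snd x) * ?S G' (fst x))) * ?c (snd x)) \<in> borel_measurable ((PW \<Otimes>\<^sub>M PZ) \<Otimes>\<^sub>M lborel)"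
    proof -
      have [measurable]: "(\<lambda>x. ?S H (fst x)) \<in> borel_measurable ((PW \<Otimes>\<^sub>M PZ) \<Otimes>\<^sub>M lborel)" if "H \<in> borel_measurable seqs" for H
        by (rule measurable_compose[OF measurable_fst measurable_tsum[OF that]])
      show ?thesis by measurable
    qed
    then show "(\<lambda>(q, s). (eneg (ennreal s * ?S G q) - eneg (ennreal s * ?S G' q)) * ?c s) \<in> borel_measurable ((PW \<Otimes>\<^sub>M PZ) \<Otimes>\<^sub>M lborel)"
      by (simp add: case_prod_beta')
  qed
  also have "\<dots> = (\<integral>\<^sup>+s. \<integral>\<^sup>+x. (eneg (ennreal (?e G x * s powr expo 1)) - eneg (ennreal (?e G' x * s powr expo 1))) * ?c s \<partial>\<rho> 0 \<partial>lborel)"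
  proof (rule nn_integral_cong)
    fix s :: real
    show "(\<integral>\<^sup>+q. (eneg (ennreal s * ?S G q) - eneg (ennreal s * ?S G' q)) * ?c s \<partial>(PW \<Otimes>\<^sub>M PZ)) =
      (\<integral>\<^sup>+x. (eneg (ennreal (?e G x * s powr expo 1)) - eneg (ennreal (?e G' x * s powr expo 1))) * ?c s \<partial>\<rho> 0)"
    proof (cases "0 < s")
      case True
      have fin1: "(\<integral>\<^sup>+q. eneg (ennreal s * ?S G' q) \<partial>(PW \<Otimes>\<^sub>M PZ)) \<le> (\<integral>\<^sup>+q. 1 \<partial>(PW \<Otimes>\<^sub>M PZ))"
        by (intro nn_integral_mono) simp
      have fin2: "(\<integral>\<^sup>+x. eneg (ennreal (?e G' x * s powr expo 1)) \<partial>\<rho> 0) \<le> (\<integral>\<^sup>+x. 1 \<partial>\<rho> 0)"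
        by (intro nn_integral_mono) simp
      have "(\<integral>\<^sup>+q. (eneg (ennreal s * ?S G q) - eneg (ennreal s * ?S G' q)) \<partial>(PW \<Otimes>\<^sub>M PZ)) =
        (\<integral>\<^sup>+q. eneg (ennreal s * ?S G q) \<partial>(PW \<Otimes>\<^sub>M PZ)) - (\<integral>\<^sup>+q. eneg (ennreal s * ?S G' q) \<partial>(PW \<Otimes>\<^sub>M PZ))"
      proof (rule nn_integral_diff)
        show "AE q in PW \<Otimes>\<^sub>M PZ. eneg (ennreal s * ?S G' q) \<le> eneg (ennreal s * ?S G q)"
          using AE_points_pos by (rule eventually_mono) (intro eneg_antimono mult_left_mono tsum_mono le, auto)
      qed (use fin1 PWZ.emeasure_space_1 in \<open>auto simp: top_unique\<close>)
      also have "\<dots> = (\<integral>\<^sup>+x. eneg (ennreal (?e G x * s powr expo 1)) \<partial>\<rho> 0) - (\<integral>\<^sup>+x. eneg (ennreal (?e G' x * s powr expo 1)) \<partial>\<rho> 0)"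
        using tree_laplace_pair[OF G(1) True] tree_laplace_pair[OF G(2) True] by simp
      also have "\<dots> = (\<integral>\<^sup>+x. (eneg (ennreal (?e G x * s powr expo 1)) - eneg (ennreal (?e G' x * s powr expo 1))) \<partial>\<rho> 0)"
      proof (rule nn_integral_diff[symmetric])
        show "AE x in \<rho> 0. eneg (ennreal (?e G' x * s powr expo 1)) \<le> eneg (ennreal (?e G x * s powr expo 1))"
          by (intro AE_I2 eneg_antimono ennreal_leI mult_right_mono e_le) auto
      qed (use fin2 \<rho>0.emeasure_space_1 in \<open>auto simp: top_unique\<close>)
      finally show ?thesis
        by (simp add: nn_integral_multc)
    qed simp
  qed
  also have "\<dots> = (\<integral>\<^sup>+x. \<integral>\<^sup>+s. (eneg (ennreal (?e G x * s powr expo 1)) - eneg (ennreal (?e G' x * s powr expo 1))) * ?c s \<partial>lborel \<partial>\<rho> 0)"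
    by (rule R.Fubini') measurable
  also have "\<dots> = (\<integral>\<^sup>+x. ennreal (Y G' 0 (\<lambda>_. x) - Y G 0 (\<lambda>_. x)) \<partial>\<rho> 0)"
  proof (rule nn_integral_cong)
    fix x
    \<comment> \<open>The common constant cancels, and dividing by \<open>expo 1\<close> undoes the
      power.\<close>
    have "ln (?e G' x / ?e G x) / expo 1 = Y G' 0 (\<lambda>_. x) - Y G 0 (\<lambda>_. x)"
      using level_const_pos[of k] e1 by (simp add: ln_div ln_powr right_diff_distrib[symmetric])
    then show "(\<integral>\<^sup>+s. (eneg (ennreal (?e G x * s powr expo 1)) - eneg (ennreal (?e G' x * s powr expo 1))) * ?c s \<partial>lborel) =
        ennreal (Y G' 0 (\<lambda>_. x) - Y G 0 (\<lambda>_. x))"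
      using frullani_eneg[OF e_pos e_le e1] by simp
  qed
  finally show ?thesis .
qed

end

section \<open>The limit of vanishing perturbation on the tree\<close>

locale perturbed_tree = tree_hierarchy k n \<rho> Q + perturbed_hierarchy k n \<rho> G F
  for k n and \<rho> :: "nat \<Rightarrow> 'c::topological_space measure" and Q G F
begin

lemma measurable_Y_diff: "(\<lambda>x. Y (Geps i) 0 (\<lambda>_. x) - Y G 0 (\<lambda>_. x)) \<in> borel_measurable (\<rho> 0)"
  unfolding measurable_cong_sets[OF sets_\<rho> refl]
  by (rule borel_measurable_diff[OF measurable_Y_const[OF Geps_admissible] measurable_Y_const[OF G]])

text \<open>The tree sum is linear in its terminal function, so its quotient under perturbation is 1
  + \<epsilon> times the ratio sought. Frullani's formula equates the means of the two logarithmic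
  difference quotients, and both are dominated by 1 as \<epsilon> tends to 0.\<close>

theorem cascade_average:
  "(\<integral>\<^sup>+q. ennreal (enn2real (tsum F (fst q) (snd q)) / enn2real (tsum G (fst q) (snd q))) \<partial>(PW \<Otimes>\<^sub>M PZ)) =
    (\<integral>\<^sup>+z. ennreal ((\<Prod>p\<in>{1..k}. weight p z) * (F z / G z)) \<partial>PiM {..k} \<rho>)"
proof -
  let ?S = "\<lambda>G q. enn2real (tsum G (fst q) (snd q))"
  interpret \<rho>0: prob_space "\<rho> 0" by (rule \<rho>_prob)
  have ratio: "AE q in PW \<Otimes>\<^sub>M PZ. 0 \<le> ?S F q / ?S G q \<and> ?S F q / ?S G q \<le> 1 \<and>
      (\<forall>i. ?S (Geps i) q / ?S G q = 1 + eps i * (?S F q / ?S G q))"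
  proof (use AE_points_pos AE_tsum_finite[OF G] in eventually_elim)
    fix q assume w: "\<forall>\<beta> j. length \<beta> < k \<longrightarrow> 0 < fst q \<beta> j" and fin: "tsum G (fst q) (snd q) < top"
    have F_G: "tsum F (fst q) (snd q) \<le> tsum G (fst q) (snd q)"
      by (intro tsum_mono F_le w)
    have finF: "tsum F (fst q) (snd q) < top"
      using F_G fin by (rule le_less_trans)
    have pos: "0 < ?S G q"
      using tsum_pos[OF G_pos w, where z="snd q"] fin by (simp add: enn2real_positive_iff)
    have "tsum (Geps i) (fst q) (snd q) = tsum G (fst q) (snd q) + ennreal (eps i) * tsum F (fst q) (snd q)" for i
    proof -
      have "tsum (Geps i) (fst q) (snd q) =
        (\<integral>\<^sup>+\<alpha>. ennreal (vprod (fst q) \<alpha> * G (path (snd q) \<alpha>)) + ennreal (eps i) * ennreal (vprod (fst q) \<alpha> * F (path (snd q) \<alpha>)) \<partial>level k)"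
        unfolding tsum_def
      proof (rule nn_integral_cong)
        fix \<alpha> assume "\<alpha> \<in> space (level k)"
        then have v: "0 \<le> vprod (fst q) \<alpha>"
          using vprod_pos[OF w, of \<alpha>] by simp
        show "ennreal (vprod (fst q) \<alpha> * Geps i (path (snd q) \<alpha>)) =
          ennreal (vprod (fst q) \<alpha> * G (path (snd q) \<alpha>)) + ennreal (eps i) * ennreal (vprod (fst q) \<alpha> * F (path (snd q) \<alpha>))"
          using v eps(1)[of i] F_nonneg G_pos[of "path (snd q) \<alpha>"]
          by (simp add: Geps_def distrib_left ennreal_mult'[symmetric] mult.left_commute ennreal_plus[symmetric] less_imp_le del: ennreal_plus)
      qed
      also have "\<dots> = tsum G (fst q) (snd q) + ennreal (eps i) * tsum F (fst q) (snd q)"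
        unfolding tsum_def by (simp add: nn_integral_add nn_integral_cmult)
      finally show ?thesis .
    qed
    then have "?S (Geps i) q = ?S G q + eps i * ?S F q" for i
      using fin finF eps(1)[of i] by (simp add: enn2real_plus ennreal_mult_less_top enn2real_mult less_imp_le)
    then have "?S (Geps i) q / ?S G q = 1 + eps i * (?S F q / ?S G q)" for i
      using pos by (simp add: field_simps)
    moreover have "?S F q / ?S G q \<le> 1"
      using pos enn2real_mono[OF F_G] fin by (simp add: less_top[symmetric])
    ultimately show "0 \<le> ?S F q / ?S G q \<and> ?S F q / ?S G q \<le> 1 \<and>
        (\<forall>i. ?S (Geps i) q / ?S G q = 1 + eps i * (?S F q / ?S G q))"
      by auto
  qed
  have quot_eq: "(\<integral>\<^sup>+q. ennreal (ln (?S (Geps i) q / ?S G q) / eps i) \<partial>(PW \<Otimes>\<^sub>M PZ)) = (\<integral>\<^sup>+x. ennreal (quot i 0 (\<lambda>_. x)) \<partial>\<rho> 0)" for i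
  proof -
    have "(\<integral>\<^sup>+q. ennreal (ln (?S (Geps i) q / ?S G q) / eps i) \<partial>(PW \<Otimes>\<^sub>M PZ)) =
      (\<integral>\<^sup>+q. ennreal (ln (?S (Geps i) q / ?S G q)) * ennreal (1 / eps i) \<partial>(PW \<Otimes>\<^sub>M PZ))"
      using eps(1)[of i] by (intro nn_integral_cong) (simp add: ennreal_mult''[symmetric])
    also have "\<dots> = (\<integral>\<^sup>+q. ennreal (ln (?S (Geps i) q / ?S G q)) \<partial>(PW \<Otimes>\<^sub>M PZ)) * ennreal (1 / eps i)"
      by (rule nn_integral_multc) measurable
    also have "\<dots> = (\<integral>\<^sup>+x. ennreal (Y (Geps i) 0 (\<lambda>_. x) - Y G 0 (\<lambda>_. x)) \<partial>\<rho> 0) * ennreal (1 / eps i)"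
      by (subst frullani_tree[OF G Geps_admissible]) (auto intro!: Geps_bounds Geps_comparison(2))
    also have "\<dots> = (\<integral>\<^sup>+x. ennreal (Y (Geps i) 0 (\<lambda>_. x) - Y G 0 (\<lambda>_. x)) * ennreal (1 / eps i) \<partial>\<rho> 0)"
      by (rule nn_integral_multc[symmetric, OF measurable_compose[OF measurable_Y_diff measurable_ennreal]])
    also have "\<dots> = (\<integral>\<^sup>+x. ennreal (quot i 0 (\<lambda>_. x)) \<partial>\<rho> 0)"
      using eps(1)[of i] by (intro nn_integral_cong) (simp add: ennreal_mult''[symmetric] quot_def)
    finally show ?thesis .
  qed
  have "(\<lambda>i. \<integral>\<^sup>+q. ennreal (ln (?S (Geps i) q / ?S G q) / eps i) \<partial>(PW \<Otimes>\<^sub>M PZ)) \<longlonglongrightarrow>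
      (\<integral>\<^sup>+q. ennreal (?S F q / ?S G q) \<partial>(PW \<Otimes>\<^sub>M PZ))"
  proof (rule nn_integral_dominated_convergence[where w="\<lambda>_. 1"])
    show "AE q in PW \<Otimes>\<^sub>M PZ. (\<lambda>i. ennreal (ln (?S (Geps i) q / ?S G q) / eps i)) \<longlonglongrightarrow> ennreal (?S F q / ?S G q)"
      using ratio
    proof (rule eventually_mono, intro tendsto_ennrealI)
      fix q assume *: "0 \<le> ?S F q / ?S G q \<and> ?S F q / ?S G q \<le> 1 \<and>
        (\<forall>i. ?S (Geps i) q / ?S G q = 1 + eps i * (?S F q / ?S G q))"
      have "(\<lambda>i. ln (1 + eps i * (?S F q / ?S G q)) / eps i) \<longlonglongrightarrow> 1 * (?S F q / ?S G q)"
        using eps(1) by (intro difference_quotient_tendsto[OF _ _ eps(3)])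
          (auto intro!: derivative_eq_intros simp: less_imp_neq[symmetric])
      with * show "(\<lambda>i. ln (?S (Geps i) q / ?S G q) / eps i) \<longlonglongrightarrow> ?S F q / ?S G q"
        by simp
    qed
    show "AE q in PW \<Otimes>\<^sub>M PZ. ennreal (ln (?S (Geps i) q / ?S G q) / eps i) \<le> 1" for i
      using ratio
    proof (rule eventually_mono)
      fix q assume *: "0 \<le> ?S F q / ?S G q \<and> ?S F q / ?S G q \<le> 1 \<and>
        (\<forall>i. ?S (Geps i) q / ?S G q = 1 + eps i * (?S F q / ?S G q))"
      have "ln (?S (Geps i) q / ?S G q) \<le> eps i * (?S F q / ?S G q)"
        using * eps(1)[of i] by (simp only: ln_add_one_self_le_self mult_nonneg_nonneg less_imp_le)
      also have "\<dots> \<le> eps i"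
        using * eps(1)[of i] by (intro mult_left_le) auto
      finally show "ennreal (ln (?S (Geps i) q / ?S G q) / eps i) \<le> 1"
        using eps(1)[of i] by (simp add: ennreal_le_1)
    qed
  qed (simp_all add: PWZ.emeasure_space_1)
  moreover have "(\<lambda>i. \<integral>\<^sup>+x. ennreal (quot i 0 (\<lambda>_. x)) \<partial>\<rho> 0) \<longlonglongrightarrow> (\<integral>\<^sup>+x. ennreal (tilted G F 0 (\<lambda>_. x)) \<partial>\<rho> 0)"
  proof (rule nn_integral_dominated_convergence[where w="\<lambda>_. 1"])
    show "(\<lambda>x. ennreal (quot i 0 (\<lambda>_. x))) \<in> borel_measurable (\<rho> 0)" for i
      unfolding quot_def by (intro measurable_compose[OF _ measurable_ennreal] borel_measurable_divide measurable_Y_diff) simp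
    have "(\<lambda>x. tilted G F 0 (\<lambda>_. x)) \<in> borel_measurable borel"
      by (rule measurable_const_seq[OF measurable_tilted[OF G F_measurable]]) simp
    from measurable_compose[OF this measurable_ennreal]
    show "(\<lambda>x. ennreal (tilted G F 0 (\<lambda>_. x))) \<in> borel_measurable (\<rho> 0)"
      by (simp only: measurable_cong_sets[OF sets_\<rho> refl])
    show "AE x in \<rho> 0. (\<lambda>i. ennreal (quot i 0 (\<lambda>_. x))) \<longlonglongrightarrow> ennreal (tilted G F 0 (\<lambda>_. x))"
      using quot_tendsto[of 0] by (intro AE_I2 tendsto_ennrealI) auto
    show "AE x in \<rho> 0. ennreal (quot i 0 (\<lambda>_. x)) \<le> 1" for i
      using quot_bounds(2)[of 0] by (intro AE_I2) (simp add: ennreal_le_1)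
  qed (use \<rho>0.emeasure_space_1 in simp_all)
  ultimately have "(\<integral>\<^sup>+q. ennreal (?S F q / ?S G q) \<partial>(PW \<Otimes>\<^sub>M PZ)) = (\<integral>\<^sup>+x. ennreal (tilted G F 0 (\<lambda>_. x)) \<partial>\<rho> 0)"
    unfolding quot_eq by (rule LIMSEQ_unique)
  also have "\<dots> = (\<integral>\<^sup>+z. ennreal ((\<Prod>p\<in>{1..k}. weight p z) * (F z / G z)) \<partial>PiM {..k} \<rho>)"
    using nn_integral_weights[of k] by (simp add: tilted_last)
  finally show ?thesis .
qed

end

subsection \<open>Joint laws and Gaussian columns\<close>

lemma distr_pair_rectangles:
  assumes M: "prob_space M" and X [measurable]: "X \<in> M \<rightarrow>\<^sub>M S" and Y [measurable]: "Y \<in> M \<rightarrow>\<^sub>M T"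
    and eq: "\<And>A B. A \<in> sets S \<Longrightarrow> B \<in> sets T \<Longrightarrow>
      emeasure M {\<omega> \<in> space M. X \<omega> \<in> A \<and> Y \<omega> \<in> B} =
      emeasure M {\<omega> \<in> space M. X \<omega> \<in> A} * emeasure M {\<omega> \<in> space M. Y \<omega> \<in> B}"
  shows "distr M (S \<Otimes>\<^sub>M T) (\<lambda>\<omega>. (X \<omega>, Y \<omega>)) = distr M S X \<Otimes>\<^sub>M distr M T Y"
proof (rule sym, rule pair_measure_eqI)
  interpret prob_space M by fact
  show "sigma_finite_measure (distr M S X)" "sigma_finite_measure (distr M T Y)"
    by (auto intro!: prob_space_imp_sigma_finite prob_space_distr)
  fix A B assume "A \<in> sets (distr M S X)" "B \<in> sets (distr M T Y)"
  then have AB: "A \<in> sets S" "B \<in> sets T" by auto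
  have "X -` A \<inter> space M = {\<omega> \<in> space M. X \<omega> \<in> A}" "Y -` B \<inter> space M = {\<omega> \<in> space M. Y \<omega> \<in> B}"
    "(\<lambda>\<omega>. (X \<omega>, Y \<omega>)) -` (A \<times> B) \<inter> space M = {\<omega> \<in> space M. X \<omega> \<in> A \<and> Y \<omega> \<in> B}"
    by auto
  then show "emeasure (distr M S X) A * emeasure (distr M T Y) B =
    emeasure (distr M (S \<Otimes>\<^sub>M T) (\<lambda>\<omega>. (X \<omega>, Y \<omega>))) (A \<times> B)"
    using AB by (simp add: emeasure_distr eq)
qed simp

text \<open>The product formula for boxes has to be extended to X against an arbitrary joint event
  of Y and V. After that, two applications of the pair case give the nested product.\<close>

lemma distr_triple_boxes:
  assumes M: "prob_space M" and X [measurable]: "X \<in> M \<rightarrow>\<^sub>M S" and Y [measurable]: "Y \<in> M \<rightarrow>\<^sub>M T"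
    and V [measurable]: "V \<in> M \<rightarrow>\<^sub>M U"
    and eq: "\<And>A B C. A \<in> sets S \<Longrightarrow> B \<in> sets T \<Longrightarrow> C \<in> sets U \<Longrightarrow>
      emeasure M {\<omega> \<in> space M. X \<omega> \<in> A \<and> Y \<omega> \<in> B \<and> V \<omega> \<in> C} =
      emeasure M {\<omega> \<in> space M. X \<omega> \<in> A} * (emeasure M {\<omega> \<in> space M. Y \<omega> \<in> B} * emeasure M {\<omega> \<in> space M. V \<omega> \<in> C})"
  shows "distr M (S \<Otimes>\<^sub>M (T \<Otimes>\<^sub>M U)) (\<lambda>\<omega>. (X \<omega>, (Y \<omega>, V \<omega>))) = distr M S X \<Otimes>\<^sub>M (distr M T Y \<Otimes>\<^sub>M distr M U V)"
proof -
  interpret prob_space M by fact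
  have X_space: "{\<omega> \<in> space M. X \<omega> \<in> space S} = space M"
    using measurable_space[OF X] by auto
  have YV: "emeasure M {\<omega> \<in> space M. Y \<omega> \<in> B \<and> V \<omega> \<in> C} =
      emeasure M {\<omega> \<in> space M. Y \<omega> \<in> B} * emeasure M {\<omega> \<in> space M. V \<omega> \<in> C}"
    if "B \<in> sets T" "C \<in> sets U" for B C
  proof -
    have "{\<omega> \<in> space M. X \<omega> \<in> space S \<and> Y \<omega> \<in> B \<and> V \<omega> \<in> C} = {\<omega> \<in> space M. Y \<omega> \<in> B \<and> V \<omega> \<in> C}"
      using measurable_space[OF X] by auto
    with eq[of "space S" B C] that X_space show ?thesis
      by (simp add: emeasure_space_1)
  qed
  have "distr M (S \<Otimes>\<^sub>M (T \<Otimes>\<^sub>M U)) (\<lambda>\<omega>. (X \<omega>, (Y \<omega>, V \<omega>))) =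
    distr M S X \<Otimes>\<^sub>M distr M (T \<Otimes>\<^sub>M U) (\<lambda>\<omega>. (Y \<omega>, V \<omega>))"
  proof (rule distr_pair_rectangles[OF M X])
    show "(\<lambda>\<omega>. (Y \<omega>, V \<omega>)) \<in> M \<rightarrow>\<^sub>M T \<Otimes>\<^sub>M U" by measurable
    fix A E assume A [measurable]: "A \<in> sets S" and E [measurable]: "E \<in> sets (T \<Otimes>\<^sub>M U)"
    let ?c = "emeasure M {\<omega> \<in> space M. X \<omega> \<in> A}"
    \<comment> \<open>Two finite measures for the pair of Y and V: its law scaled by the probability
      of X in A, and its law restricted to that event. They agree on rectangles, an
      intersection-stable generator.\<close>
    let ?\<mu> = "scale_measure ?c (distr M (T \<Otimes>\<^sub>M U) (\<lambda>\<omega>. (Y \<omega>, V \<omega>)))"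
    let ?\<nu> = "distr (density M (indicator {\<omega> \<in> space M. X \<omega> \<in> A})) (T \<Otimes>\<^sub>M U) (\<lambda>\<omega>. (Y \<omega>, V \<omega>))"
    have \<mu>: "emeasure ?\<mu> E = ?c * emeasure M {\<omega> \<in> space M. (Y \<omega>, V \<omega>) \<in> E}" if "E \<in> sets (T \<Otimes>\<^sub>M U)" for E
      using that by (auto simp: emeasure_distr intro!: arg_cong2[where f="(*)"] arg_cong2[where f=emeasure])
    have \<nu>: "emeasure ?\<nu> E = emeasure M {\<omega> \<in> space M. X \<omega> \<in> A \<and> (Y \<omega>, V \<omega>) \<in> E}" if [measurable]: "E \<in> sets (T \<Otimes>\<^sub>M U)" for E
    proof -
      have "emeasure ?\<nu> E = emeasure (density M (indicator {\<omega> \<in> space M. X \<omega> \<in> A})) ((\<lambda>\<omega>. (Y \<omega>, V \<omega>)) -` E \<inter> space M)"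
        by (subst emeasure_distr) auto
      also have "\<dots> = emeasure M ({\<omega> \<in> space M. X \<omega> \<in> A} \<inter> ((\<lambda>\<omega>. (Y \<omega>, V \<omega>)) -` E \<inter> space M))"
        by (subst emeasure_density) (simp_all flip: indicator_inter_arith)
      also have "{\<omega> \<in> space M. X \<omega> \<in> A} \<inter> ((\<lambda>\<omega>. (Y \<omega>, V \<omega>)) -` E \<inter> space M) = {\<omega> \<in> space M. X \<omega> \<in> A \<and> (Y \<omega>, V \<omega>) \<in> E}"
        by auto
      finally show ?thesis .
    qed
    have "?\<mu> = ?\<nu>"
    proof (rule measure_eqI_generator_eq[OF Int_stable_pair_measure_generator[of T U] pair_measure_closed,
          where A="\<lambda>_. space T \<times> space U"])
      fix F assume "F \<in> {a \<times> b |a b. a \<in> sets T \<and> b \<in> sets U}"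
      then obtain B C where F: "F = B \<times> C" "B \<in> sets T" "C \<in> sets U" by auto
      then have "F \<in> sets (T \<Otimes>\<^sub>M U)" by auto
      then show "emeasure ?\<mu> F = emeasure ?\<nu> F"
        using F A by (simp only: \<mu> \<nu>) (simp add: eq YV)
    next
      have "emeasure ?\<mu> (space T \<times> space U) \<le> 1 * 1"
        by (subst \<mu>) (auto intro!: mult_mono simp: emeasure_le_1 space_pair_measure[symmetric] simp del: mult_1_left mult_1_right)
      then show "emeasure ?\<mu> (space T \<times> space U) \<noteq> \<infinity>"
        by (auto simp: top_unique)
    qed (auto simp: sets_pair_measure)
    then show "emeasure M {\<omega> \<in> space M. X \<omega> \<in> A \<and> (Y \<omega>, V \<omega>) \<in> E} =
        ?c * emeasure M {\<omega> \<in> space M. (Y \<omega>, V \<omega>) \<in> E}"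
      using \<mu>[OF E] \<nu>[OF E] by simp
  qed
  also have "distr M (T \<Otimes>\<^sub>M U) (\<lambda>\<omega>. (Y \<omega>, V \<omega>)) = distr M T Y \<Otimes>\<^sub>M distr M U V"
    by (rule distr_pair_rectangles[OF M Y V YV])
  finally show ?thesis .
qed

lemma distr_indep_pair:
  assumes M: "prob_space M" and ind: "indep_pair M S X T Y"
  shows "distr M (S \<Otimes>\<^sub>M T) (\<lambda>\<omega>. (X \<omega>, Y \<omega>)) = distr M S X \<Otimes>\<^sub>M distr M T Y"
proof (rule distr_pair_rectangles[OF M])
  interpret prob_space M by fact
  show "X \<in> M \<rightarrow>\<^sub>M S" "Y \<in> M \<rightarrow>\<^sub>M T"
    using ind by (auto simp: indep_pair_def)
  fix A B assume AB: "A \<in> sets S" "B \<in> sets T"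
  have "prob ((X -` A \<inter> space M) \<inter> (Y -` B \<inter> space M)) = prob (X -` A \<inter> space M) * prob (Y -` B \<inter> space M)"
    using ind AB by (intro indep_setD[of "preimages M S X" "preimages M T Y"]) (auto simp: indep_pair_def preimages_def)
  moreover have "(X -` A \<inter> space M) \<inter> (Y -` B \<inter> space M) = {\<omega> \<in> space M. X \<omega> \<in> A \<and> Y \<omega> \<in> B}"
    "X -` A \<inter> space M = {\<omega> \<in> space M. X \<omega> \<in> A}" "Y -` B \<inter> space M = {\<omega> \<in> space M. Y \<omega> \<in> B}"
    by auto
  ultimately show "emeasure M {\<omega> \<in> space M. X \<omega> \<in> A \<and> Y \<omega> \<in> B} =
      emeasure M {\<omega> \<in> space M. X \<omega> \<in> A} * emeasure M {\<omega> \<in> space M. Y \<omega> \<in> B}"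
    by (simp add: emeasure_eq_measure ennreal_mult')
qed

lemma distr_indep_triple:
  assumes M: "prob_space M" and ind: "indep_triple M S X T Y U V"
  shows "distr M (S \<Otimes>\<^sub>M (T \<Otimes>\<^sub>M U)) (\<lambda>\<omega>. (X \<omega>, (Y \<omega>, V \<omega>))) = distr M S X \<Otimes>\<^sub>M (distr M T Y \<Otimes>\<^sub>M distr M U V)"
proof (rule distr_triple_boxes[OF M])
  interpret prob_space M by fact
  show "X \<in> M \<rightarrow>\<^sub>M S" "Y \<in> M \<rightarrow>\<^sub>M T" "V \<in> M \<rightarrow>\<^sub>M U"
    using ind by (auto simp: indep_triple_def)
  fix A B C assume ABC: "A \<in> sets S" "B \<in> sets T" "C \<in> sets U"
  let ?F = "case_option (preimages M S X) (case_bool (preimages M T Y) (preimages M U V))"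
  let ?E = "case_option {\<omega> \<in> space M. X \<omega> \<in> A} (case_bool {\<omega> \<in> space M. Y \<omega> \<in> B} {\<omega> \<in> space M. V \<omega> \<in> C})"
  have UNIV_eq: "(UNIV :: bool option set) = {None, Some True, Some False}"
    by (auto simp: UNIV_option_conv UNIV_bool)
  have "{\<omega> \<in> space M. X \<omega> \<in> A} = X -` A \<inter> space M" "{\<omega> \<in> space M. Y \<omega> \<in> B} = Y -` B \<inter> space M"
    "{\<omega> \<in> space M. V \<omega> \<in> C} = V -` C \<inter> space M"
    by auto
  then have "\<forall>j\<in>UNIV. ?E j \<in> ?F j"
    using ABC by (auto simp: preimages_def split: option.split bool.split)
  then have "prob (\<Inter>j\<in>UNIV. ?E j) = (\<Prod>j\<in>UNIV. prob (?E j))"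
    using ind by (intro indep_setsD[of ?F UNIV]) (auto simp: indep_triple_def)
  moreover have "(\<Inter>j\<in>UNIV. ?E j) = {\<omega> \<in> space M. X \<omega> \<in> A \<and> Y \<omega> \<in> B \<and> V \<omega> \<in> C}"
    unfolding UNIV_eq by auto
  moreover have "(\<Prod>j\<in>UNIV. prob (?E j)) = prob {\<omega> \<in> space M. X \<omega> \<in> A} *
      (prob {\<omega> \<in> space M. Y \<omega> \<in> B} * prob {\<omega> \<in> space M. V \<omega> \<in> C})"
    unfolding UNIV_eq by simp
  ultimately show "emeasure M {\<omega> \<in> space M. X \<omega> \<in> A \<and> Y \<omega> \<in> B \<and> V \<omega> \<in> C} =
      emeasure M {\<omega> \<in> space M. X \<omega> \<in> A} * (emeasure M {\<omega> \<in> space M. Y \<omega> \<in> B} * emeasure M {\<omega> \<in> space M. V \<omega> \<in> C})"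
    by (simp add: emeasure_eq_measure ennreal_mult')
qed

lemma borel_measurable_vec_lambda:
  fixes f :: "'n::finite \<Rightarrow> 'a \<Rightarrow> real"
  assumes "\<And>i. f i \<in> borel_measurable M"
  shows "(\<lambda>x. \<chi> i. f i x) \<in> borel_measurable M"
proof (rule borel_measurable_euclidean_space[THEN iffD2], rule ballI)
  fix b :: "real ^ 'n" assume "b \<in> Basis"
  then obtain j where "b = axis j 1"
    by (auto simp: Basis_vec_def)
  with assms[of j] show "(\<lambda>x. (\<chi> i. f i x) \<bullet> b) \<in> borel_measurable M"
    by (simp add: inner_axis)
qed

text \<open>Valid without summability, since both sides default to 0 together. It translates the
  infinite sums in the definition of the Gibbs measure into integrals.\<close>

lemma infsum_eq_integral_count_space:
  fixes g :: "'i \<Rightarrow> real"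
  shows "infsum g A = (\<integral>x. g x \<partial>count_space A)"
proof (cases "g summable_on A")
  case True
  then have "Infinite_Set_Sum.abs_summable_on g A"
    using abs_summable_equivalent summable_on_iff_abs_summable_on_real by blast
  then show ?thesis
    using infsetsum_infsum by (metis infsetsum_def)
next
  case False
  then have "\<not> Infinite_Set_Sum.abs_summable_on g A"
    using abs_summable_equivalent summable_on_iff_abs_summable_on_real by blast
  then show ?thesis
    using False by (simp add: infsum_not_exists not_integrable_integral_eq Infinite_Set_Sum.abs_summable_on_def)
qed

text \<open>Completing the square turns exp(a x) times the normal density into a multiple of a
  shifted normal density; exp(c |x|) is at most the sum of the two one-sided exponentials.\<close>

lemma centered_gaussian_exp_abs:
  assumes M: "prob_space M" and X: "centered_gaussian M v X"
  shows "integrable M (\<lambda>\<omega>. exp (c * \<bar>X \<omega>\<bar>))"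
proof -
  have X_meas [measurable]: "X \<in> borel_measurable M" and law: "distr M borel X = centered_normal v"
    using X by (auto simp: centered_gaussian_def)
  have "integrable (centered_normal v) (\<lambda>x. exp (c * \<bar>x\<bar>))"
  proof (cases "v = 0")
    case True
    have "(\<integral>\<^sup>+x. ennreal (norm (exp (c * \<bar>x\<bar>))) \<partial>return borel (0::real)) = 1"
      by (subst nn_integral_return) auto
    with True show ?thesis
      by (auto simp: centered_normal_def intro!: integrableI_bounded)
  next
    case False
    \<comment> \<open>The sign of v is not fixed here. For negative v the value
      \<open>sqrt v\<close> is minus the root of |v|, and the density sees only its square.\<close>
    define \<sigma> where "\<sigma> = sqrt \<bar>v\<bar>"
    have \<sigma>: "0 < \<sigma>" and \<sigma>2: "\<sigma>\<^sup>2 = (sqrt v)\<^sup>2"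
      using False by (auto simp: \<sigma>_def real_sqrt_abs2 power2_eq_square real_sqrt_mult[symmetric] abs_if real_sqrt_minus)
    have dens: "normal_density 0 (sqrt v) = normal_density 0 \<sigma>"
      by (simp add: normal_density_def fun_eq_iff \<sigma>2)
    have shift: "normal_density 0 \<sigma> x * exp (a * x) = exp (a\<^sup>2 * \<sigma>\<^sup>2 / 2) * normal_density (a * \<sigma>\<^sup>2) \<sigma> x" for a x
    proof -
      have "- (x - 0)\<^sup>2 / (2 * \<sigma>\<^sup>2) + a * x = a\<^sup>2 * \<sigma>\<^sup>2 / 2 + - (x - a * \<sigma>\<^sup>2)\<^sup>2 / (2 * \<sigma>\<^sup>2)"
        using \<sigma> by (simp add: field_simps power2_eq_square)
      then show ?thesis
        by (simp add: normal_density_def exp_add[symmetric] mult_ac)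
    qed
    have int: "integrable lborel (\<lambda>x. normal_density 0 \<sigma> x * exp (a * x))" for a
      unfolding shift using \<sigma> by (intro integrable_mult_right integrable_normal_density) auto
    have "integrable lborel (\<lambda>x. normal_density 0 \<sigma> x * exp (c * x) + normal_density 0 \<sigma> x * exp (- c * x))"
      by (intro Bochner_Integration.integrable_add int)
    then have "integrable lborel (\<lambda>x. normal_density 0 \<sigma> x * exp (c * \<bar>x\<bar>))"
    proof (rule Bochner_Integration.integrable_bound)
      show "AE x in lborel. norm (normal_density 0 \<sigma> x * exp (c * \<bar>x\<bar>)) \<le>
          norm (normal_density 0 \<sigma> x * exp (c * x) + normal_density 0 \<sigma> x * exp (- c * x))"
      proof (intro AE_I2)
        fix x
        have "exp (c * \<bar>x\<bar>) \<le> exp (c * x) + exp (- c * x)"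
          by (cases "0 \<le> x") auto
        then show "norm (normal_density 0 \<sigma> x * exp (c * \<bar>x\<bar>)) \<le>
            norm (normal_density 0 \<sigma> x * exp (c * x) + normal_density 0 \<sigma> x * exp (- c * x))"
          using mult_left_mono[of "exp (c * \<bar>x\<bar>)" "exp (c * x) + exp (- c * x)" "normal_density 0 \<sigma> x"]
          by (simp add: abs_mult distrib_left)
      qed
    qed simp
    then have "integrable (density lborel (\<lambda>x. ennreal (normal_density 0 \<sigma> x))) (\<lambda>x. exp (c * \<bar>x\<bar>))"
      by (subst integrable_density) auto
    then show ?thesis
      using False by (simp add: centered_normal_def dens)
  qed
  then have "integrable (distr M borel X) (\<lambda>x. exp (c * \<bar>x\<bar>))"
    by (simp add: law)
  then show ?thesis
    by (subst (asm) integrable_distr_eq) auto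
qed

text \<open>The sum is at most the number of terms times the largest term. It bounds exponential
  moments of a vector norm by those of single coordinates, whatever their joint law.\<close>

lemma exp_sum_le_sum_exp:
  fixes x :: "'i \<Rightarrow> real"
  assumes "finite I" "I \<noteq> {}"
  shows "exp (\<Sum>i\<in>I. x i) \<le> (\<Sum>i\<in>I. exp (card I * x i))"
proof -
  obtain j where j: "j \<in> I" "\<And>i. i \<in> I \<Longrightarrow> x i \<le> x j"
  proof -
    have "Max (x ` I) \<in> x ` I"
      using assms by (intro Max_in) auto
    then obtain j where "j \<in> I" "x j = Max (x ` I)"
      by auto
    with assms show ?thesis
      by (intro that[of j]) auto
  qed
  have "(\<Sum>i\<in>I. x i) \<le> card I * x j"
    using sum_bounded_above[of I x "x j"] j by simp
  then have "exp (\<Sum>i\<in>I. x i) \<le> exp (card I * x j)"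
    by simp
  also have "\<dots> \<le> (\<Sum>i\<in>I. exp (card I * x i))"
    using assms j(1) by (intro member_le_sum) auto
  finally show ?thesis .
qed

lemma gaussian_vector_exp_norm:
  fixes Z :: "'a \<Rightarrow> real ^ 'n"
  assumes M: "prob_space M" and Z: "\<And>i. centered_gaussian M v (\<lambda>\<omega>. Z \<omega> $ i)" and c: "0 \<le> c"
  shows "integrable M (\<lambda>\<omega>. exp (c * norm (Z \<omega>)))"
proof (rule Bochner_Integration.integrable_bound)
  have [measurable]: "(\<lambda>\<omega>. Z \<omega> $ i) \<in> borel_measurable M" for i
    using Z by (auto simp: centered_gaussian_def)
  have "(\<lambda>\<omega>. \<chi> i. Z \<omega> $ i) \<in> borel_measurable M"
    by (intro borel_measurable_vec_lambda) measurable
  then have [measurable]: "Z \<in> borel_measurable M"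
    by simp
  show "integrable M (\<lambda>\<omega>. \<Sum>i\<in>UNIV. exp (card (UNIV :: 'n set) * c * \<bar>Z \<omega> $ i\<bar>))"
    by (intro Bochner_Integration.integrable_sum centered_gaussian_exp_abs[OF M Z])
  show "(\<lambda>\<omega>. exp (c * norm (Z \<omega>))) \<in> borel_measurable M"
    by measurable
  show "AE \<omega> in M. norm (exp (c * norm (Z \<omega>))) \<le> norm (\<Sum>i\<in>UNIV. exp (card (UNIV :: 'n set) * c * \<bar>Z \<omega> $ i\<bar>))"
  proof (intro AE_I2)
    fix \<omega>
    have "c * norm (Z \<omega>) \<le> c * (\<Sum>i\<in>UNIV. \<bar>Z \<omega> $ i\<bar>)"
      using c by (intro mult_left_mono norm_le_l1_cart)
    then have "exp (c * norm (Z \<omega>)) \<le> exp (\<Sum>i\<in>UNIV. c * \<bar>Z \<omega> $ i\<bar>)"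
      by (simp add: sum_distrib_left)
    also have "\<dots> \<le> (\<Sum>i\<in>UNIV. exp (card (UNIV :: 'n set) * (c * \<bar>Z \<omega> $ i\<bar>)))"
      by (intro exp_sum_le_sum_exp) auto
    finally show "norm (exp (c * norm (Z \<omega>))) \<le> norm (\<Sum>i\<in>UNIV. exp (card (UNIV :: 'n set) * c * \<bar>Z \<omega> $ i\<bar>))"
      by (simp add: sum_nonneg mult.assoc)
  qed
qed

subsection \<open>Two replicas with shared columns\<close>

lemma finite_spins [simp, intro]: "finite (spins :: (real ^ 'n) set)"
proof -
  have "(spins :: (real ^ 'n) set) \<subseteq> vec_lambda ` (UNIV \<rightarrow>\<^sub>E {-1, 1 :: real})"
  proof
    fix \<sigma> :: "real ^ 'n" assume "\<sigma> \<in> spins"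
    then have "vec_nth \<sigma> \<in> UNIV \<rightarrow>\<^sub>E {-1, 1}"
      by (auto simp: spins_def)
    then have "vec_lambda (vec_nth \<sigma>) \<in> vec_lambda ` (UNIV \<rightarrow>\<^sub>E {-1, 1 :: real})"
      by (rule imageI)
    then show "\<sigma> \<in> vec_lambda ` (UNIV \<rightarrow>\<^sub>E {-1, 1 :: real})"
      by simp
  qed
  then show ?thesis
    by (rule finite_subset) (auto intro!: finite_PiE)
qed

lemma spins_nonempty: "(spins :: (real ^ 'n) set) \<noteq> {}"
proof -
  have "(\<chi> i. 1) \<in> (spins :: (real ^ 'n) set)"
    by (simp add: spins_def)
  then show ?thesis by blast
qed

lemma borel_measurable_fst_borel [measurable]:
  "fst \<in> borel_measurable (borel :: ('b::second_countable_topology \<times> 'd::second_countable_topology) measure)"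
  and borel_measurable_snd_borel [measurable]:
  "snd \<in> borel_measurable (borel :: ('b \<times> 'd) measure)"
  by (intro borel_measurable_continuous_onI continuous_intros)+

definition partition_one :: "nat \<Rightarrow> real \<Rightarrow> (real ^ 'n \<Rightarrow> real) \<Rightarrow> (nat \<Rightarrow> real ^ 'n) \<Rightarrow> real" where
  "partition_one k t h z = (\<Sum>\<sigma>\<in>spins. exp (Ht t h (\<Sum>p\<le>k. z p) \<sigma>))"

definition gibbs_sum :: "(real ^ 'n \<Rightarrow> real ^ 'n \<Rightarrow> real) \<Rightarrow> nat \<Rightarrow> real \<Rightarrow> (real ^ 'n \<Rightarrow> real) \<Rightarrow>
    (nat \<Rightarrow> (real ^ 'n) \<times> (real ^ 'n)) \<Rightarrow> real" where
  "gibbs_sum f k t h z = (\<Sum>\<sigma>\<in>spins. \<Sum>\<tau>\<in>spins. f \<sigma> \<tau> *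
    exp (Ht t h (\<Sum>p\<le>k. fst (z p)) \<sigma> + Ht t h (\<Sum>p\<le>k. snd (z p)) \<tau>))"

abbreviation "partition_two \<equiv> gibbs_sum (\<lambda>_ _. 1)"

lemma partition_two_eq: "partition_two k t h z = partition_one k t h (fst \<circ> z) * partition_one k t h (snd \<circ> z)"
  by (simp add: gibbs_sum_def partition_one_def sum_product exp_add)

lemma partition_one_pos: "0 < partition_one k t h z"
  unfolding partition_one_def using spins_nonempty by (intro sum_pos) auto

lemma partition_two_pos: "0 < partition_two k t h z"
  by (simp add: partition_two_eq partition_one_pos)

lemma depends_upto_partition_one: "depends_upto k (partition_one k t h)"
  by (auto simp: depends_upto_def partition_one_def intro!: sum.cong)

lemma depends_upto_gibbs_sum:
  fixes f :: "real ^ 'n \<Rightarrow> real ^ 'n \<Rightarrow> real"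
  shows "depends_upto k (gibbs_sum f k t h)"
  unfolding depends_upto_def
proof (intro allI impI)
  fix z z' :: "nat \<Rightarrow> (real ^ 'n) \<times> (real ^ 'n)"
  assume "\<forall>p\<le>k. z p = z' p"
  then have "(\<Sum>p\<le>k. fst (z p)) = (\<Sum>p\<le>k. fst (z' p))" "(\<Sum>p\<le>k. snd (z p)) = (\<Sum>p\<le>k. snd (z' p))"
    by (auto intro!: sum.cong)
  then show "gibbs_sum f k t h z = gibbs_sum f k t h z'"
    by (simp add: gibbs_sum_def)
qed

abbreviation (input) "fields \<equiv> PiM spins (\<lambda>_. borel :: real measure)"

lemma measurable_partition_one:
  "(\<lambda>(h, z). partition_one k t h z) \<in> borel_measurable (fields \<Otimes>\<^sub>M seqs)"
  unfolding partition_one_def Ht_def by measurable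

lemma measurable_gibbs_sum:
  "(\<lambda>(h, z). gibbs_sum f k t h z) \<in> borel_measurable (fields \<Otimes>\<^sub>M seqs)"
  unfolding gibbs_sum_def Ht_def by measurable

text \<open>Here h is an arbitrary function, whereas \<open>fields\<close> contains only functions
  restricted to \<open>spins\<close>; G reads h on \<open>spins\<close> alone, so the restriction
  may be substituted.\<close>

lemma measurable_fixed_field:
  assumes "(\<lambda>(h, z). G h z) \<in> borel_measurable (fields \<Otimes>\<^sub>M N)" and "\<And>h. G (restrict h spins) = G h"
  shows "G h \<in> borel_measurable N"
proof -
  have "(\<lambda>z. (restrict h spins, z)) \<in> N \<rightarrow>\<^sub>M fields \<Otimes>\<^sub>M N"
    by (intro measurable_Pair measurable_const measurable_ident) (auto simp: space_PiM)
  from measurable_compose[OF this assms(1)] show ?thesis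
    by (simp add: assms(2))
qed

lemma partition_one_restrict: "partition_one k t (restrict h spins) = partition_one k t h"
  by (auto simp: partition_one_def Ht_def fun_eq_iff)

lemma gibbs_sum_restrict: "gibbs_sum f k t (restrict h spins) = gibbs_sum f k t h"
  by (auto simp: gibbs_sum_def Ht_def fun_eq_iff intro!: sum.cong)

lemmas measurable_partition_one' [measurable] = measurable_fixed_field[OF measurable_partition_one partition_one_restrict]
lemmas measurable_gibbs_sum' [measurable] = measurable_fixed_field[OF measurable_gibbs_sum gibbs_sum_restrict]

text \<open>A crude uniform bound for the norm of a configuration; as a sum of all norms it
  dominates each of them directly.\<close>

definition spin_bound :: "'n::finite itself \<Rightarrow> real" where
  "spin_bound _ = (\<Sum>\<sigma>\<in>(spins :: (real ^ 'n) set). norm \<sigma>)"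

lemma spin_bound_nonneg: "0 \<le> spin_bound TYPE('n::finite)"
  by (simp add: spin_bound_def sum_nonneg)

lemma Ht_le:
  fixes \<sigma> :: "real ^ 'n"
  assumes t: "0 \<le> t" "t \<le> 1" and \<sigma>: "\<sigma> \<in> spins"
  shows "Ht t h s \<sigma> \<le> (\<Sum>\<sigma>\<in>spins. \<bar>h \<sigma>\<bar>) + spin_bound TYPE('n) * norm s"
proof -
  have le_abs: "a * x \<le> \<bar>x\<bar>" if "0 \<le> a" "a \<le> 1" for a x :: real
  proof -
    have "a * x \<le> a * \<bar>x\<bar>"
      using that by (intro mult_left_mono) auto
    also have "\<dots> \<le> 1 * \<bar>x\<bar>"
      using that by (intro mult_right_mono) auto
    finally show ?thesis by simp
  qed
  have "sqrt t * h \<sigma> \<le> \<bar>h \<sigma>\<bar>"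
    using t by (intro le_abs) auto
  also have "\<dots> \<le> (\<Sum>\<sigma>\<in>spins. \<bar>h \<sigma>\<bar>)"
    using \<sigma> by (intro member_le_sum[of \<sigma> spins "\<lambda>\<sigma>. \<bar>h \<sigma>\<bar>"]) auto
  finally have 1: "sqrt t * h \<sigma> \<le> (\<Sum>\<sigma>\<in>spins. \<bar>h \<sigma>\<bar>)" .
  have "sqrt (1 - t) * (s \<bullet> \<sigma>) \<le> \<bar>s \<bullet> \<sigma>\<bar>"
    using t by (intro le_abs) auto
  also have "\<dots> \<le> norm s * norm \<sigma>"
    by (simp add: Cauchy_Schwarz_ineq2)
  also have "\<dots> \<le> norm s * spin_bound TYPE('n)"
    unfolding spin_bound_def using \<sigma> by (intro mult_left_mono member_le_sum) auto
  finally show ?thesis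
    using 1 by (simp add: Ht_def mult.commute)
qed

lemma partition_one_le:
  fixes z :: "nat \<Rightarrow> real ^ 'n"
  assumes t: "0 \<le> t" "t \<le> 1"
  shows "partition_one k t h z \<le>
    exp (ln (real (card (spins :: (real ^ 'n) set))) + (\<Sum>\<sigma>\<in>spins. \<bar>h \<sigma>\<bar>) + (\<Sum>p\<le>k. spin_bound TYPE('n) * norm (z p)))"
proof -
  have card: "0 < card (spins :: (real ^ 'n) set)"
    using spins_nonempty by (simp add: card_gt_0_iff)
  have "Ht t h (\<Sum>p\<le>k. z p) \<sigma> \<le> (\<Sum>\<sigma>\<in>spins. \<bar>h \<sigma>\<bar>) + (\<Sum>p\<le>k. spin_bound TYPE('n) * norm (z p))" if "\<sigma> \<in> spins" for \<sigma>
  proof -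
    have "spin_bound TYPE('n) * norm (\<Sum>p\<le>k. z p) \<le> spin_bound TYPE('n) * (\<Sum>p\<le>k. norm (z p))"
      by (intro mult_left_mono norm_sum spin_bound_nonneg)
    then show ?thesis
      using Ht_le[OF t that, of h "\<Sum>p\<le>k. z p"] by (simp add: sum_distrib_left)
  qed
  then have "partition_one k t h z \<le> real (card (spins :: (real ^ 'n) set)) *
      exp ((\<Sum>\<sigma>\<in>spins. \<bar>h \<sigma>\<bar>) + (\<Sum>p\<le>k. spin_bound TYPE('n) * norm (z p)))"
    unfolding partition_one_def by (intro sum_bounded_above) simp
  then show ?thesis
    using card by (simp add: exp_add mult.assoc)
qed

locale column_model = prob_space M
  for M :: "'a measure" +
  fixes k r :: nat and m :: "nat \<Rightarrow> real" and t :: real and v :: "nat \<Rightarrow> real"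
    and Z :: "nat \<Rightarrow> nat \<Rightarrow> 'a \<Rightarrow> real ^ 'n"
  assumes r: "1 \<le> r" "r \<le> k" and t: "0 \<le> t" "t \<le> 1"
    and m: "m 0 = 0" "\<And>l. l < k \<Longrightarrow> m l < m (l + 1)" "m k < 1"
    and Z_gaussian: "\<And>j l i. j \<in> {1, 2} \<Longrightarrow> l \<le> k \<Longrightarrow> centered_gaussian M (v l) (\<lambda>\<omega>. Z j l \<omega> $ i)"
    and Z_equal: "\<And>l \<omega>. l < r \<Longrightarrow> \<omega> \<in> space M \<Longrightarrow> Z 1 l \<omega> = Z 2 l \<omega>"
    and Z_indep: "indep_vars (\<lambda>_. borel) (\<lambda>(j, l, i) \<omega>. Z j l \<omega> $ i)
        ({1} \<times> {..k} \<times> UNIV \<union> {2} \<times> {r..k} \<times> UNIV)"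
begin

lemma Z_measurable [measurable]:
  assumes "j \<in> {1, 2}" "l \<le> k"
  shows "Z j l \<in> borel_measurable M"
proof -
  have "(\<lambda>\<omega>. \<chi> i. Z j l \<omega> $ i) \<in> borel_measurable M"
    using Z_gaussian[OF assms] by (intro borel_measurable_vec_lambda) (auto simp: centered_gaussian_def)
  then show ?thesis by simp
qed

lemma m_mono: "l \<le> l' \<Longrightarrow> l' \<le> k \<Longrightarrow> m l \<le> m l'"
proof (induction l' rule: dec_induct)
  case (step p)
  then show ?case using m(2)[of p] by simp
qed simp

lemma m_pos: "1 \<le> l \<Longrightarrow> l \<le> k \<Longrightarrow> 0 < m l"
  using m(2)[of 0] m(1) m_mono[of 1 l] by simp

lemma m_less_1: "l \<le> k \<Longrightarrow> m l < 1"
  using m(3) m_mono[of l k] by simp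

abbreviation "n \<equiv> cascade_param r m"

lemma n_pos: "1 \<le> l \<Longrightarrow> l \<le> k \<Longrightarrow> 0 < n l"
  using m_pos[of l] by (simp add: cascade_param_def)

lemma n_less_1: "1 \<le> l \<Longrightarrow> l \<le> k \<Longrightarrow> n l < 1"
  using m_pos[of l] m_less_1[of l] by (auto simp: cascade_param_def)

lemma n_less: "1 \<le> l \<Longrightarrow> l < k \<Longrightarrow> n l < n (Suc l)"
  using m(2)[of l] m_pos[of l] by (auto simp: cascade_param_def)

text \<open>Beyond level k the last column is repeated, so that there is a probability law at every
  index, as \<open>hierarchy\<close> demands.\<close>

definition law :: "nat \<Rightarrow> (real ^ 'n) measure" where
  "law l = distr M borel (Z 1 (min l k))"

definition pair_law :: "nat \<Rightarrow> ((real ^ 'n) \<times> (real ^ 'n)) measure" where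
  "pair_law l = distr M borel (\<lambda>\<omega>. (Z 1 (min l k) \<omega>, Z 2 (min l k) \<omega>))"

sublocale A: hierarchy k m law
proof (rule hierarchy.intro)
  show "prob_space (law l)" for l
    unfolding law_def by (rule prob_space_distr) simp
qed (auto simp: law_def m_pos m_less_1)

sublocale B: hierarchy k n pair_law
proof (rule hierarchy.intro)
  show "prob_space (pair_law l)" for l
    unfolding pair_law_def by (rule prob_space_distr) simp
qed (auto simp: pair_law_def n_pos n_less_1)

text \<open>The right side does not mention j, which yields equality in law of the two replicas'
  columns. For j = 2 the levels below r are excluded because the independent family contains only
  one copy of the shared columns.\<close>

lemma column_law:
  assumes jl: "j = 1 \<and> l \<le> k \<or> j = 2 \<and> r \<le> l \<and> l \<le> k"
  shows "distr M borel (Z j l) = distr (PiM UNIV (\<lambda>_. centered_normal (v l))) borel vec_lambda"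
proof -
  let ?J = "{j} \<times> {l} \<times> (UNIV :: 'n set)" and ?X = "\<lambda>(j, l, i) \<omega>. Z j l \<omega> $ i"
  have cg: "centered_gaussian M (v l) (\<lambda>\<omega>. Z j l \<omega> $ i)" for i
    using jl by (intro Z_gaussian) auto
  then have [measurable]: "(\<lambda>\<omega>. Z j l \<omega> $ i) \<in> borel_measurable M" and d: "distr M borel (\<lambda>\<omega>. Z j l \<omega> $ i) = centered_normal (v l)" for i
    by (auto simp: centered_gaussian_def)
  have cn_prob: "prob_space (centered_normal (v l))"
    unfolding d[of undefined, symmetric] by (rule prob_space_distr) simp
  have cn_sets: "sets (centered_normal (v l)) = sets borel"
    unfolding d[of undefined, symmetric] by simp
  have rv: "?X x \<in> borel_measurable M" if "x \<in> ?J" for x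
    using that by auto
  have "indep_vars (\<lambda>_. borel) ?X ?J"
    using jl by (intro indep_vars_subset[OF Z_indep]) auto
  then have "distr M (PiM ?J (\<lambda>_. borel)) (\<lambda>\<omega>. \<lambda>x\<in>?J. ?X x \<omega>) = PiM ?J (\<lambda>x. distr M borel (?X x))"
    by (subst (asm) indep_vars_iff_distr_eq_PiM'[OF _ rv]) auto
  also have "\<dots> = PiM ?J (\<lambda>_. centered_normal (v l))"
    by (intro PiM_cong) (auto simp: d)
  finally have J: "distr M (PiM ?J (\<lambda>_. borel)) (\<lambda>\<omega>. \<lambda>x\<in>?J. ?X x \<omega>) = PiM ?J (\<lambda>_. centered_normal (v l))" .
  have vec: "vec_lambda \<in> PiM UNIV (\<lambda>_::'n. borel) \<rightarrow>\<^sub>M (borel :: (real ^ 'n) measure)"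
    using borel_measurable_vec_lambda[of "\<lambda>i x. x i" "PiM UNIV (\<lambda>_::'n. borel)"] by simp
  have vec': "vec_lambda \<in> PiM UNIV (\<lambda>_::'n. centered_normal (v l)) \<rightarrow>\<^sub>M (borel :: (real ^ 'n) measure)"
    using vec by (simp cong: measurable_cong_sets sets_PiM_cong add: cn_sets)
  have re: "distr (PiM ?J (\<lambda>_. centered_normal (v l))) (PiM UNIV (\<lambda>_. centered_normal (v l))) (\<lambda>x. \<lambda>i\<in>UNIV. x (j, l, i)) =
    PiM UNIV (\<lambda>_. centered_normal (v l))"
    by (rule distr_PiM_reindex) (auto intro: cn_prob simp: inj_on_def)
  have "distr (PiM UNIV (\<lambda>_. centered_normal (v l))) borel vec_lambda =
    distr (PiM ?J (\<lambda>_. centered_normal (v l))) borel (\<lambda>x. vec_lambda (\<lambda>i. x (j, l, i)))"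
    by (subst re[symmetric], subst distr_distr[OF vec']) (auto simp: comp_def restrict_UNIV sets_eq_imp_space_eq[OF cn_sets] intro!: measurable_PiM_single')
  also have "\<dots> = distr M borel (\<lambda>\<omega>. vec_lambda (\<lambda>i. (\<lambda>x\<in>?J. ?X x \<omega>) (j, l, i)))"
    unfolding J[symmetric]
  proof (subst distr_distr)
    show "(\<lambda>x. vec_lambda (\<lambda>i. x (j, l, i))) \<in> PiM ?J (\<lambda>_. borel) \<rightarrow>\<^sub>M (borel :: (real ^ 'n) measure)"
      by (intro borel_measurable_vec_lambda measurable_component_singleton) auto
    show "(\<lambda>\<omega>. \<lambda>x\<in>?J. ?X x \<omega>) \<in> M \<rightarrow>\<^sub>M PiM ?J (\<lambda>_. borel)"
      by (intro measurable_restrict rv)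
  qed (simp add: comp_def)
  also have "\<dots> = distr M borel (Z j l)"
    by simp
  finally show ?thesis by simp
qed

lemma law_eq:
  assumes "j \<in> {1, 2}" "l \<le> k"
  shows "distr M borel (Z j l) = law l"
proof (cases "j = 1 \<or> r \<le> l")
  case True
  then show ?thesis
    using assms column_law[of j l] column_law[of 1 l] by (auto simp: law_def)
next
  case False
  then show ?thesis
    using assms Z_equal[of l] by (auto simp: law_def intro!: distr_cong)
qed

lemma pair_law_eq: "l \<le> k \<Longrightarrow> pair_law l = distr M borel (\<lambda>\<omega>. (Z 1 l \<omega>, Z 2 l \<omega>))"
  by (simp add: pair_law_def)

lemma admissible_partition_one: "A.admissible (partition_one k t h)"
proof (rule A.admissible_exp_bound[where \<kappa>="\<lambda>x. spin_bound TYPE('n) * norm x"])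
  show "integrable (law l) (\<lambda>x. exp (spin_bound TYPE('n) * norm x))" if "l \<le> k" for l
    using that unfolding law_def
    by (subst integrable_distr_eq) (auto intro!: gaussian_vector_exp_norm prob_space_axioms Z_gaussian spin_bound_nonneg)
  show "partition_one k t h z \<le> exp (ln (real (card (spins :: (real ^ 'n) set))) + (\<Sum>\<sigma>\<in>spins. \<bar>h \<sigma>\<bar>) + (\<Sum>p\<le>k. spin_bound TYPE('n) * norm (z p)))" for z
    by (rule partition_one_le[OF t])
qed (auto intro: partition_one_pos depends_upto_partition_one mult_nonneg_nonneg spin_bound_nonneg)

lemma admissible_partition_two: "B.admissible (partition_two k t h)"
proof (rule B.admissible_exp_bound[where \<kappa>="\<lambda>x. spin_bound TYPE('n) * (norm (fst x) + norm (snd x))"])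
  let ?c = "spin_bound TYPE('n)" and ?b = "ln (real (card (spins :: (real ^ 'n) set))) + (\<Sum>\<sigma>\<in>spins. \<bar>h \<sigma>\<bar>)"
  show "integrable (pair_law l) (\<lambda>x. exp (?c * (norm (fst x) + norm (snd x))))" if l: "l \<le> k" for l
    unfolding pair_law_eq[OF l]
  proof (subst integrable_distr_eq)
    show "integrable M (\<lambda>\<omega>. exp (?c * (norm (fst (Z 1 l \<omega>, Z 2 l \<omega>)) + norm (snd (Z 1 l \<omega>, Z 2 l \<omega>)))))"
    proof (rule Bochner_Integration.integrable_bound)
      show "integrable M (\<lambda>\<omega>. exp (2 * ?c * norm (Z 1 l \<omega>)) + exp (2 * ?c * norm (Z 2 l \<omega>)))"
        using l spin_bound_nonneg
        by (intro Bochner_Integration.integrable_add gaussian_vector_exp_norm[OF prob_space_axioms Z_gaussian]) auto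
      show "AE \<omega> in M. norm (exp (?c * (norm (fst (Z 1 l \<omega>, Z 2 l \<omega>)) + norm (snd (Z 1 l \<omega>, Z 2 l \<omega>))))) \<le>
          norm (exp (2 * ?c * norm (Z 1 l \<omega>)) + exp (2 * ?c * norm (Z 2 l \<omega>)))"
      proof (intro AE_I2)
        fix \<omega>
        \<comment> \<open>Replaces a moment of the pair by moments of the two columns separately,
          which covers shared and independent columns alike.\<close>
        have "exp (a + b) \<le> exp (2 * a) + exp (2 * b)" for a b :: real
        proof (cases "a \<le> b")
          case True
          then have "exp (a + b) \<le> exp (2 * b)" by simp
          then show ?thesis by (rule order_trans) simp
        next
          case False
          then have "exp (a + b) \<le> exp (2 * a)" by simp
          then show ?thesis by (rule order_trans) simp
        qed
        from this[of "?c * norm (Z 1 l \<omega>)" "?c * norm (Z 2 l \<omega>)"]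
        show "norm (exp (?c * (norm (fst (Z 1 l \<omega>, Z 2 l \<omega>)) + norm (snd (Z 1 l \<omega>, Z 2 l \<omega>))))) \<le>
          norm (exp (2 * ?c * norm (Z 1 l \<omega>)) + exp (2 * ?c * norm (Z 2 l \<omega>)))"
          by (simp add: distrib_left mult.assoc)
      qed
    qed (use l in measurable)
  qed (use l in measurable)
  show "partition_two k t h z \<le> exp ((?b + ?b) + (\<Sum>p\<le>k. ?c * (norm (fst (z p)) + norm (snd (z p)))))" for z
  proof -
    have "partition_two k t h z \<le> exp (?b + (\<Sum>p\<le>k. ?c * norm ((fst \<circ> z) p))) * exp (?b + (\<Sum>p\<le>k. ?c * norm ((snd \<circ> z) p)))"
      unfolding partition_two_eq by (intro mult_mono partition_one_le t less_imp_le[OF partition_one_pos]) auto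
    also have "\<dots> = exp ((?b + ?b) + (\<Sum>p\<le>k. ?c * (norm (fst (z p)) + norm (snd (z p)))))"
      by (simp add: exp_add[symmetric] sum.distrib distrib_left algebra_simps)
    finally show ?thesis .
  qed
qed (auto intro: partition_two_pos depends_upto_gibbs_sum mult_nonneg_nonneg add_nonneg_nonneg spin_bound_nonneg)

text \<open>\<open>expect_from\<close> averages over all columns from level l + 1 on, but the
  integrand depends only on columns up to l + 1. Hence the average is an integral over one column,
  and both replicas give the same functional.\<close>

lemma Xfun_eq:
  assumes j: "j \<in> {1, 2}" and "l \<le> k"
  shows "Xfun M k m t (Z j) h l = A.Y (partition_one k t h) l"
  using assms(2)
proof (induction l rule: ylog_induct)
  case last
  show ?case
    by (simp add: Xfun.simps[of M k m t "Z j" h k] ylog_last fun_eq_iff partition_one_def)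
next
  case (step l)
  show ?case
  proof
    fix z
    have dep: "depends_upto (Suc l) (A.Y (partition_one k t h) (Suc l))"
      using step by (intro depends_upto_ylog depends_upto_partition_one) auto
    have [measurable]: "A.Y (partition_one k t h) (Suc l) \<in> borel_measurable seqs"
      using step by (intro A.admissible_measurable_Y admissible_partition_one) auto
    have [measurable]: "Z j (Suc l) \<in> borel_measurable M"
      using step j by (intro Z_measurable) auto
    have "expect_from M (Z j) (Suc l) (\<lambda>y. exp (m (Suc l) * Xfun M k m t (Z j) h (Suc l) y)) z =
      (\<integral>\<omega>. exp (m (Suc l) * A.Y (partition_one k t h) (Suc l) (z(Suc l := Z j (Suc l) \<omega>))) \<partial>M)"
      unfolding expect_from_def step.IH
      by (intro Bochner_Integration.integral_cong refl arg_cong[where f="\<lambda>a. exp (m (Suc l) * a)"] depends_uptoD[OF dep]) auto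
    also have "\<dots> = (\<integral>x. exp (m (Suc l) * A.Y (partition_one k t h) (Suc l) (z(Suc l := x))) \<partial>distr M borel (Z j (Suc l)))"
      by (subst integral_distr) auto
    also have "distr M borel (Z j (Suc l)) = law (Suc l)"
      using step j by (intro law_eq) auto
    finally have E: "expect_from M (Z j) (Suc l) (\<lambda>y. exp (m (Suc l) * Xfun M k m t (Z j) h (Suc l) y)) z =
      (\<integral>x. exp (m (Suc l) * A.Y (partition_one k t h) (Suc l) (z(Suc l := x))) \<partial>law (Suc l))" .
    have "Xfun M k m t (Z j) h l z = 1 / m (Suc l) *
        ln (expect_from M (Z j) (Suc l) (\<lambda>y. exp (m (Suc l) * Xfun M k m t (Z j) h (Suc l) y)) z)"
      using step(1) by (simp add: Xfun.simps[of M k m t "Z j" h l])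
    then show "Xfun M k m t (Z j) h l z = A.Y (partition_one k t h) l z"
      by (simp only: E ylog_step[OF step(1)] times_divide_eq_left mult_1_left)
  qed
qed

lemma columns_indep:
  assumes l: "r \<le> l" "l \<le> k"
  shows "indep_var borel (Z 1 l) borel (Z 2 l)"
proof -
  let ?X = "\<lambda>(j, l, i) \<omega>. Z j l \<omega> $ i"
  let ?J = "\<lambda>j. {j :: nat} \<times> {l} \<times> (UNIV :: 'n set)"
  have "indep_var (PiM (?J 1) (\<lambda>_. borel)) (\<lambda>\<omega>. \<lambda>x\<in>?J 1. ?X x \<omega>) (PiM (?J 2) (\<lambda>_. borel)) (\<lambda>\<omega>. \<lambda>x\<in>?J 2. ?X x \<omega>)"
    using l by (intro indep_var_restrict[OF Z_indep]) auto
  then have "indep_var borel ((\<lambda>x. \<chi> i. x (1, l, i)) \<circ> (\<lambda>\<omega>. \<lambda>x\<in>?J 1. ?X x \<omega>)) borel ((\<lambda>x. \<chi> i. x (2, l, i)) \<circ> (\<lambda>\<omega>. \<lambda>x\<in>?J 2. ?X x \<omega>))"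
    by (rule indep_var_compose) (auto intro!: borel_measurable_vec_lambda measurable_component_singleton)
  then show ?thesis
    by (simp add: comp_def)
qed

text \<open>The splitting is asserted only where the two halves of z agree below r, since halving
  the exponent there relies on both replicas having the same value. The columns being integrated
  keep this property because \<open>Z_equal\<close> holds at every point of the space.\<close>

lemma Y_pair:
  assumes "l \<le> k" and "\<And>p. p \<le> l \<Longrightarrow> p < r \<Longrightarrow> fst (z p) = snd (z p)"
  shows "B.Y (partition_two k t h) l z =
    A.Y (partition_one k t h) l (fst \<circ> z) + A.Y (partition_one k t h) l (snd \<circ> z)"
  using assms
proof (induction l arbitrary: z rule: ylog_induct)
  case last
  show ?case
    unfolding ylog_last partition_two_eq
    using partition_one_pos[of k t h "fst \<circ> z"] partition_one_pos[of k t h "snd \<circ> z"]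
    by (subst ln_mult) auto
next
  case (step l)
  let ?X = "A.Y (partition_one k t h)" and ?Y = "B.Y (partition_two k t h)"
  let ?l = "Suc l"
  have mp: "0 < m ?l" using step by (intro m_pos) auto
  have [measurable]: "?X ?l \<in> borel_measurable seqs" "?Y ?l \<in> borel_measurable seqs"
    using step by (auto intro!: A.admissible_measurable_Y B.admissible_measurable_Y admissible_partition_one admissible_partition_two)
  have [measurable]: "Z 1 ?l \<in> borel_measurable M" "Z 2 ?l \<in> borel_measurable M"
    using step by auto
  have int: "integrable M (\<lambda>\<omega>. exp (m ?l * ?X ?l (y(?l := Z j ?l \<omega>))))" if "j \<in> {1, 2}" for y j
  proof -
    have [measurable]: "Z j ?l \<in> borel_measurable M"
      using that step by (intro Z_measurable) auto
    have "integrable (distr M borel (Z j ?l)) (\<lambda>x. exp (m ?l * ?X ?l (y(?l := x))))"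
      using step admissible_partition_one[of h] law_eq[OF that, of ?l] by (simp add: A.admissible_def)
    then show ?thesis
      by (subst (asm) integrable_distr_eq) auto
  qed
  have X_step: "(\<integral>\<omega>. exp (m ?l * ?X ?l (y(?l := Z j ?l \<omega>))) \<partial>M) = exp (m ?l * ?X l y)" if "j \<in> {1, 2}" for y j
  proof -
    have [measurable]: "Z j ?l \<in> borel_measurable M"
      using that step by (intro Z_measurable) auto
    have "(\<integral>\<omega>. exp (m ?l * ?X ?l (y(?l := Z j ?l \<omega>))) \<partial>M) = (\<integral>x. exp (m ?l * ?X ?l (y(?l := x))) \<partial>distr M borel (Z j ?l))"
      by (subst integral_distr) auto
    then show ?thesis
      using step law_eq[OF that, of ?l] A.exp_Y_step[OF admissible_partition_one, of l h y] by simp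
  qed
  have upd: "fst \<circ> z(?l := (a, b)) = (fst \<circ> z)(?l := a)" "snd \<circ> z(?l := (a, b)) = (snd \<circ> z)(?l := b)" for a b
    by auto
  have "exp (n ?l * ?Y l z) = (\<integral>x. exp (n ?l * ?Y ?l (z(?l := x))) \<partial>pair_law ?l)"
    using step by (intro B.exp_Y_step admissible_partition_two)
  also have "\<dots> = (\<integral>\<omega>. exp (n ?l * ?Y ?l (z(?l := (Z 1 ?l \<omega>, Z 2 ?l \<omega>)))) \<partial>M)"
    using step by (simp add: pair_law_eq) (subst integral_distr, auto)
  also have "\<dots> = (\<integral>\<omega>. exp (n ?l * (?X ?l ((fst \<circ> z)(?l := Z 1 ?l \<omega>)) + ?X ?l ((snd \<circ> z)(?l := Z 2 ?l \<omega>)))) \<partial>M)"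
  proof (intro Bochner_Integration.integral_cong refl)
    fix \<omega> assume \<omega>: "\<omega> \<in> space M"
    have "?Y ?l (z(?l := (Z 1 ?l \<omega>, Z 2 ?l \<omega>))) =
      ?X ?l (fst \<circ> z(?l := (Z 1 ?l \<omega>, Z 2 ?l \<omega>))) + ?X ?l (snd \<circ> z(?l := (Z 1 ?l \<omega>, Z 2 ?l \<omega>)))"
      using step.prems Z_equal[OF _ \<omega>] by (intro step.IH) (auto simp: le_Suc_eq)
    then show "exp (n ?l * ?Y ?l (z(?l := (Z 1 ?l \<omega>, Z 2 ?l \<omega>)))) =
      exp (n ?l * (?X ?l ((fst \<circ> z)(?l := Z 1 ?l \<omega>)) + ?X ?l ((snd \<circ> z)(?l := Z 2 ?l \<omega>))))"
      by (simp add: upd)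
  qed
  also have "\<dots> = exp (n ?l * (?X l (fst \<circ> z) + ?X l (snd \<circ> z)))"
  proof (cases "r \<le> ?l")
    case True
    then have n: "n ?l = m ?l" by (simp add: cascade_param_def)
    have ind: "indep_var borel (\<lambda>\<omega>. exp (m ?l * ?X ?l ((fst \<circ> z)(?l := Z 1 ?l \<omega>)))) borel (\<lambda>\<omega>. exp (m ?l * ?X ?l ((snd \<circ> z)(?l := Z 2 ?l \<omega>))))"
      using indep_var_compose[OF columns_indep[of ?l], of "\<lambda>x. exp (m ?l * ?X ?l ((fst \<circ> z)(?l := x)))" borel
          "\<lambda>x. exp (m ?l * ?X ?l ((snd \<circ> z)(?l := x)))" borel] True step
      by (simp add: comp_def)
    have "(\<integral>\<omega>. exp (n ?l * (?X ?l ((fst \<circ> z)(?l := Z 1 ?l \<omega>)) + ?X ?l ((snd \<circ> z)(?l := Z 2 ?l \<omega>)))) \<partial>M) =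
      (\<integral>\<omega>. exp (m ?l * ?X ?l ((fst \<circ> z)(?l := Z 1 ?l \<omega>))) * exp (m ?l * ?X ?l ((snd \<circ> z)(?l := Z 2 ?l \<omega>))) \<partial>M)"
      by (simp add: n distrib_left exp_add)
    also have "\<dots> = exp (m ?l * ?X l (fst \<circ> z)) * exp (m ?l * ?X l (snd \<circ> z))"
      using int[of 1] int[of 2] X_step[of 1] X_step[of 2] by (subst indep_var_lebesgue_integral[OF ind]) auto
    finally show ?thesis
      by (simp add: n distrib_left exp_add)
  next
    case False
    then have n: "n ?l = m ?l / 2" by (simp add: cascade_param_def)
    have "depends_upto ?l (?X ?l)" "depends_upto l (?X l)"
      using step by (auto intro!: depends_upto_ylog depends_upto_partition_one)
    then have "?X ?l ((snd \<circ> z)(?l := a)) = ?X ?l ((fst \<circ> z)(?l := a))" "?X l (snd \<circ> z) = ?X l (fst \<circ> z)" for a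
      using step.prems False by (auto elim!: depends_uptoD)
    moreover have "(\<integral>\<omega>. exp (n ?l * (?X ?l ((fst \<circ> z)(?l := Z 1 ?l \<omega>)) + ?X ?l ((fst \<circ> z)(?l := Z 2 ?l \<omega>)))) \<partial>M) =
      (\<integral>\<omega>. exp (m ?l * ?X ?l ((fst \<circ> z)(?l := Z 1 ?l \<omega>))) \<partial>M)"
      using Z_equal[of ?l] False by (intro Bochner_Integration.integral_cong) (auto simp: n)
    ultimately show ?thesis
      using X_step[of 1 "fst \<circ> z"] by (simp add: n)
  qed
  finally have "n ?l * ?Y l z = n ?l * (?X l (fst \<circ> z) + ?X l (snd \<circ> z))"
    by simp
  moreover have "n ?l \<noteq> 0"
    using n_pos[of ?l] step(1) by simp
  ultimately show ?case
    by (rule mult_left_cancel[THEN iffD1, rotated])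
qed

end

subsection \<open>The cascade over the pairs of columns\<close>

lemma nn_integral_PiM_restrict:
  assumes M: "\<And>i. prob_space (M i)" and f [measurable]: "f \<in> borel_measurable (PiM I M)"
  shows "(\<integral>\<^sup>+x. f (restrict x I) \<partial>PiM UNIV M) = (\<integral>\<^sup>+x. f x \<partial>PiM I M)"
proof -
  have "distr (PiM UNIV M) (PiM I M) (\<lambda>x. \<lambda>i\<in>I. x i) = PiM I M"
    using distr_PiM_reindex[of UNIV M "\<lambda>i. i" I] M by simp
  then have "(\<integral>\<^sup>+x. f x \<partial>PiM I M) = (\<integral>\<^sup>+x. f x \<partial>distr (PiM UNIV M) (PiM I M) (\<lambda>x. \<lambda>i\<in>I. x i))"
    by simp
  also have "\<dots> = (\<integral>\<^sup>+x. f (restrict x I) \<partial>PiM UNIV M)"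
    by (subst nn_integral_distr) auto
  finally show ?thesis by simp
qed

text \<open>The two sides of the identity are compared through laws: independence of the field and
  the columns determines one side, independence of the field, the marks and the points the
  other.\<close>

locale cascade_model = column_model M k r m t v Z
  for M :: "'a measure" and k r m t v and Z :: "nat \<Rightarrow> nat \<Rightarrow> 'a \<Rightarrow> real ^ 'n" +
  fixes H :: "real ^ 'n \<Rightarrow> 'a \<Rightarrow> real"
    and zb :: "nat list \<Rightarrow> 'a \<Rightarrow> (real ^ 'n) \<times> (real ^ 'n)"
    and u :: "nat list \<Rightarrow> 'a \<Rightarrow> real"
  assumes H_Z_indep: "indep_pair M
        (\<Pi>\<^sub>M \<sigma>\<in>spins. borel) (\<lambda>\<omega>. \<lambda>\<sigma>\<in>spins. H \<sigma> \<omega>)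
        (\<Pi>\<^sub>M l\<in>{..k}. borel) (\<lambda>\<omega>. \<lambda>l\<in>{..k}. (Z 1 l \<omega>, Z 2 l \<omega>))"
    and u_cascade: "poisson_cascade M k (cascade_param r m) u"
    and zb_root: "zb [] = (\<lambda>\<omega>. (Z 1 0 \<omega>, Z 2 0 \<omega>))"
    and zb_copies: "\<And>\<beta>. 1 \<le> length \<beta> \<Longrightarrow> length \<beta> \<le> k \<Longrightarrow>
        distr M borel (zb \<beta>) = distr M borel (\<lambda>\<omega>. (Z 1 (length \<beta>) \<omega>, Z 2 (length \<beta>) \<omega>))"
    and zb_indep: "indep_vars (\<lambda>_. borel) zb {\<beta>. length \<beta> \<le> k}"
    and H_zb_u_indep: "indep_triple M
        (\<Pi>\<^sub>M \<sigma>\<in>spins. borel) (\<lambda>\<omega>. \<lambda>\<sigma>\<in>spins. H \<sigma> \<omega>)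
        (\<Pi>\<^sub>M \<beta>\<in>{\<beta>. length \<beta> \<le> k}. borel) (\<lambda>\<omega>. \<lambda>\<beta>\<in>{\<beta>. length \<beta> \<le> k}. zb \<beta> \<omega>)
        (\<Pi>\<^sub>M \<beta>\<in>{\<beta>. 1 \<le> length \<beta> \<and> length \<beta> \<le> k}. borel)
        (\<lambda>\<omega>. \<lambda>\<beta>\<in>{\<beta>. 1 \<le> length \<beta> \<and> length \<beta> \<le> k}. u \<beta> \<omega>)"
begin

text \<open>From depth k on there are no children, and the law of the root's children is used there
  so that every coordinate carries a probability measure.\<close>

definition points :: "nat list \<Rightarrow> (nat \<Rightarrow> real) measure" where
  "points \<beta> = distr M seqs (\<lambda>\<omega> j. u ((if length \<beta> < k then \<beta> else []) @ [j]) \<omega>)"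

lemma k_pos: "0 < k"
  using r by simp

lemma poisson_children: "length \<beta> < k \<Longrightarrow> decreasing_poisson_process M (n (Suc (length \<beta>))) (\<lambda>j. u (\<beta> @ [j]))"
  using u_cascade by (simp add: poisson_cascade_def)

lemma u_measurable: "length \<beta> < k \<Longrightarrow> u (\<beta> @ [j]) \<in> borel_measurable M"
  using poisson_children[of \<beta>] by (simp add: decreasing_poisson_process_def)

lemma children_measurable: "length \<beta> < k \<Longrightarrow> (\<lambda>\<omega> j. u (\<beta> @ [j]) \<omega>) \<in> M \<rightarrow>\<^sub>M seqs"
  by (rule measurable_PiM_single') (auto intro: u_measurable)

lemma points_eq: "length \<beta> < k \<Longrightarrow> points \<beta> = distr M seqs (\<lambda>\<omega> j. u (\<beta> @ [j]) \<omega>)"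
  by (simp add: points_def)

lemma children_pos: "length \<beta> < k \<Longrightarrow> AE \<omega> in M. \<forall>j. 0 < u (\<beta> @ [j]) \<omega>"
  using poisson_children[of \<beta>] by (auto simp: decreasing_poisson_process_def elim: eventually_mono)

sublocale C: tree_hierarchy k n pair_law points
proof (rule tree_hierarchy.intro[OF B.hierarchy_axioms], rule tree_hierarchy_axioms.intro)
  show "1 \<le> l \<Longrightarrow> l < k \<Longrightarrow> n l < n (Suc l)" for l
    by (rule n_less)
  show "prob_space (points \<beta>)" for \<beta>
    unfolding points_def using k_pos by (intro prob_space_distr children_measurable) auto
  show "sets (points \<beta>) = sets seqs" for \<beta>
    by (simp add: points_def)
  show "AE x in points \<beta>. \<forall>j. 0 < x j" if "length \<beta> < k" for \<beta>
    unfolding points_eq[OF that]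
  proof (subst AE_distr_iff)
    have [measurable]: "(\<lambda>x. x j) \<in> borel_measurable (seqs :: (nat \<Rightarrow> real) measure)" for j
      by (rule measurable_component_singleton) simp
    show "{x \<in> space (seqs :: (nat \<Rightarrow> real) measure). \<forall>j. 0 < x j} \<in> sets seqs"
      by measurable
  qed (use that children_measurable children_pos in auto)
  show "(\<integral>\<^sup>+x. eneg (\<integral>\<^sup>+j. \<phi> (x j) \<partial>count_space UNIV) \<partial>points \<beta>) =
      eneg (\<integral>\<^sup>+x. (1 - eneg (\<phi> x)) \<partial>intensity (n (Suc (length \<beta>))))"
    if \<beta>: "length \<beta> < k" and [measurable]: "\<phi> \<in> borel_measurable borel" for \<beta> \<phi>
    unfolding points_eq[OF \<beta>]
    by (subst nn_integral_distr[OF children_measurable[OF \<beta>]])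
      (auto intro!: poisson_process_laplace[OF prob_space_axioms poisson_children[OF \<beta>]])
qed

definition "nodes = {\<beta> :: nat list. length \<beta> \<le> k}"
definition "parents = {\<beta> :: nat list. length \<beta> < k}"

definition "hr \<omega> = (\<lambda>\<sigma>\<in>spins. H \<sigma> \<omega>)"
definition "zr \<omega> = (\<lambda>\<beta>\<in>nodes. zb \<beta> \<omega>)"
definition "wr \<omega> = (\<lambda>\<beta>\<in>parents. \<lambda>j. u (\<beta> @ [j]) \<omega>)"
definition "cols \<omega> = (\<lambda>l\<in>{..k}. (Z 1 l \<omega>, Z 2 l \<omega>))"

lemma hr_measurable: "hr \<in> M \<rightarrow>\<^sub>M fields"
  using H_Z_indep by (simp add: indep_pair_def hr_def[abs_def])

lemma zb_measurable: "\<beta> \<in> nodes \<Longrightarrow> zb \<beta> \<in> borel_measurable M"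
  using zb_indep by (auto simp: indep_vars_def nodes_def)

lemma zr_measurable: "zr \<in> M \<rightarrow>\<^sub>M PiM nodes (\<lambda>_. borel)"
  unfolding zr_def by (intro measurable_restrict zb_measurable)

lemma wr_measurable: "wr \<in> M \<rightarrow>\<^sub>M PiM parents (\<lambda>_. seqs)"
  unfolding wr_def by (intro measurable_restrict children_measurable) (simp add: parents_def)

lemma cols_measurable: "cols \<in> M \<rightarrow>\<^sub>M PiM {..k} (\<lambda>_. borel)"
  using H_Z_indep by (simp add: indep_pair_def cols_def[abs_def])

lemma distr_zr: "distr M (PiM nodes (\<lambda>_. borel)) zr = PiM nodes (\<lambda>\<beta>. pair_law (length \<beta>))"
proof -
  have "nodes \<noteq> {}"
    by (auto simp: nodes_def intro: exI[of _ "[]"])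
  moreover have "indep_vars (\<lambda>_. borel) zb nodes"
    using zb_indep by (simp add: nodes_def)
  ultimately have "distr M (PiM nodes (\<lambda>_. borel)) zr = PiM nodes (\<lambda>\<beta>. distr M borel (zb \<beta>))"
    unfolding zr_def by (subst (asm) indep_vars_iff_distr_eq_PiM') (auto simp: zb_measurable)
  also have "\<dots> = PiM nodes (\<lambda>\<beta>. pair_law (length \<beta>))"
  proof (intro PiM_cong refl)
    fix \<beta> assume "\<beta> \<in> nodes"
    then show "distr M borel (zb \<beta>) = pair_law (length \<beta>)"
      using zb_copies[of \<beta>] zb_root by (cases \<beta>) (auto simp: nodes_def pair_law_eq)
  qed
  finally show ?thesis .
qed

lemma distr_wr: "distr M (PiM parents (\<lambda>_. seqs)) wr = PiM parents points"
proof -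
  have "parents \<noteq> {}"
    using k_pos by (auto simp: parents_def intro: exI[of _ "[]"])
  moreover have "indep_vars (\<lambda>_. seqs) (\<lambda>\<beta> \<omega> j. u (\<beta> @ [j]) \<omega>) parents"
    using u_cascade by (simp add: poisson_cascade_def parents_def)
  ultimately have "distr M (PiM parents (\<lambda>_. seqs)) wr = PiM parents (\<lambda>\<beta>. distr M seqs (\<lambda>\<omega> j. u (\<beta> @ [j]) \<omega>))"
    unfolding wr_def by (subst (asm) indep_vars_iff_distr_eq_PiM') (auto simp: parents_def children_measurable)
  also have "\<dots> = PiM parents points"
    by (intro PiM_cong) (auto simp: parents_def points_eq)
  finally show ?thesis .
qed

text \<open>Distinct columns are functions of disjoint blocks of the independent scalar entries,
  hence independent.\<close>

lemma distr_cols: "distr M (PiM {..k} (\<lambda>_. borel)) cols = PiM {..k} pair_law"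
proof -
  let ?X = "\<lambda>(j, l, i) \<omega>. Z j l \<omega> $ i"
  \<comment> \<open>Below r the block holds only the entries of replica 1, and \<open>?f\<close>
    reads the second half from replica 1 as well; \<open>Z_equal\<close> identifies the result with
    the actual pair.\<close>
  let ?K = "\<lambda>l. {1 :: nat} \<times> {l} \<times> (UNIV :: 'n set) \<union> (if r \<le> l then {2} \<times> {l} \<times> UNIV else {})"
  let ?f = "\<lambda>l x. ((\<chi> i. x (1 :: nat, l :: nat, i :: 'n)) :: real ^ 'n, (\<chi> i. x (if r \<le> l then 2 else 1, l, i)) :: real ^ 'n)"
  let ?C = "\<lambda>l \<omega>. ?f l (\<lambda>x\<in>?K l. ?X x \<omega>)"
  have "indep_vars (\<lambda>l. PiM (?K l) (\<lambda>_. borel)) (\<lambda>l \<omega>. \<lambda>x\<in>?K l. ?X x \<omega>) {..k}"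
    using r by (intro indep_vars_restrict[OF Z_indep]) (auto simp: disjoint_family_on_def split: if_splits)
  moreover have f_meas: "?f l \<in> PiM (?K l) (\<lambda>_. borel) \<rightarrow>\<^sub>M borel" for l
  proof (rule borel_measurable_Pair)
    show "(\<lambda>x. (\<chi> i. x (1 :: nat, l, i)) :: real ^ 'n) \<in> borel_measurable (PiM (?K l) (\<lambda>_. borel))"
      by (intro borel_measurable_vec_lambda measurable_component_singleton) auto
    show "(\<lambda>x. (\<chi> i. x (if r \<le> l then 2 else 1 :: nat, l, i)) :: real ^ 'n) \<in> borel_measurable (PiM (?K l) (\<lambda>_. borel))"
      by (intro borel_measurable_vec_lambda measurable_component_singleton) auto
  qed
  ultimately have ind: "indep_vars (\<lambda>_. borel) ?C {..k}"
    by (rule indep_vars_compose2[where Y="?f" and N="\<lambda>_. borel"])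
  have C: "?C l \<omega> = (Z 1 l \<omega>, Z 2 l \<omega>)" if "\<omega> \<in> space M" for l \<omega>
    using Z_equal[of l \<omega>] that by auto
  have rv: "?C l \<in> borel_measurable M" if "l \<in> {..k}" for l
    using ind that by (auto simp: indep_vars_def)
  have "distr M (PiM {..k} (\<lambda>_. borel)) cols = distr M (PiM {..k} (\<lambda>_. borel)) (\<lambda>\<omega>. \<lambda>l\<in>{..k}. ?C l \<omega>)"
    unfolding cols_def by (intro distr_cong refl) (simp only: C)
  also have "\<dots> = PiM {..k} (\<lambda>l. distr M borel (?C l))"
    using ind by (subst (asm) indep_vars_iff_distr_eq_PiM'[OF _ rv]) auto
  also have "\<dots> = PiM {..k} pair_law"
  proof (intro PiM_cong refl)
    fix l assume "l \<in> {..k}"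
    then show "distr M borel (?C l) = pair_law l"
      by (subst pair_law_eq, simp) (intro distr_cong refl, simp only: C)
  qed
  finally show ?thesis .
qed

definition "field_law = distr M fields hr"

sublocale F: prob_space field_law
  unfolding field_law_def by (rule prob_space_distr[OF hr_measurable])

lemma sets_field_law [measurable_cong, simp]: "sets field_law = sets fields"
  by (simp add: field_law_def)

lemma nn_integral_columns:
  assumes V: "V \<in> borel_measurable (fields \<Otimes>\<^sub>M seqs)"
  shows "(\<integral>\<^sup>+\<omega>. V (hr \<omega>, cols \<omega>) \<partial>M) = (\<integral>\<^sup>+h. \<integral>\<^sup>+z. V (h, z) \<partial>PiM {..k} pair_law \<partial>field_law)"
proof -
  interpret S: prob_space "PiM {..k} pair_law"
    by (intro prob_space_PiM B.\<rho>_prob)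
  have id: "(\<lambda>z. z) \<in> PiM {..k} (\<lambda>_. borel) \<rightarrow>\<^sub>M (seqs :: (nat \<Rightarrow> (real ^ 'n) \<times> (real ^ 'n)) measure)"
    by (rule measurable_PiM_UNIV_id) auto
  have "(\<lambda>x. (fst x, snd x)) \<in> fields \<Otimes>\<^sub>M PiM {..k} (\<lambda>_. borel) \<rightarrow>\<^sub>M fields \<Otimes>\<^sub>M (seqs :: (nat \<Rightarrow> (real ^ 'n) \<times> (real ^ 'n)) measure)"
    by (intro measurable_Pair measurable_fst measurable_compose[OF measurable_snd id])
  from measurable_compose[OF this V]
  have V': "V \<in> borel_measurable (fields \<Otimes>\<^sub>M PiM {..k} (\<lambda>_. borel))"
    by simp
  have law: "distr M (fields \<Otimes>\<^sub>M PiM {..k} (\<lambda>_. borel)) (\<lambda>\<omega>. (hr \<omega>, cols \<omega>)) = field_law \<Otimes>\<^sub>M PiM {..k} pair_law"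
    unfolding field_law_def distr_cols[symmetric] unfolding hr_def[abs_def] cols_def[abs_def]
    by (rule distr_indep_pair[OF prob_space_axioms H_Z_indep])
  have "(\<integral>\<^sup>+\<omega>. V (hr \<omega>, cols \<omega>) \<partial>M) = (\<integral>\<^sup>+q. V q \<partial>distr M (fields \<Otimes>\<^sub>M PiM {..k} (\<lambda>_. borel)) (\<lambda>\<omega>. (hr \<omega>, cols \<omega>)))"
    by (subst nn_integral_distr[OF measurable_Pair[OF hr_measurable cols_measurable]]) (use V' in simp_all)
  also have "\<dots> = (\<integral>\<^sup>+h. \<integral>\<^sup>+z. V (h, z) \<partial>PiM {..k} pair_law \<partial>field_law)"
    unfolding law
  proof (rule S.nn_integral_fst[symmetric])
    have "sets (field_law \<Otimes>\<^sub>M PiM {..k} pair_law) = sets (fields \<Otimes>\<^sub>M PiM {..k} (\<lambda>_. borel))"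
      by (intro sets_pair_measure_cong sets_PiM_cong) auto
    then show "V \<in> borel_measurable (field_law \<Otimes>\<^sub>M PiM {..k} pair_law)"
      using V' by (simp cong: measurable_cong_sets)
  qed
  finally show ?thesis .
qed

text \<open>The actual variables live on nodes of depth at most k, the measures \<open>PW\<close>
  and \<open>PZ\<close> on all lists. \<open>g_restrict\<close> says that g sees only the former, so
  the two can be exchanged.\<close>

lemma nn_integral_tree:
  assumes g: "g \<in> borel_measurable (fields \<Otimes>\<^sub>M (wseqs \<Otimes>\<^sub>M seqs))"
    and g_restrict: "\<And>h w z. g (h, (restrict w parents, restrict z nodes)) = g (h, (w, z))"
  shows "(\<integral>\<^sup>+\<omega>. g (hr \<omega>, (wr \<omega>, zr \<omega>)) \<partial>M) = (\<integral>\<^sup>+h. \<integral>\<^sup>+q. g (h, q) \<partial>(C.PW \<Otimes>\<^sub>M C.PZ) \<partial>field_law)"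
proof -
  let ?LU = "{\<beta> :: nat list. 1 \<le> length \<beta> \<and> length \<beta> \<le> k}"
  let ?ur = "\<lambda>\<omega>. \<lambda>\<beta>\<in>?LU. u \<beta> \<omega>"
  let ?PU = "PiM ?LU (\<lambda>_. borel :: real measure)"
  let ?NZ = "PiM nodes (\<lambda>_. borel :: ((real ^ 'n) \<times> (real ^ 'n)) measure)" and ?NW = "PiM parents (\<lambda>_. seqs :: (nat \<Rightarrow> real) measure)"
  \<comment> \<open>Regroups points indexed by nodes other than the root into sequences indexed by
    their parents, a measurable rearrangement that preserves independence from the field and the
    marks.\<close>
  let ?\<kappa> = "\<lambda>y. \<lambda>\<beta>\<in>parents. \<lambda>j. y (\<beta> @ [j] :: nat list) :: real"
  have idZ: "(\<lambda>z. z) \<in> ?NZ \<rightarrow>\<^sub>M seqs"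
    by (rule measurable_PiM_UNIV_id) auto
  have idW: "(\<lambda>w. w) \<in> ?NW \<rightarrow>\<^sub>M wseqs"
    by (rule measurable_PiM_UNIV_id) (auto simp: space_PiM)
  have \<kappa>: "?\<kappa> \<in> ?PU \<rightarrow>\<^sub>M ?NW"
  proof (intro measurable_restrict measurable_PiM_single')
    fix \<beta> :: "nat list" and j assume "\<beta> \<in> parents"
    then show "(\<lambda>y. y (\<beta> @ [j])) \<in> borel_measurable ?PU"
      by (intro measurable_component_singleton) (auto simp: parents_def)
  qed auto
  have \<kappa>_ur: "?\<kappa> (?ur \<omega>) = wr \<omega>" for \<omega>
    by (auto simp: wr_def parents_def restrict_def fun_eq_iff)
  have ur: "?ur \<in> M \<rightarrow>\<^sub>M ?PU" and hr: "hr \<in> M \<rightarrow>\<^sub>M fields" and zr: "zr \<in> M \<rightarrow>\<^sub>M ?NZ"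
    using H_zb_u_indep hr_measurable zr_measurable by (auto simp: indep_triple_def)
  interpret LU: prob_space "distr M ?PU ?ur" by (rule prob_space_distr[OF ur])
  interpret LZ: prob_space "distr M ?NZ zr" by (rule prob_space_distr[OF zr])
  interpret ZU: pair_prob_space "distr M ?NZ zr" "distr M ?PU ?ur" ..
  have law: "distr M (fields \<Otimes>\<^sub>M (?NZ \<Otimes>\<^sub>M ?PU)) (\<lambda>\<omega>. (hr \<omega>, (zr \<omega>, ?ur \<omega>))) =
      field_law \<Otimes>\<^sub>M (distr M ?NZ zr \<Otimes>\<^sub>M distr M ?PU ?ur)"
    unfolding field_law_def hr_def[abs_def] zr_def[abs_def] nodes_def
    by (rule distr_indep_triple[OF prob_space_axioms H_zb_u_indep])
  let ?g = "\<lambda>(h, (z, y)). g (h, (?\<kappa> y, z))"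
  have g_meas: "?g \<in> borel_measurable (fields \<Otimes>\<^sub>M (?NZ \<Otimes>\<^sub>M ?PU))"
  proof -
    have "(\<lambda>x. (fst x, (?\<kappa> (snd (snd x)), fst (snd x)))) \<in> fields \<Otimes>\<^sub>M (?NZ \<Otimes>\<^sub>M ?PU) \<rightarrow>\<^sub>M fields \<Otimes>\<^sub>M (wseqs \<Otimes>\<^sub>M seqs)"
      by (intro measurable_Pair measurable_fst
          measurable_compose[OF measurable_compose[OF measurable_snd measurable_snd] measurable_compose[OF \<kappa> idW]]
          measurable_compose[OF measurable_compose[OF measurable_snd measurable_fst] idZ])
    from measurable_compose[OF this g] show ?thesis
      by (simp add: case_prod_beta')
  qed
  have "(\<integral>\<^sup>+\<omega>. g (hr \<omega>, (wr \<omega>, zr \<omega>)) \<partial>M) = (\<integral>\<^sup>+\<omega>. ?g (hr \<omega>, (zr \<omega>, ?ur \<omega>)) \<partial>M)"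
    by (simp only: split_conv \<kappa>_ur)
  also have "\<dots> = (\<integral>\<^sup>+q. ?g q \<partial>distr M (fields \<Otimes>\<^sub>M (?NZ \<Otimes>\<^sub>M ?PU)) (\<lambda>\<omega>. (hr \<omega>, (zr \<omega>, ?ur \<omega>))))"
    by (subst nn_integral_distr[OF measurable_Pair[OF hr measurable_Pair[OF zr ur]]]) (use g_meas in simp_all)
  also have "\<dots> = (\<integral>\<^sup>+h. \<integral>\<^sup>+q. ?g (h, q) \<partial>(distr M ?NZ zr \<Otimes>\<^sub>M distr M ?PU ?ur) \<partial>field_law)"
    unfolding law by (rule ZU.nn_integral_fst[symmetric]) (use g_meas in \<open>simp cong: measurable_cong_sets sets_pair_measure_cong\<close>)
  also have "\<dots> = (\<integral>\<^sup>+h. \<integral>\<^sup>+q. g (h, q) \<partial>(C.PW \<Otimes>\<^sub>M C.PZ) \<partial>field_law)"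
  proof (rule nn_integral_cong)
    fix h assume "h \<in> space field_law"
    then have h: "h \<in> space fields"
      using sets_eq_imp_space_eq[OF sets_field_law] by simp
    have gh: "(\<lambda>q. g (h, q)) \<in> borel_measurable (wseqs \<Otimes>\<^sub>M seqs)"
      using measurable_compose[OF measurable_Pair1'[OF h] g] .
    have gw: "(\<lambda>w. g (h, (w, z))) \<in> borel_measurable wseqs" for z
      using measurable_compose[OF measurable_Pair2'[of z seqs] gh] by (simp add: space_PiM)
    have gh': "(\<lambda>q. ?g (h, q)) \<in> borel_measurable (?NZ \<Otimes>\<^sub>M ?PU)"
      using measurable_compose[OF measurable_Pair1'[OF h] g_meas] .
    have "(\<integral>\<^sup>+q. ?g (h, q) \<partial>(distr M ?NZ zr \<Otimes>\<^sub>M distr M ?PU ?ur)) =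
      (\<integral>\<^sup>+z. \<integral>\<^sup>+y. ?g (h, (z, y)) \<partial>distr M ?PU ?ur \<partial>distr M ?NZ zr)"
      by (rule LU.nn_integral_fst[symmetric]) (use gh' in \<open>simp cong: measurable_cong_sets sets_pair_measure_cong\<close>)
    also have "\<dots> = (\<integral>\<^sup>+z. \<integral>\<^sup>+w. g (h, (w, z)) \<partial>C.PW \<partial>distr M ?NZ zr)"
    proof (rule nn_integral_cong)
      fix z
      have gwI: "(\<lambda>w. g (h, (w, z))) \<in> borel_measurable ?NW"
        using measurable_compose[OF idW gw] .
      have "(\<integral>\<^sup>+y. ?g (h, (z, y)) \<partial>distr M ?PU ?ur) = (\<integral>\<^sup>+\<omega>. ?g (h, (z, ?ur \<omega>)) \<partial>M)"
        by (rule nn_integral_distr[OF ur]) (use measurable_compose[OF \<kappa> gwI] in simp)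
      also have "\<dots> = (\<integral>\<^sup>+\<omega>. g (h, (wr \<omega>, z)) \<partial>M)"
        by (simp only: split_conv \<kappa>_ur)
      also have "\<dots> = (\<integral>\<^sup>+w. g (h, (w, z)) \<partial>distr M ?NW wr)"
        by (subst nn_integral_distr[OF wr_measurable]) (use gwI in simp_all)
      also have "\<dots> = (\<integral>\<^sup>+w. g (h, (restrict w parents, z)) \<partial>C.PW)"
        unfolding distr_wr C.PW_def
        by (rule nn_integral_PiM_restrict[symmetric, OF C.Q_prob]) (use gwI in \<open>simp cong: measurable_cong_sets sets_PiM_cong\<close>)
      also have "\<dots> = (\<integral>\<^sup>+w. g (h, (w, z)) \<partial>C.PW)"
      proof -
        have "g (h, (restrict w parents, z)) = g (h, (w, z))" for w
          using g_restrict[of h "restrict w parents" z] g_restrict[of h w z] by simp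
        then show ?thesis by simp
      qed
      finally show "(\<integral>\<^sup>+y. ?g (h, (z, y)) \<partial>distr M ?PU ?ur) = (\<integral>\<^sup>+w. g (h, (w, z)) \<partial>C.PW)" .
    qed
    also have "\<dots> = (\<integral>\<^sup>+z. \<integral>\<^sup>+w. g (h, (w, z)) \<partial>C.PW \<partial>PiM nodes (\<lambda>\<beta>. pair_law (length \<beta>)))"
      by (simp only: distr_zr)
    also have "\<dots> = (\<integral>\<^sup>+z. \<integral>\<^sup>+w. g (h, (w, restrict z nodes)) \<partial>C.PW \<partial>C.PZ)"
    proof -
      have "(\<lambda>(z, w). g (h, (w, z))) \<in> borel_measurable (?NZ \<Otimes>\<^sub>M C.PW)"
      proof -
        have "(\<lambda>x. (snd x, fst x)) \<in> ?NZ \<Otimes>\<^sub>M C.PW \<rightarrow>\<^sub>M wseqs \<Otimes>\<^sub>M seqs"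
          by (intro measurable_Pair measurable_compose[OF measurable_fst idZ]) simp
        from measurable_compose[OF this gh] show ?thesis
          by (simp add: case_prod_beta')
      qed
      then have "(\<lambda>z. \<integral>\<^sup>+w. g (h, (w, z)) \<partial>C.PW) \<in> borel_measurable ?NZ"
        by (rule C.PW.borel_measurable_nn_integral)
      then show ?thesis
        unfolding C.PZ_def
        by (intro nn_integral_PiM_restrict[symmetric, OF B.\<rho>_prob]) (simp cong: measurable_cong_sets sets_PiM_cong)
    qed
    also have "\<dots> = (\<integral>\<^sup>+z. \<integral>\<^sup>+w. g (h, (w, z)) \<partial>C.PW \<partial>C.PZ)"
    proof -
      have "g (h, (w, restrict z nodes)) = g (h, (w, z))" for w z
        using g_restrict[of h w "restrict z nodes"] g_restrict[of h w z] by simp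
      then show ?thesis by simp
    qed
    also have "\<dots> = (\<integral>\<^sup>+q. g (h, q) \<partial>(C.PW \<Otimes>\<^sub>M C.PZ))"
      by (rule C.PWZ.nn_integral_snd) (use gh in \<open>simp cong: measurable_cong_sets sets_pair_measure_cong\<close>)
    finally show "(\<integral>\<^sup>+q. ?g (h, q) \<partial>(distr M ?NZ zr \<Otimes>\<^sub>M distr M ?PU ?ur)) = (\<integral>\<^sup>+q. g (h, q) \<partial>(C.PW \<Otimes>\<^sub>M C.PZ))" .
  qed
  finally show ?thesis .
qed

end

lemma borel_measurable_integral_count_space:
  fixes g :: "'i \<Rightarrow> 'a \<Rightarrow> real"
  assumes A: "countable A" and g: "\<And>i. i \<in> A \<Longrightarrow> g i \<in> borel_measurable M"
  shows "(\<lambda>\<omega>. \<integral>i. g i \<omega> \<partial>count_space A) \<in> borel_measurable M"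
proof -
  interpret sigma_finite_measure "count_space A"
    by (rule sigma_finite_measure_count_space_countable[OF A])
  have "(\<lambda>x. g (snd x) (fst x)) \<in> borel_measurable (M \<Otimes>\<^sub>M count_space A)"
    by (rule measurable_compose_countable'[where g=snd and I=A])
      (auto intro!: measurable_compose[OF measurable_fst g] A)
  then show ?thesis
    by (intro borel_measurable_lebesgue_integral) (simp add: case_prod_beta')
qed

text \<open>\<open>ennreal\<close> truncates negative values, hence the maximum. Requiring no sign
  of g, the formula applies at every point of the probability space and thus gives measurability of
  the Gibbs average.\<close>

lemma integral_point_measure:
  fixes g f :: "'i \<Rightarrow> real"
  shows "(\<integral>x. f x \<partial>point_measure A (\<lambda>x. ennreal (g x))) = (\<integral>x. max 0 (g x) * f x \<partial>count_space A)"
proof -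
  have "(\<lambda>x. ennreal (g x)) = (\<lambda>x. ennreal (max 0 (g x)))"
    by (auto simp: fun_eq_iff max_def ennreal_neg)
  then have "(\<integral>x. f x \<partial>point_measure A (\<lambda>x. ennreal (g x))) = (\<integral>x. f x \<partial>density (count_space A) (\<lambda>x. ennreal (max 0 (g x))))"
    unfolding point_measure_def by simp
  also have "\<dots> = (\<integral>x. max 0 (g x) * f x \<partial>count_space A)"
    by (subst integral_density) auto
  finally show ?thesis .
qed

lemma Gamma_space_countable: "countable (Gamma_space k)"
  unfolding Gamma_space_def using countable_finite[OF finite_spins] by (intro countable_SIGMA) auto

section \<open>The weighted mean and the Gibbs average as the same ratio of tree sums\<close>

context cascade_model
begin

definition tilted_density :: "(real ^ 'n \<Rightarrow> real ^ 'n \<Rightarrow> real) \<Rightarrow> (real ^ 'n \<Rightarrow> real) \<Rightarrow> (nat \<Rightarrow> (real ^ 'n) \<times> (real ^ 'n)) \<Rightarrow> real" where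
  "tilted_density f h z = (\<Prod>p\<in>{1..k}. exp (n p * (B.Y (partition_two k t h) p z - B.Y (partition_two k t h) (p - 1) z))) *
    (gibbs_sum f k t h z / partition_two k t h z)"

lemma measurable_tilted_density:
  "(\<lambda>(h, z). tilted_density f h z) \<in> borel_measurable (fields \<Otimes>\<^sub>M seqs)"
proof -
  have Y: "(\<lambda>x. B.Y (partition_two k t (fst x)) p (snd x)) \<in> borel_measurable (fields \<Otimes>\<^sub>M seqs)" if "p \<le> k" for p
    using measurable_ylog_param[of k pair_law "partition_two k t" fields p n] that measurable_gibbs_sum[of "\<lambda>_ _. 1" k t] B.\<rho>_prob
    by (simp add: case_prod_beta')
  have g: "(\<lambda>x. gibbs_sum f k t (fst x) (snd x)) \<in> borel_measurable (fields \<Otimes>\<^sub>M seqs)" for f :: "real ^ 'n \<Rightarrow> real ^ 'n \<Rightarrow> real"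
    using measurable_gibbs_sum[of f k t] by (simp add: case_prod_beta')
  have "(\<lambda>x. tilted_density f (fst x) (snd x)) \<in> borel_measurable (fields \<Otimes>\<^sub>M seqs)"
    unfolding tilted_density_def
    by (intro borel_measurable_times borel_measurable_prod borel_measurable_divide g
        measurable_compose[OF _ borel_measurable_exp] borel_measurable_diff borel_measurable_const Y) auto
  then show ?thesis
    by (simp add: case_prod_beta')
qed

lemma tilted_density_restrict: "tilted_density f (restrict h spins) = tilted_density f h"
  unfolding tilted_density_def gibbs_sum_restrict ..

lemma tilted_density_cols: "tilted_density f (\<lambda>\<sigma>. H \<sigma> \<omega>) (\<lambda>p. (Z 1 p \<omega>, Z 2 p \<omega>)) = tilted_density f (hr \<omega>) (cols \<omega>)"
proof -
  have "B.Y (partition_two k t h) p (\<lambda>p. (Z 1 p \<omega>, Z 2 p \<omega>)) = B.Y (partition_two k t h) p (cols \<omega>)" if "p \<le> k" for p h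
    using that by (intro depends_uptoD[OF depends_upto_ylog[OF depends_upto_gibbs_sum that]]) (simp add: cols_def)
  moreover have "gibbs_sum f k t h (\<lambda>p. (Z 1 p \<omega>, Z 2 p \<omega>)) = gibbs_sum f k t h (cols \<omega>)" for f h
    by (intro depends_uptoD[OF depends_upto_gibbs_sum]) (simp add: cols_def)
  ultimately have "tilted_density f h (\<lambda>p. (Z 1 p \<omega>, Z 2 p \<omega>)) = tilted_density f h (cols \<omega>)" for h
    unfolding tilted_density_def by (intro arg_cong2[where f="(*)"] prod.cong) auto
  then show ?thesis
    by (simp add: hr_def tilted_density_restrict)
qed

text \<open>By \<open>Y_pair\<close>, an increment of Y is the sum of the two replicas' increments
  of X. For l < r these coincide and the halved parameter leaves one factor W; for l \<ge> r the
  exponential is the product of both.\<close>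

lemma mu_eq: "mu M k m t H Z r f = (\<integral>\<omega>. tilted_density f (hr \<omega>) (cols \<omega>) \<partial>M)"
  unfolding mu_def Let_def
proof (intro Bochner_Integration.integral_cong refl)
  fix \<omega> assume \<omega>: "\<omega> \<in> space M"
  let ?h = "\<lambda>\<sigma>. H \<sigma> \<omega>" and ?z = "\<lambda>p. (Z 1 p \<omega>, Z 2 p \<omega>)"
  let ?Y = "B.Y (partition_two k t ?h)" and ?X = "A.Y (partition_one k t ?h)"
  let ?W = "\<lambda>j l. Wfun M k m t (Z j) ?h l (\<lambda>p. Z j p \<omega>)"
  have comp: "fst \<circ> ?z = (\<lambda>p. Z 1 p \<omega>)" "snd \<circ> ?z = (\<lambda>p. Z 2 p \<omega>)"
    by (auto simp: comp_def)
  have Y: "?Y p ?z = ?X p (\<lambda>p. Z 1 p \<omega>) + ?X p (\<lambda>p. Z 2 p \<omega>)" if "p \<le> k" for p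
    using Y_pair[OF that, of ?z ?h] Z_equal[OF _ \<omega>] unfolding comp by simp
  have W: "?W j l = exp (m l * (?X l (\<lambda>p. Z j p \<omega>) - ?X (l - 1) (\<lambda>p. Z j p \<omega>)))" if "j \<in> {1, 2}" "l \<le> k" for j l
    using that by (simp add: Wfun_def Xfun_eq)
  have lo: "?W 1 l = exp (n l * (?Y l ?z - ?Y (l - 1) ?z))" if "l \<in> {1..<r}" for l
  proof -
    have "?X p (\<lambda>p. Z 2 p \<omega>) = ?X p (\<lambda>p. Z 1 p \<omega>)" if "p < r" for p
      using that r Z_equal[OF _ \<omega>] by (intro depends_uptoD[OF depends_upto_ylog[OF depends_upto_partition_one]]) auto
    moreover have "l \<le> k" "l - 1 \<le> k"
      using that r by auto
    ultimately show ?thesis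
      using that by (simp del: One_nat_def add: W Y cascade_param_def less_imp_diff_less)
  qed
  have hi: "?W 1 l * ?W 2 l = exp (n l * (?Y l ?z - ?Y (l - 1) ?z))" if "l \<in> {r..k}" for l
  proof -
    have "l \<le> k" "l - 1 \<le> k"
      using that by auto
    then show ?thesis
      using that by (simp del: One_nat_def add: W Y cascade_param_def exp_add[symmetric] algebra_simps)
  qed
  have split: "{1..k} = {1..<r} \<union> {r..k}"
    using r by auto
  have prod: "(\<Prod>l\<in>{1..k}. exp (n l * (?Y l ?z - ?Y (l - 1) ?z))) =
      (\<Prod>l\<in>{1..<r}. ?W 1 l) * (\<Prod>l\<in>{r..k}. ?W 1 l * ?W 2 l)"
    unfolding split by (subst prod.union_disjoint)
      (auto simp del: One_nat_def simp: lo hi intro!: arg_cong2[where f="(*)"] prod.cong)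
  have gibbs: "gibbs2 t ?h (\<Sum>l\<le>k. Z 1 l \<omega>) (\<Sum>l\<le>k. Z 2 l \<omega>) f = gibbs_sum f k t ?h ?z / partition_two k t ?h ?z"
    by (simp add: gibbs2_def gibbs_sum_def)
  show "(\<Prod>l\<in>{1..<r}. ?W 1 l) * (\<Prod>l\<in>{r..k}. ?W 1 l * ?W 2 l) *
      gibbs2 t ?h (\<Sum>l\<le>k. Z 1 l \<omega>) (\<Sum>l\<le>k. Z 2 l \<omega>) f = tilted_density f (hr \<omega>) (cols \<omega>)"
    unfolding tilted_density_cols[symmetric] unfolding tilted_density_def prod gibbs ..
qed

definition cascade_ratio :: "(real ^ 'n \<Rightarrow> real ^ 'n \<Rightarrow> real) \<Rightarrow> (real ^ 'n \<Rightarrow> real) \<Rightarrow>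
    (nat list \<Rightarrow> nat \<Rightarrow> real) \<Rightarrow> (nat list \<Rightarrow> (real ^ 'n) \<times> (real ^ 'n)) \<Rightarrow> real" where
  "cascade_ratio f h w z = enn2real (C.tsum (gibbs_sum f k t h) w z) / enn2real (C.tsum (partition_two k t h) w z)"

lemma tsum_restrict: "C.tsum F (restrict w parents) (restrict z nodes) = C.tsum F w z"
  unfolding C.tsum_def
proof (intro nn_integral_cong)
  fix \<alpha> :: "nat list" assume "\<alpha> \<in> space (count_space {\<beta>. length \<beta> = k})"
  then have \<alpha>: "length \<alpha> = k" by simp
  have "vprod (restrict w parents) \<alpha> = vprod w \<alpha>"
    using \<alpha> by (intro vprod_cong) (auto simp: parents_def)
  moreover have "path (restrict z nodes) \<alpha> = path z \<alpha>"
    using \<alpha> by (auto simp: path_def fun_eq_iff nodes_def)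
  ultimately show "ennreal (vprod (restrict w parents) \<alpha> * F (path (restrict z nodes) \<alpha>)) = ennreal (vprod w \<alpha> * F (path z \<alpha>))"
    by simp
qed

lemma measurable_tsum_gibbs:
  "(\<lambda>(h, (w, z)). C.tsum (gibbs_sum f k t h) w z) \<in> borel_measurable (fields \<Otimes>\<^sub>M (wseqs \<Otimes>\<^sub>M seqs))"
proof -
  have "(\<lambda>x. vprod (fst (snd x)) \<alpha> * gibbs_sum f k t (fst x) (path (snd (snd x)) \<alpha>)) \<in> borel_measurable (fields \<Otimes>\<^sub>M (wseqs \<Otimes>\<^sub>M seqs))" for \<alpha>
  proof (rule borel_measurable_times)
    show "(\<lambda>x. vprod (fst (snd x)) \<alpha>) \<in> borel_measurable (fields \<Otimes>\<^sub>M (wseqs \<Otimes>\<^sub>M seqs))"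
      by measurable
    have "(\<lambda>x. (fst x, path (snd (snd x)) \<alpha>)) \<in> fields \<Otimes>\<^sub>M (wseqs \<Otimes>\<^sub>M seqs) \<rightarrow>\<^sub>M fields \<Otimes>\<^sub>M (seqs :: (nat \<Rightarrow> (real ^ 'n) \<times> (real ^ 'n)) measure)"
      by (intro measurable_Pair measurable_fst measurable_compose[OF measurable_compose[OF measurable_snd measurable_snd] measurable_path])
    from measurable_compose[OF this measurable_gibbs_sum[of f k t]]
    show "(\<lambda>x. gibbs_sum f k t (fst x) (path (snd (snd x)) \<alpha>)) \<in> borel_measurable (fields \<Otimes>\<^sub>M (wseqs \<Otimes>\<^sub>M seqs))"
      by simp
  qed
  then show ?thesis
    unfolding C.tsum_def case_prod_beta'
    by (intro borel_measurable_nn_integral_count_space measurable_compose[OF _ measurable_ennreal])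
qed

lemma gibbs_sum_nonneg:
  assumes "\<And>\<sigma> \<tau>. \<sigma> \<in> spins \<Longrightarrow> \<tau> \<in> spins \<Longrightarrow> 0 \<le> f \<sigma> \<tau>"
  shows "0 \<le> gibbs_sum f k t h z"
  unfolding gibbs_sum_def using assms by (intro sum_nonneg mult_nonneg_nonneg) auto

lemma gibbs_sum_le:
  assumes "\<And>\<sigma> \<tau>. \<sigma> \<in> spins \<Longrightarrow> \<tau> \<in> spins \<Longrightarrow> f \<sigma> \<tau> \<le> 1"
  shows "gibbs_sum f k t h z \<le> partition_two k t h z"
  unfolding gibbs_sum_def using assms by (intro sum_mono mult_right_mono) auto

text \<open>With the disorder h fixed, \<open>cascade_average\<close> applies with the two-replica
  partition function as G; the law of the field is common to both sides and is integrated
  last.\<close>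

lemma nn_integral_tilted_density:
  assumes f: "\<And>\<sigma> \<tau>. \<sigma> \<in> spins \<Longrightarrow> \<tau> \<in> spins \<Longrightarrow> 0 \<le> f \<sigma> \<tau>" "\<And>\<sigma> \<tau>. \<sigma> \<in> spins \<Longrightarrow> \<tau> \<in> spins \<Longrightarrow> f \<sigma> \<tau> \<le> 1"
  shows "(\<integral>\<^sup>+\<omega>. ennreal (tilted_density f (hr \<omega>) (cols \<omega>)) \<partial>M) = (\<integral>\<^sup>+\<omega>. ennreal (cascade_ratio f (hr \<omega>) (wr \<omega>) (zr \<omega>)) \<partial>M)"
proof -
  have "(\<integral>\<^sup>+\<omega>. ennreal (tilted_density f (hr \<omega>) (cols \<omega>)) \<partial>M) =
    (\<integral>\<^sup>+h. \<integral>\<^sup>+z. ennreal (tilted_density f h z) \<partial>PiM {..k} pair_law \<partial>field_law)"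
    using nn_integral_columns[of "\<lambda>(h, z). ennreal (tilted_density f h z)"]
      measurable_compose[OF measurable_tilted_density[of f] measurable_ennreal] by (simp add: case_prod_beta')
  also have "\<dots> = (\<integral>\<^sup>+h. \<integral>\<^sup>+q. ennreal (cascade_ratio f h (fst q) (snd q)) \<partial>(C.PW \<Otimes>\<^sub>M C.PZ) \<partial>field_law)"
  proof (rule nn_integral_cong)
    fix h
    interpret P: perturbed_tree k n pair_law points "partition_two k t h" "gibbs_sum f k t h"
      by (intro perturbed_tree.intro perturbed_hierarchy.intro perturbed_hierarchy_axioms.intro
          C.tree_hierarchy_axioms B.hierarchy_axioms admissible_partition_two measurable_gibbs_sum'
          depends_upto_gibbs_sum gibbs_sum_nonneg gibbs_sum_le f)
    show "(\<integral>\<^sup>+z. ennreal (tilted_density f h z) \<partial>PiM {..k} pair_law) =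
      (\<integral>\<^sup>+q. ennreal (cascade_ratio f h (fst q) (snd q)) \<partial>(C.PW \<Otimes>\<^sub>M C.PZ))"
      using P.cascade_average by (simp add: tilted_density_def cascade_ratio_def P.weight_def)
  qed
  also have "\<dots> = (\<integral>\<^sup>+\<omega>. ennreal (cascade_ratio f (hr \<omega>) (wr \<omega>) (zr \<omega>)) \<partial>M)"
  proof -
    let ?g = "\<lambda>x. ennreal (cascade_ratio f (fst x) (fst (snd x)) (snd (snd x)))"
    have "?g \<in> borel_measurable (fields \<Otimes>\<^sub>M (wseqs \<Otimes>\<^sub>M seqs))"
      using measurable_tsum_gibbs[of f] measurable_tsum_gibbs[of "\<lambda>_ _. 1"]
      unfolding cascade_ratio_def case_prod_beta' by measurable
    from nn_integral_tree[OF this] show ?thesis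
      by (simp add: cascade_ratio_def tsum_restrict)
  qed
  finally show ?thesis .
qed

text \<open>The indicator of an infinite sum has integral 0 for every fixed h;
  \<open>nn_integral_tree\<close> carries this over to the original probability space.\<close>

lemma AE_tsum_finite:
  assumes F: "(\<lambda>(h, (w, z)). C.tsum (F h) w z) \<in> borel_measurable (fields \<Otimes>\<^sub>M (wseqs \<Otimes>\<^sub>M seqs))"
    and adm: "\<And>h. B.admissible (F h)"
  shows "AE \<omega> in M. C.tsum (F (hr \<omega>)) (wr \<omega>) (zr \<omega>) < top"
proof -
  let ?g = "\<lambda>x. (if C.tsum (F (fst x)) (fst (snd x)) (snd (snd x)) < top then 0 else 1) :: ennreal"
  have F' [measurable]: "(\<lambda>x. C.tsum (F (fst x)) (fst (snd x)) (snd (snd x))) \<in> borel_measurable (fields \<Otimes>\<^sub>M (wseqs \<Otimes>\<^sub>M seqs))"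
    using F by (simp add: case_prod_beta')
  have g: "?g \<in> borel_measurable (fields \<Otimes>\<^sub>M (wseqs \<Otimes>\<^sub>M seqs))"
    by measurable
  have "(\<integral>\<^sup>+\<omega>. ?g (hr \<omega>, (wr \<omega>, zr \<omega>)) \<partial>M) = (\<integral>\<^sup>+h. \<integral>\<^sup>+q. ?g (h, q) \<partial>(C.PW \<Otimes>\<^sub>M C.PZ) \<partial>field_law)"
    using g by (rule nn_integral_tree) (simp add: tsum_restrict)
  also have "\<dots> = (\<integral>\<^sup>+h. 0 \<partial>field_law)"
  proof (rule nn_integral_cong)
    fix h
    have "(\<integral>\<^sup>+q. ?g (h, q) \<partial>(C.PW \<Otimes>\<^sub>M C.PZ)) = (\<integral>\<^sup>+q. 0 \<partial>(C.PW \<Otimes>\<^sub>M C.PZ))"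
      using C.AE_tsum_finite[OF adm[of h]] by (intro nn_integral_cong_AE) (auto elim!: eventually_mono)
    then show "(\<integral>\<^sup>+q. ?g (h, q) \<partial>(C.PW \<Otimes>\<^sub>M C.PZ)) = 0" by simp
  qed
  finally have 0: "(\<integral>\<^sup>+\<omega>. ?g (hr \<omega>, (wr \<omega>, zr \<omega>)) \<partial>M) = 0" by simp
  have idZ: "(\<lambda>z. z) \<in> PiM nodes (\<lambda>_. borel) \<rightarrow>\<^sub>M (seqs :: (nat list \<Rightarrow> (real ^ 'n) \<times> (real ^ 'n)) measure)"
    by (rule measurable_PiM_UNIV_id) auto
  have idW: "(\<lambda>w. w) \<in> PiM parents (\<lambda>_. seqs) \<rightarrow>\<^sub>M wseqs"
    by (rule measurable_PiM_UNIV_id) (auto simp: space_PiM)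
  have "(\<lambda>\<omega>. (hr \<omega>, (wr \<omega>, zr \<omega>))) \<in> M \<rightarrow>\<^sub>M fields \<Otimes>\<^sub>M (wseqs \<Otimes>\<^sub>M seqs)"
    by (intro measurable_Pair hr_measurable measurable_compose[OF wr_measurable idW] measurable_compose[OF zr_measurable idZ])
  from measurable_compose[OF this g]
  have "AE \<omega> in M. ?g (hr \<omega>, (wr \<omega>, zr \<omega>)) = 0"
    using 0 by (subst (asm) nn_integral_0_iff_AE) auto
  then show ?thesis
    by (rule eventually_mono) (simp split: if_splits)
qed

text \<open>For the constant terminal function the tree sum is the normaliser of the cascade
  weights, so the same argument shows that the weights are well defined almost surely.\<close>

lemma admissible_one: "B.admissible (\<lambda>_. 1)"
proof (rule B.admissible_exp_bound[where \<kappa>="\<lambda>_. 0" and b=0])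
  show "integrable (pair_law l) (\<lambda>x. exp 0)" for l
  proof -
    interpret P: prob_space "pair_law l" by (rule B.\<rho>_prob)
    show ?thesis by simp
  qed
qed (auto simp: depends_upto_def)

text \<open>Where the two sums are finite, neither \<open>infsum\<close> nor \<open>enn2real\<close>
  takes a default value and the normalisations are genuine.\<close>

definition good :: "'a \<Rightarrow> bool" where
  "good \<omega> \<longleftrightarrow> (\<forall>\<beta> j. length \<beta> < k \<longrightarrow> 0 < wr \<omega> \<beta> j) \<and> C.tsum (\<lambda>_. 1) (wr \<omega>) (zr \<omega>) < top \<and>
    C.tsum (partition_two k t (hr \<omega>)) (wr \<omega>) (zr \<omega>) < top"

lemma AE_good: "AE \<omega> in M. good \<omega>"
proof -
  have "AE \<omega> in M. length \<beta> < k \<longrightarrow> (\<forall>j. 0 < u (\<beta> @ [j]) \<omega>)" for \<beta>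
    using children_pos[of \<beta>] by (cases "length \<beta> < k") auto
  then have "AE \<omega> in M. \<forall>\<beta>. length \<beta> < k \<longrightarrow> (\<forall>j. 0 < u (\<beta> @ [j]) \<omega>)"
    by (simp add: AE_all_countable)
  moreover have "AE \<omega> in M. C.tsum (\<lambda>_. 1) (wr \<omega>) (zr \<omega>) < top"
  proof (rule AE_tsum_finite[where F="\<lambda>_ _. 1"])
    show "(\<lambda>(h, (w, z)). C.tsum (\<lambda>_. 1) w z) \<in> borel_measurable (fields \<Otimes>\<^sub>M (wseqs \<Otimes>\<^sub>M seqs))"
      unfolding C.tsum_def case_prod_beta'
      by (intro borel_measurable_nn_integral_count_space measurable_compose[OF _ measurable_ennreal]) measurable
  qed (rule admissible_one)
  moreover have "AE \<omega> in M. C.tsum (partition_two k t (hr \<omega>)) (wr \<omega>) (zr \<omega>) < top"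
    by (rule AE_tsum_finite[OF measurable_tsum_gibbs admissible_partition_two])
  ultimately show ?thesis
    by eventually_elim (auto simp: good_def wr_def parents_def)
qed

definition leaf_term :: "'a \<Rightarrow> (real ^ 'n) \<times> (real ^ 'n) \<times> nat list \<Rightarrow> real" where
  "leaf_term \<omega> = (\<lambda>(\<sigma>, \<tau>, \<alpha>). vprod (wr \<omega>) \<alpha> *
    exp (Ht t (hr \<omega>) (\<Sum>p\<le>k. fst (path (zr \<omega>) \<alpha> p)) \<sigma> + Ht t (hr \<omega>) (\<Sum>p\<le>k. snd (path (zr \<omega>) \<alpha> p)) \<tau>))"

lemma leaf_term_nonneg:
  assumes "good \<omega>" "x \<in> Gamma_space k"
  shows "0 \<le> leaf_term \<omega> x"
proof -
  obtain \<sigma> \<tau> \<alpha> where x: "x = (\<sigma>, \<tau>, \<alpha>)" "length \<alpha> = k"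
    using assms(2) by (auto simp: Gamma_space_def)
  then have "0 < vprod (wr \<omega>) \<alpha>"
    using assms(1) by (intro C.vprod_pos) (auto simp: good_def)
  then show ?thesis
    by (simp add: leaf_term_def x)
qed

lemma nn_integral_leaf_term:
  assumes \<omega>: "good \<omega>" and f: "\<And>\<sigma> \<tau>. \<sigma> \<in> spins \<Longrightarrow> \<tau> \<in> spins \<Longrightarrow> 0 \<le> f \<sigma> \<tau>"
  shows "(\<integral>\<^sup>+x. ennreal (leaf_term \<omega> x * (case x of (\<sigma>, \<tau>, \<alpha>) \<Rightarrow> f \<sigma> \<tau>)) \<partial>count_space (Gamma_space k)) =
    C.tsum (gibbs_sum f k t (hr \<omega>)) (wr \<omega>) (zr \<omega>)"
proof -
  let ?e = "\<lambda>\<sigma> \<tau> \<alpha>. ennreal (leaf_term \<omega> (\<sigma>, \<tau>, \<alpha>) * f \<sigma> \<tau>)"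
  have "(\<integral>\<^sup>+x. ennreal (leaf_term \<omega> x * (case x of (\<sigma>, \<tau>, \<alpha>) \<Rightarrow> f \<sigma> \<tau>)) \<partial>count_space (Gamma_space k)) =
    (\<Sum>\<sigma>\<in>spins. \<Sum>\<tau>\<in>spins. \<integral>\<^sup>+\<alpha>. ?e \<sigma> \<tau> \<alpha> \<partial>count_space {\<alpha>. length \<alpha> = k})"
    unfolding Gamma_space_def nn_integral_count_space_Times by (simp add: nn_integral_count_space_finite)
  also have "\<dots> = (\<integral>\<^sup>+\<alpha>. (\<Sum>\<sigma>\<in>spins. \<Sum>\<tau>\<in>spins. ?e \<sigma> \<tau> \<alpha>) \<partial>count_space {\<alpha>. length \<alpha> = k})"
    by (simp add: nn_integral_sum)
  also have "\<dots> = C.tsum (gibbs_sum f k t (hr \<omega>)) (wr \<omega>) (zr \<omega>)"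
    unfolding C.tsum_def
  proof (intro nn_integral_cong)
    fix \<alpha> :: "nat list" assume "\<alpha> \<in> space (count_space {\<alpha>. length \<alpha> = k})"
    then have \<alpha>: "length \<alpha> = k" by simp
    have nonneg: "0 \<le> leaf_term \<omega> (\<sigma>, \<tau>, \<alpha>) * f \<sigma> \<tau>" if "\<sigma> \<in> spins" "\<tau> \<in> spins" for \<sigma> \<tau>
      using that \<alpha> by (intro mult_nonneg_nonneg leaf_term_nonneg[OF \<omega>] f) (auto simp: Gamma_space_def)
    have "(\<Sum>\<sigma>\<in>spins. \<Sum>\<tau>\<in>spins. ?e \<sigma> \<tau> \<alpha>) = ennreal (\<Sum>\<sigma>\<in>spins. \<Sum>\<tau>\<in>spins. leaf_term \<omega> (\<sigma>, \<tau>, \<alpha>) * f \<sigma> \<tau>)"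
      using nonneg by (simp add: sum_nonneg)
    also have "(\<Sum>\<sigma>\<in>spins. \<Sum>\<tau>\<in>spins. leaf_term \<omega> (\<sigma>, \<tau>, \<alpha>) * f \<sigma> \<tau>) =
      vprod (wr \<omega>) \<alpha> * gibbs_sum f k t (hr \<omega>) (path (zr \<omega>) \<alpha>)"
      by (simp add: leaf_term_def gibbs_sum_def sum_distrib_left mult_ac)
    finally show "(\<Sum>\<sigma>\<in>spins. \<Sum>\<tau>\<in>spins. ?e \<sigma> \<tau> \<alpha>) = ennreal (vprod (wr \<omega>) \<alpha> * gibbs_sum f k t (hr \<omega>) (path (zr \<omega>) \<alpha>))" .
  qed
  finally show ?thesis .
qed

lemma cascade_v_eq: "length \<alpha> = k \<Longrightarrow> cascade_v k u \<omega> \<alpha> = vprod (wr \<omega>) \<alpha>"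
proof -
  assume \<alpha>: "length \<alpha> = k"
  \<comment> \<open>Shift by one: level l of the product is the child chosen at position l - 1 below
    the prefix of that length.\<close>
  have "cascade_v k u \<omega> \<alpha> = (\<Prod>p<k. u (take (Suc p) \<alpha>) \<omega>)"
    unfolding cascade_v_def by (rule prod.reindex_cong[of Suc]) (auto simp: image_Suc_lessThan)
  also have "\<dots> = vprod (wr \<omega>) \<alpha>"
    unfolding vprod_def using \<alpha> by (intro prod.cong) (auto simp: wr_def parents_def take_Suc_conv_app_nth)
  finally show ?thesis .
qed

text \<open>The normaliser c of the cascade weights occurs in numerator and total mass alike and
  cancels, leaving the unnormalised products of points.\<close>

lemma Gamma_average_eq:
  assumes \<omega>: "good \<omega>"
  shows "Gamma_average k t H zb u f \<omega> =
    (\<integral>x. leaf_term \<omega> x * (case x of (\<sigma>, \<tau>, \<alpha>) \<Rightarrow> f \<sigma> \<tau>) \<partial>count_space (Gamma_space k)) /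
      enn2real (C.tsum (partition_two k t (hr \<omega>)) (wr \<omega>) (zr \<omega>))"
proof -
  let ?L = "{\<alpha> :: nat list. length \<alpha> = k}"
  define c where "c = enn2real (C.tsum (\<lambda>_. 1) (wr \<omega>) (zr \<omega>))"
  define D where "D = enn2real (C.tsum (partition_two k t (hr \<omega>)) (wr \<omega>) (zr \<omega>))"
  have w: "\<forall>\<beta> j. length \<beta> < k \<longrightarrow> 0 < wr \<omega> \<beta> j"
    using \<omega> by (simp add: good_def)
  have c_pos: "0 < c"
    using \<omega> C.tsum_pos[of "\<lambda>_. 1", OF _ w, of "zr \<omega>"] by (simp add: c_def good_def enn2real_positive_iff)
  have D_pos: "0 < D"
    using \<omega> C.tsum_pos[of "partition_two k t (hr \<omega>)", OF partition_two_pos w, of "zr \<omega>"] by (simp add: D_def good_def enn2real_positive_iff)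
  have v_nonneg: "0 \<le> vprod (wr \<omega>) \<alpha>" if "length \<alpha> = k" for \<alpha>
    using C.vprod_pos[OF w, of \<alpha>] that by simp
  have "(\<Sum>\<^sub>\<infinity>\<gamma>\<in>?L. cascade_v k u \<omega> \<gamma>) = (\<integral>\<gamma>. cascade_v k u \<omega> \<gamma> \<partial>count_space ?L)"
    by (rule infsum_eq_integral_count_space)
  also have "\<dots> = (\<integral>\<gamma>. vprod (wr \<omega>) \<gamma> \<partial>count_space ?L)"
    by (intro Bochner_Integration.integral_cong) (auto simp: cascade_v_eq)
  also have "\<dots> = c"
    unfolding c_def C.tsum_def using v_nonneg by (subst integral_eq_nn_integral) (auto simp: AE_count_space)
  finally have sum_v: "(\<Sum>\<^sub>\<infinity>\<gamma>\<in>?L. cascade_v k u \<omega> \<gamma>) = c" .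
  have unnorm: "Gamma_unnormalized k t H zb u \<omega> x = leaf_term \<omega> x / c" if x_in: "x \<in> Gamma_space k" for x
  proof -
    obtain \<sigma> \<tau> \<alpha> where x: "x = (\<sigma>, \<tau>, \<alpha>)" "\<sigma> \<in> spins" "\<tau> \<in> spins" "length \<alpha> = k"
      using x_in by (auto simp: Gamma_space_def)
    have "path (zr \<omega>) \<alpha> p = zb (take p \<alpha>) \<omega>" for p
      using x by (simp add: path_def zr_def nodes_def)
    then show ?thesis
      using x by (simp add: Gamma_unnormalized_def leaf_term_def cascade_weight_def sum_v cascade_v_eq Ht_def hr_def)
  qed
  have "(\<Sum>\<^sub>\<infinity>y\<in>Gamma_space k. Gamma_unnormalized k t H zb u \<omega> y) = (\<integral>y. Gamma_unnormalized k t H zb u \<omega> y \<partial>count_space (Gamma_space k))"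
    by (rule infsum_eq_integral_count_space)
  also have "\<dots> = (\<integral>y. leaf_term \<omega> y / c \<partial>count_space (Gamma_space k))"
    by (intro Bochner_Integration.integral_cong) (auto simp: unnorm)
  also have "\<dots> = (\<integral>y. leaf_term \<omega> y \<partial>count_space (Gamma_space k)) / c"
    by simp
  also have "(\<integral>y. leaf_term \<omega> y \<partial>count_space (Gamma_space k)) = D"
    using nn_integral_leaf_term[OF \<omega>, of "\<lambda>_ _. 1"] leaf_term_nonneg[OF \<omega>]
    unfolding D_def by (subst integral_eq_nn_integral) (auto simp: AE_count_space case_prod_beta')
  finally have total: "(\<Sum>\<^sub>\<infinity>y\<in>Gamma_space k. Gamma_unnormalized k t H zb u \<omega> y) = D / c" .
  have "Gamma_average k t H zb u f \<omega> =
    (\<integral>x. max 0 (Gamma_unnormalized k t H zb u \<omega> x / (D / c)) * (case x of (\<sigma>, \<tau>, \<alpha>) \<Rightarrow> f \<sigma> \<tau>) \<partial>count_space (Gamma_space k))"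
    unfolding Gamma_average_def Gamma_measure_def total integral_point_measure ..
  also have "\<dots> = (\<integral>x. leaf_term \<omega> x * (case x of (\<sigma>, \<tau>, \<alpha>) \<Rightarrow> f \<sigma> \<tau>) / D \<partial>count_space (Gamma_space k))"
    using c_pos D_pos leaf_term_nonneg[OF \<omega>] by (intro Bochner_Integration.integral_cong) (auto simp: unnorm)
  also have "\<dots> = (\<integral>x. leaf_term \<omega> x * (case x of (\<sigma>, \<tau>, \<alpha>) \<Rightarrow> f \<sigma> \<tau>) \<partial>count_space (Gamma_space k)) / D"
    by simp
  finally show ?thesis
    unfolding D_def .
qed

lemma leaf_term_integrable:
  assumes \<omega>: "good \<omega>" and f: "\<And>\<sigma> \<tau>. \<sigma> \<in> spins \<Longrightarrow> \<tau> \<in> spins \<Longrightarrow> 0 \<le> f \<sigma> \<tau>" "\<And>\<sigma> \<tau>. \<sigma> \<in> spins \<Longrightarrow> \<tau> \<in> spins \<Longrightarrow> f \<sigma> \<tau> \<le> 1"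
  shows "integrable (count_space (Gamma_space k)) (\<lambda>x. leaf_term \<omega> x * (case x of (\<sigma>, \<tau>, \<alpha>) \<Rightarrow> f \<sigma> \<tau>))"
    and "Gamma_average k t H zb u f \<omega> = cascade_ratio f (hr \<omega>) (wr \<omega>) (zr \<omega>)"
    and "0 \<le> cascade_ratio f (hr \<omega>) (wr \<omega>) (zr \<omega>)" "cascade_ratio f (hr \<omega>) (wr \<omega>) (zr \<omega>) \<le> 1"
proof -
  let ?g = "\<lambda>x. leaf_term \<omega> x * (case x of (\<sigma>, \<tau>, \<alpha>) \<Rightarrow> f \<sigma> \<tau>)"
  have w: "\<forall>\<beta> j. length \<beta> < k \<longrightarrow> 0 < wr \<omega> \<beta> j"
    using \<omega> by (simp add: good_def)
  have nonneg: "0 \<le> ?g x" if "x \<in> Gamma_space k" for x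
    using that f(1) by (intro mult_nonneg_nonneg leaf_term_nonneg[OF \<omega>]) (auto simp: Gamma_space_def)
  have le: "C.tsum (gibbs_sum f k t (hr \<omega>)) (wr \<omega>) (zr \<omega>) \<le> C.tsum (partition_two k t (hr \<omega>)) (wr \<omega>) (zr \<omega>)"
    by (rule C.tsum_mono[OF _ w]) (rule gibbs_sum_le[OF f(2)])
  have fin: "C.tsum (partition_two k t (hr \<omega>)) (wr \<omega>) (zr \<omega>) < top"
    using \<omega> by (simp add: good_def)
  show "integrable (count_space (Gamma_space k)) ?g"
  proof (rule integrableI_nonneg)
    show "(\<integral>\<^sup>+x. ennreal (?g x) \<partial>count_space (Gamma_space k)) < \<infinity>"
      using le_less_trans[OF le fin] nn_integral_leaf_term[OF \<omega> f(1)] by simp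
  qed (use nonneg in \<open>auto simp: AE_count_space\<close>)
  show "Gamma_average k t H zb u f \<omega> = cascade_ratio f (hr \<omega>) (wr \<omega>) (zr \<omega>)"
    unfolding Gamma_average_eq[OF \<omega>] cascade_ratio_def
    using nn_integral_leaf_term[OF \<omega> f(1)] nonneg by (subst integral_eq_nn_integral) (auto simp: AE_count_space)
  show "0 \<le> cascade_ratio f (hr \<omega>) (wr \<omega>) (zr \<omega>)"
    by (simp add: cascade_ratio_def)
  show "cascade_ratio f (hr \<omega>) (wr \<omega>) (zr \<omega>) \<le> 1"
    using enn2real_mono[OF le fin] by (simp add: cascade_ratio_def divide_le_eq_1 less_le)
qed

text \<open>Agreement with \<open>cascade_ratio\<close> holds only almost everywhere, so
  measurability is derived from the definition itself, as a composition of integrals over counting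
  measures.\<close>

lemma Gamma_average_measurable: "Gamma_average k t H zb u f \<in> borel_measurable M"
proof -
  have H_meas: "H \<sigma> \<in> borel_measurable M" if "\<sigma> \<in> spins" for \<sigma>
  proof -
    have "(\<lambda>\<omega>. hr \<omega> \<sigma>) \<in> borel_measurable M"
      by (rule measurable_compose[OF hr_measurable measurable_component_singleton[OF that]])
    with that show ?thesis by (simp add: hr_def)
  qed
  have v: "(\<lambda>\<omega>. cascade_v k u \<omega> \<alpha>) \<in> borel_measurable M" if "length \<alpha> = k" for \<alpha>
    unfolding cascade_v_def
  proof (rule borel_measurable_prod)
    fix l assume l: "l \<in> {1..k}"
    then have "take l \<alpha> = take (l - 1) \<alpha> @ [\<alpha> ! (l - 1)]"
      using that take_Suc_conv_app_nth[of "l - 1" \<alpha>] by (cases l) auto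
    moreover have "u (take (l - 1) \<alpha> @ [\<alpha> ! (l - 1)]) \<in> borel_measurable M"
      using l that by (intro u_measurable) auto
    ultimately show "(\<lambda>\<omega>. u (take l \<alpha>) \<omega>) \<in> borel_measurable M"
      by simp
  qed
  have weight: "(\<lambda>\<omega>. cascade_weight k u \<omega> \<alpha>) \<in> borel_measurable M" if "length \<alpha> = k" for \<alpha>
    unfolding cascade_weight_def infsum_eq_integral_count_space
    using that by (intro borel_measurable_divide v borel_measurable_integral_count_space) auto
  have unnorm: "(\<lambda>\<omega>. Gamma_unnormalized k t H zb u \<omega> x) \<in> borel_measurable M" if x_in: "x \<in> Gamma_space k" for x
  proof -
    obtain \<sigma> \<tau> \<alpha> where x: "x = (\<sigma>, \<tau>, \<alpha>)" "\<sigma> \<in> spins" "\<tau> \<in> spins" "length \<alpha> = k"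
      using x_in by (auto simp: Gamma_space_def)
    note weight[OF x(4), measurable] H_meas[OF x(2), measurable] H_meas[OF x(3), measurable]
    have [measurable]: "zb (take p \<alpha>) \<in> borel_measurable M" for p
      using x(4) by (intro zb_measurable) (simp add: nodes_def)
    have [measurable]: "(\<lambda>\<omega>. fst (zb (take p \<alpha>) \<omega>)) \<in> borel_measurable M" "(\<lambda>\<omega>. snd (zb (take p \<alpha>) \<omega>)) \<in> borel_measurable M" for p
      by measurable
    show ?thesis
      unfolding x(1) Gamma_unnormalized_def split_conv Ht_def by measurable
  qed
  show ?thesis
    unfolding Gamma_average_def[abs_def] Gamma_measure_def integral_point_measure infsum_eq_integral_count_space
    by (intro borel_measurable_integral_count_space Gamma_space_countable borel_measurable_times
        borel_measurable_max borel_measurable_const borel_measurable_divide unnorm)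
qed

lemma tilted_density_measurable: "(\<lambda>\<omega>. tilted_density f (hr \<omega>) (cols \<omega>)) \<in> borel_measurable M"
proof -
  have id: "(\<lambda>z. z) \<in> PiM {..k} (\<lambda>_. borel) \<rightarrow>\<^sub>M (seqs :: (nat \<Rightarrow> (real ^ 'n) \<times> (real ^ 'n)) measure)"
    by (rule measurable_PiM_UNIV_id) auto
  have "(\<lambda>\<omega>. (hr \<omega>, cols \<omega>)) \<in> M \<rightarrow>\<^sub>M fields \<Otimes>\<^sub>M (seqs :: (nat \<Rightarrow> (real ^ 'n) \<times> (real ^ 'n)) measure)"
    by (intro measurable_Pair hr_measurable measurable_compose[OF cols_measurable id])
  from measurable_compose[OF this measurable_tilted_density] show ?thesis
    by simp
qed

lemma tilted_density_nonneg:
  assumes "\<And>\<sigma> \<tau>. \<sigma> \<in> spins \<Longrightarrow> \<tau> \<in> spins \<Longrightarrow> 0 \<le> f \<sigma> \<tau>"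
  shows "0 \<le> tilted_density f h z"
  unfolding tilted_density_def
  by (intro mult_nonneg_nonneg divide_nonneg_nonneg prod_nonneg gibbs_sum_nonneg assms) auto

text \<open>Values in [0,1] place the perturbing Gibbs sum between 0 and the partition function, the
  situation of \<open>cascade_average\<close>, and make the Gibbs average bounded.\<close>

lemma unit_interval_case:
  assumes f: "\<And>\<sigma> \<tau>. \<sigma> \<in> spins \<Longrightarrow> \<tau> \<in> spins \<Longrightarrow> 0 \<le> f \<sigma> \<tau>" "\<And>\<sigma> \<tau>. \<sigma> \<in> spins \<Longrightarrow> \<tau> \<in> spins \<Longrightarrow> f \<sigma> \<tau> \<le> 1"
  shows "integrable M (\<lambda>\<omega>. tilted_density f (hr \<omega>) (cols \<omega>))"
    and "integrable M (Gamma_average k t H zb u f)"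
    and "(\<integral>\<omega>. tilted_density f (hr \<omega>) (cols \<omega>) \<partial>M) = (\<integral>\<omega>. Gamma_average k t H zb u f \<omega> \<partial>M)"
proof -
  let ?A = "Gamma_average k t H zb u f"
  have A: "AE \<omega> in M. ?A \<omega> = cascade_ratio f (hr \<omega>) (wr \<omega>) (zr \<omega>) \<and> 0 \<le> ?A \<omega> \<and> ?A \<omega> \<le> 1"
    using AE_good by (rule eventually_mono) (simp add: leaf_term_integrable[OF _ f])
  have eq: "(\<integral>\<^sup>+\<omega>. ennreal (?A \<omega>) \<partial>M) = (\<integral>\<^sup>+\<omega>. ennreal (tilted_density f (hr \<omega>) (cols \<omega>)) \<partial>M)"
    using A by (subst nn_integral_tilted_density) (auto intro: f intro!: nn_integral_cong_AE elim!: eventually_mono)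
  have "(\<integral>\<^sup>+\<omega>. ennreal (?A \<omega>) \<partial>M) \<le> (\<integral>\<^sup>+\<omega>. 1 \<partial>M)"
    using A by (intro nn_integral_mono_AE) (auto elim!: eventually_mono simp: ennreal_le_1)
  then have fin: "(\<integral>\<^sup>+\<omega>. ennreal (?A \<omega>) \<partial>M) < \<infinity>"
    by (rule le_less_trans) (simp add: emeasure_space_1)
  show "integrable M (\<lambda>\<omega>. tilted_density f (hr \<omega>) (cols \<omega>))"
    using fin eq f(1) by (intro integrableI_nonneg tilted_density_measurable) (auto intro!: tilted_density_nonneg)
  show "integrable M ?A"
    using fin A by (intro integrableI_nonneg Gamma_average_measurable) (auto elim: eventually_mono)
  show "(\<integral>\<omega>. tilted_density f (hr \<omega>) (cols \<omega>) \<partial>M) = (\<integral>\<omega>. ?A \<omega> \<partial>M)"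
  proof -
    have "(\<integral>\<omega>. tilted_density f (hr \<omega>) (cols \<omega>) \<partial>M) = enn2real (\<integral>\<^sup>+\<omega>. ennreal (tilted_density f (hr \<omega>) (cols \<omega>)) \<partial>M)"
      by (intro integral_eq_nn_integral tilted_density_measurable AE_I2 tilted_density_nonneg f(1))
    also have "\<dots> = enn2real (\<integral>\<^sup>+\<omega>. ennreal (?A \<omega>) \<partial>M)"
      by (simp only: eq)
    also have "\<dots> = (\<integral>\<omega>. ?A \<omega> \<partial>M)"
      using A by (intro integral_eq_nn_integral[symmetric] Gamma_average_measurable) (erule eventually_mono, simp)
    finally show ?thesis .
  qed
qed

theorem mu_eq_Gamma_average: "mu M k m t H Z r f = (\<integral>\<omega>. Gamma_average k t H zb u f \<omega> \<partial>M)"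
proof -
  \<comment> \<open>A bound for |f| on pairs of configurations; the summand 1 keeps it positive when
    f vanishes. The map (f + c)/(2c) then takes values in [0,1].\<close>
  define c where "c = 1 + (\<Sum>\<sigma>\<in>spins. \<Sum>\<tau>\<in>spins. \<bar>f \<sigma> \<tau>\<bar>)"
  have c: "0 < c"
    by (simp add: c_def add_pos_nonneg sum_nonneg)
  have f_le: "\<bar>f \<sigma> \<tau>\<bar> \<le> c" if "\<sigma> \<in> spins" "\<tau> \<in> spins" for \<sigma> \<tau>
  proof -
    have "\<bar>f \<sigma> \<tau>\<bar> \<le> (\<Sum>\<tau>\<in>spins. \<bar>f \<sigma> \<tau>\<bar>)"
      using that by (intro member_le_sum[of \<tau> spins "\<lambda>\<tau>. \<bar>f \<sigma> \<tau>\<bar>"]) auto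
    also have "\<dots> \<le> (\<Sum>\<sigma>\<in>spins. \<Sum>\<tau>\<in>spins. \<bar>f \<sigma> \<tau>\<bar>)"
      using that by (intro member_le_sum[of \<sigma> spins "\<lambda>\<sigma>. \<Sum>\<tau>\<in>spins. \<bar>f \<sigma> \<tau>\<bar>"]) (auto intro: sum_nonneg)
    finally show ?thesis by (simp add: c_def)
  qed
  define g where "g \<sigma> \<tau> = (f \<sigma> \<tau> + c) / (2 * c)" for \<sigma> \<tau>
  have g: "0 \<le> g \<sigma> \<tau>" "g \<sigma> \<tau> \<le> 1" if "\<sigma> \<in> spins" "\<tau> \<in> spins" for \<sigma> \<tau>
    using f_le[OF that] c by (auto simp: g_def divide_le_eq)
  have f_eq: "f \<sigma> \<tau> = 2 * c * g \<sigma> \<tau> - c * 1" for \<sigma> \<tau>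
    using c by (simp add: g_def)
  note unit_g = unit_interval_case[of g, OF g] and unit_1 = unit_interval_case[of "\<lambda>_ _. 1"]
  \<comment> \<open>Everything is linear in f, so the affine change is undone term by term; the
    constant part is the case f = 1.\<close>
  have "gibbs_sum f k t h z = 2 * c * gibbs_sum g k t h z - c * partition_two k t h z" for h z
    unfolding gibbs_sum_def by (subst f_eq) (simp add: left_diff_distrib sum_subtractf sum_distrib_left mult.assoc)
  then have density: "tilted_density f h z = 2 * c * tilted_density g h z - c * tilted_density (\<lambda>_ _. 1) h z" for h z
    by (simp add: tilted_density_def diff_divide_distrib right_diff_distrib)
  have average: "AE \<omega> in M. Gamma_average k t H zb u f \<omega> =
      2 * c * Gamma_average k t H zb u g \<omega> - c * Gamma_average k t H zb u (\<lambda>_ _. 1) \<omega>"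
    using AE_good
  proof (rule eventually_mono)
    fix \<omega> assume \<omega>: "good \<omega>"
    have "(\<integral>x. leaf_term \<omega> x * (case x of (\<sigma>, \<tau>, \<alpha>) \<Rightarrow> f \<sigma> \<tau>) \<partial>count_space (Gamma_space k)) =
      (\<integral>x. 2 * c * (leaf_term \<omega> x * (case x of (\<sigma>, \<tau>, \<alpha>) \<Rightarrow> g \<sigma> \<tau>)) - c * (leaf_term \<omega> x * (case x of (\<sigma>, \<tau>, \<alpha>) \<Rightarrow> 1)) \<partial>count_space (Gamma_space k))"
      by (intro Bochner_Integration.integral_cong refl) (subst f_eq, simp add: case_prod_beta' algebra_simps)
    also have "\<dots> = 2 * c * (\<integral>x. leaf_term \<omega> x * (case x of (\<sigma>, \<tau>, \<alpha>) \<Rightarrow> g \<sigma> \<tau>) \<partial>count_space (Gamma_space k)) -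
        c * (\<integral>x. leaf_term \<omega> x * (case x of (\<sigma>, \<tau>, \<alpha>) \<Rightarrow> 1) \<partial>count_space (Gamma_space k))"
      using leaf_term_integrable(1)[OF \<omega>, of g] leaf_term_integrable(1)[OF \<omega>, of "\<lambda>_ _. 1"] g
      by (subst Bochner_Integration.integral_diff) auto
    finally show "Gamma_average k t H zb u f \<omega> =
        2 * c * Gamma_average k t H zb u g \<omega> - c * Gamma_average k t H zb u (\<lambda>_ _. 1) \<omega>"
      by (simp add: Gamma_average_eq[OF \<omega>] diff_divide_distrib)
  qed
  have "mu M k m t H Z r f = (\<integral>\<omega>. 2 * c * tilted_density g (hr \<omega>) (cols \<omega>) - c * tilted_density (\<lambda>_ _. 1) (hr \<omega>) (cols \<omega>) \<partial>M)"
    by (simp add: mu_eq density)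
  also have "\<dots> = 2 * c * (\<integral>\<omega>. tilted_density g (hr \<omega>) (cols \<omega>) \<partial>M) - c * (\<integral>\<omega>. tilted_density (\<lambda>_ _. 1) (hr \<omega>) (cols \<omega>) \<partial>M)"
    using unit_g(1) unit_1(1) by (subst Bochner_Integration.integral_diff) auto
  also have "\<dots> = 2 * c * (\<integral>\<omega>. Gamma_average k t H zb u g \<omega> \<partial>M) - c * (\<integral>\<omega>. Gamma_average k t H zb u (\<lambda>_ _. 1) \<omega> \<partial>M)"
    using unit_g(3) unit_1(3) by simp
  also have "\<dots> = (\<integral>\<omega>. 2 * c * Gamma_average k t H zb u g \<omega> - c * Gamma_average k t H zb u (\<lambda>_ _. 1) \<omega> \<partial>M)"
    using unit_g(2) unit_1(2) by (subst Bochner_Integration.integral_diff) auto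
  also have "\<dots> = (\<integral>\<omega>. Gamma_average k t H zb u f \<omega> \<partial>M)"
    by (intro integral_cong_AE eventually_mono[OF average] borel_measurable_diff borel_measurable_times
        borel_measurable_const Gamma_average_measurable) simp
  finally show ?thesis .
qed

end

theorem theorem5:
  fixes M :: "'a measure"
    and \<xi> :: "real \<Rightarrow> real"
    and k r :: nat
    and m q :: "nat \<Rightarrow> real"
    and t :: real
    and H :: "real ^ 'n \<Rightarrow> 'a \<Rightarrow> real"
    and Z :: "nat \<Rightarrow> nat \<Rightarrow> 'a \<Rightarrow> real ^ 'n"
    and zb :: "nat list \<Rightarrow> 'a \<Rightarrow> (real ^ 'n) \<times> (real ^ 'n)"
    and u :: "nat list \<Rightarrow> 'a \<Rightarrow> real"
  assumes M: "prob_space M"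
    and xi: "smooth \<xi>" "convex_on UNIV \<xi>" "\<xi> 0 = 0"
    and k: "1 \<le> k" and r: "1 \<le> r" "r \<le> k" and t: "0 \<le> t" "t \<le> 1"
    and m: "m 0 = 0" "\<And>l. l < k \<Longrightarrow> m l < m (l + 1)" "m k < 1"
    and q: "q 0 = 0" "\<And>l. l \<le> k \<Longrightarrow> q l < q (l + 1)" "q (k + 1) = 1"
    and H_gaussian: "centered_gaussian_process M spins H"
    and H_cov: "\<And>\<sigma> \<tau>. \<sigma> \<in> spins \<Longrightarrow> \<tau> \<in> spins \<Longrightarrow>
        prob_space.expectation M (\<lambda>\<omega>. H \<sigma> \<omega> * H \<tau> \<omega>) = real CARD('n) * \<xi> (overlap \<sigma> \<tau>)"
    and Z_gaussian: "\<And>j l i. j \<in> {1, 2} \<Longrightarrow> l \<le> k \<Longrightarrow>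
        centered_gaussian M (deriv \<xi> (q (l + 1)) - deriv \<xi> (q l)) (\<lambda>\<omega>. Z j l \<omega> $ i)"
    and Z_equal: "\<And>l \<omega>. l < r \<Longrightarrow> \<omega> \<in> space M \<Longrightarrow> Z 1 l \<omega> = Z 2 l \<omega>"
    and Z_indep: "prob_space.indep_vars M (\<lambda>_. borel) (\<lambda>(j, l, i) \<omega>. Z j l \<omega> $ i)
        ({1} \<times> {..k} \<times> UNIV \<union> {2} \<times> {r..k} \<times> UNIV)"
    and H_Z_indep: "indep_pair M
        (\<Pi>\<^sub>M \<sigma>\<in>spins. borel) (\<lambda>\<omega>. \<lambda>\<sigma>\<in>spins. H \<sigma> \<omega>)
        (\<Pi>\<^sub>M l\<in>{..k}. borel) (\<lambda>\<omega>. \<lambda>l\<in>{..k}. (Z 1 l \<omega>, Z 2 l \<omega>))"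
    and u_cascade: "poisson_cascade M k (cascade_param r m) u"
    and zb_root: "zb [] = (\<lambda>\<omega>. (Z 1 0 \<omega>, Z 2 0 \<omega>))"
    and zb_copies: "\<And>\<beta>. 1 \<le> length \<beta> \<Longrightarrow> length \<beta> \<le> k \<Longrightarrow>
        distr M borel (zb \<beta>) = distr M borel (\<lambda>\<omega>. (Z 1 (length \<beta>) \<omega>, Z 2 (length \<beta>) \<omega>))"
    and zb_indep: "prob_space.indep_vars M (\<lambda>_. borel) zb {\<beta>. length \<beta> \<le> k}"
    and H_zb_u_indep: "indep_triple M
        (\<Pi>\<^sub>M \<sigma>\<in>spins. borel) (\<lambda>\<omega>. \<lambda>\<sigma>\<in>spins. H \<sigma> \<omega>)
        (\<Pi>\<^sub>M \<beta>\<in>{\<beta>. length \<beta> \<le> k}. borel) (\<lambda>\<omega>. \<lambda>\<beta>\<in>{\<beta>. length \<beta> \<le> k}. zb \<beta> \<omega>)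
        (\<Pi>\<^sub>M \<beta>\<in>{\<beta>. 1 \<le> length \<beta> \<and> length \<beta> \<le> k}. borel)
        (\<lambda>\<omega>. \<lambda>\<beta>\<in>{\<beta>. 1 \<le> length \<beta> \<and> length \<beta> \<le> k}. u \<beta> \<omega>)"
  shows "(\<forall>f :: real ^ 'n \<Rightarrow> real ^ 'n \<Rightarrow> real.
            mu M k m t H Z r f = prob_space.expectation M (Gamma_average k t H zb u f)) \<and>
         mu M k m t H Z r (\<lambda>\<sigma> \<tau>. Delta \<xi> (overlap \<sigma> \<tau>) (q r)) =
           prob_space.expectation M
             (Gamma_average k t H zb u (\<lambda>\<sigma> \<tau>. Delta \<xi> (overlap \<sigma> \<tau>) (q r)))"
proof -
  interpret prob_space M by (rule M)
  interpret cascade_model M k r m t "\<lambda>l. deriv \<xi> (q (l + 1)) - deriv \<xi> (q l)" Z H zb u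
    by (intro cascade_model.intro column_model.intro column_model_axioms.intro cascade_model_axioms.intro)
      (fact M r t m Z_gaussian Z_equal Z_indep H_Z_indep u_cascade zb_root zb_copies zb_indep H_zb_u_indep)+
  show ?thesis
    by (simp add: mu_eq_Gamma_average)
qed

end
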